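(* Let $d\in\{1,2,3\}$, let $V$ be the harmonic potential on $\mathbb R^d$ given in the context, let $\delta>0$ and $\beta>0$, let $\phi_g\in S$ be the positive ground state of $E$ (depending on $\beta,\delta$), and for $\varepsilon>0$ (depending on $\beta$ and $\delta$ as specified below) let $\phi_g^\varepsilon(\mathbf x)=\varepsilon^{-d/2}\phi_g(\mathbf x/\varepsilon)\in S$ and $\rho_g^\varepsilon=|\phi_g^\varepsilon|^2$. (1) If $\beta\to+\infty$ and $\delta=o\big(\beta^{\frac{4+d}{2+d}}\big)$, set $\varepsilon=\beta^{-\frac1{2+d}}$. Then, as $\beta\to+\infty$ ($\varepsilon\to0^+$), $\rho_g^\varepsilon\to\rho_\infty=|\phi_\infty|^2$ in $L^2$, where $\phi_\infty$ is the unique nonnegative minimizer of $E_1$ subject to $\|\phi\|=1$. (2) If $\beta\to+\infty$ and $\lim_{\beta\to+\infty}\delta/\beta^{\frac{4+d}{2+d}}=\delta_\infty>0$, set $\varepsilon=\beta^{-\frac1{2+d}}$. Then, as $\varepsilon\to0^+$, $\rho_g^\varepsilon\to\rho_\infty=|\phi_\infty|^2$ in $H^1$, where $\phi_\infty$ is the unique nonnegative minimizer of $E_2$ subject to $\|\phi\|=1$. (3) If $\beta\to+\infty$ and $\delta/\beta^{\frac{4+d}{2+d}}\to+\infty$, set $\varepsilon=\delta^{-\frac1{4+d}}$. Then, as $\delta\to+\infty$ ($\varepsilon\to0^+$), $\rho_g^\varepsilon\to\rho_\infty=|\phi_\infty|^2$ in $H^1$, where $\phi_\infty$ is the unique nonnegative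 minimizer of $E_3$ subject to $\|\phi\|=1$.
   Context: $\|\cdot\|$ denotes the $L^2(\mathbb R^d)$ norm. The harmonic potential is $V(\mathbf x)=\frac12\gamma_x^2x^2$ ($d=1$), $\frac12(\gamma_x^2x^2+\gamma_y^2y^2)$ ($d=2$), $\frac12(\gamma_x^2x^2+\gamma_y^2y^2+\gamma_z^2z^2)$ ($d=3$), with positive constants $\gamma_x,\gamma_y,\gamma_z$. The energy is $$E(\phi)=\int_{\mathbb R^d}\Big[\tfrac12|\nabla\phi|^2+V(\mathbf x)|\phi|^2+\tfrac{\beta}{2}|\phi|^4+\tfrac{\delta}{2}\big|\nabla|\phi|^2\big|^2\Big]\,d\mathbf x ,$$ $S=\{\phi\in H^1(\mathbb R^d):\ \int V|\phi|^2<\infty,\ \|\phi\|=1,\ E(\phi)<\infty\}$, and a ground state is a minimizer of $E$ over $S$. The limiting functionals are $$E_1(\phi)=\int_{\mathbb R^d}\Big(V|\phi|^2+\tfrac12|\phi|^4\Big)d\mathbf x,\quad E_2(\phi)=\int_{\mathbb R^d}\Big(V|\phi|^2+\tfrac12|\phi|^4+\tfrac{\delta_\infty}{2}\big|\nabla|\phi|^2\big|^2\Big)d\mathbf x,$$ $$E_3(\phi)=\int_{\mathbb R^d}\Big(V|\phi|^2+\tfrac12\big|\nabla|\phi|^2\big|^2\Big)d\mathbf x,$$ each minimized over $\phi$ with $\|\phi\|=1$ and all its terms finite. *)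

theory Defs
  imports "HOL-Analysis.Analysis" "HOL-Library.Landau_Symbols"
begin

section \<open>Weak gradients and Sobolev spaces on \<open>\<real>\<^sup>d\<close>\<close>

definition partial_deriv :: "'n::finite \<Rightarrow> (real^'n \<Rightarrow> real) \<Rightarrow> real^'n \<Rightarrow> real" where
  "partial_deriv i f x = frechet_derivative f (at x) (axis i 1)"

primrec C_k :: "nat \<Rightarrow> (real^'n::finite \<Rightarrow> real) \<Rightarrow> bool" where
  "C_k 0 f \<longleftrightarrow> continuous_on UNIV f"
| "C_k (Suc k) f \<longleftrightarrow> f differentiable_on UNIV \<and> (\<forall>i. C_k k (partial_deriv i f))"

definition test_function :: "(real^'n::finite \<Rightarrow> real) \<Rightarrow> bool" where
  "test_function \<psi> \<longleftrightarrow> (\<forall>k. C_k k \<psi>) \<and> (\<exists>K. compact K \<and> (\<forall>x. x \<notin> K \<longrightarrow> \<psi> x = 0))"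

definition locally_integrable :: "(real^'n::finite \<Rightarrow> 'b::euclidean_space) \<Rightarrow> bool" where
  "locally_integrable f \<longleftrightarrow> (\<forall>K. compact K \<longrightarrow> set_integrable lebesgue K f)"

definition has_weak_gradient ::
  "(real^'n::finite \<Rightarrow> 'b::euclidean_space) \<Rightarrow> (real^'n \<Rightarrow> 'b^'n) \<Rightarrow> bool" where
  "has_weak_gradient u g \<longleftrightarrow>
     locally_integrable u \<and> locally_integrable g \<and>
     (\<forall>\<psi> i. test_function \<psi> \<longrightarrow>
        (LINT x|lebesgue. partial_deriv i \<psi> x *\<^sub>R u x) = - (LINT x|lebesgue. \<psi> x *\<^sub>R (g x $ i)))"

definition weakly_differentiable :: "(real^'n::finite \<Rightarrow> 'b::euclidean_space) \<Rightarrow> bool" where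
  "weakly_differentiable u \<longleftrightarrow> (\<exists>g. has_weak_gradient u g)"

text \<open>Weak gradients are unique only up to null sets; \<open>weak_grad u\<close> is an arbitrary
  representative, and it is meaningful only if \<open>u\<close> is weakly differentiable.\<close>

definition weak_grad :: "(real^'n::finite \<Rightarrow> 'b::euclidean_space) \<Rightarrow> real^'n \<Rightarrow> 'b^'n" where
  "weak_grad u = (SOME g. has_weak_gradient u g)"

definition in_L2 :: "(real^'n::finite \<Rightarrow> 'b::euclidean_space) \<Rightarrow> bool" where
  "in_L2 u \<longleftrightarrow> u \<in> borel_measurable lebesgue \<and> integrable lebesgue (\<lambda>x. (norm (u x))\<^sup>2)"

definition L2_norm :: "(real^'n::finite \<Rightarrow> 'b::euclidean_space) \<Rightarrow> real" where
  "L2_norm u = sqrt (LINT x|lebesgue. (norm (u x))\<^sup>2)"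

definition in_H1 :: "(real^'n::finite \<Rightarrow> 'b::euclidean_space) \<Rightarrow> bool" where
  "in_H1 u \<longleftrightarrow> in_L2 u \<and> weakly_differentiable u \<and> in_L2 (weak_grad u)"

definition H1_norm :: "(real^'n::finite \<Rightarrow> 'b::euclidean_space) \<Rightarrow> real" where
  "H1_norm u = sqrt ((L2_norm u)\<^sup>2 + (L2_norm (weak_grad u))\<^sup>2)"

definition tendsto_L2 ::
  "('i \<Rightarrow> real^'n::finite \<Rightarrow> 'b::euclidean_space) \<Rightarrow> (real^'n \<Rightarrow> 'b) \<Rightarrow> 'i filter \<Rightarrow> bool" where
  "tendsto_L2 f l F \<longleftrightarrow>
     (\<forall>\<^sub>F i in F. in_L2 (f i)) \<and> in_L2 l \<and> ((\<lambda>i. L2_norm (\<lambda>x. f i x - l x)) \<longlongrightarrow> 0) F"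

definition tendsto_H1 ::
  "('i \<Rightarrow> real^'n::finite \<Rightarrow> 'b::euclidean_space) \<Rightarrow> (real^'n \<Rightarrow> 'b) \<Rightarrow> 'i filter \<Rightarrow> bool" where
  "tendsto_H1 f l F \<longleftrightarrow>
     (\<forall>\<^sub>F i in F. in_H1 (f i)) \<and> in_H1 l \<and> ((\<lambda>i. H1_norm (\<lambda>x. f i x - l x)) \<longlongrightarrow> 0) F"


section \<open>The energy and its ground states\<close>

definition harmonic :: "('n::finite \<Rightarrow> real) \<Rightarrow> real^'n \<Rightarrow> real" where
  "harmonic \<gamma> x = (\<Sum>i\<in>UNIV. (\<gamma> i)\<^sup>2 * (x $ i)\<^sup>2) / 2"

definition mod_sq :: "(real^'n::finite \<Rightarrow> complex) \<Rightarrow> real^'n \<Rightarrow> real" where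
  "mod_sq \<phi> x = (norm (\<phi> x))\<^sup>2"

definition energy_density ::
  "('n::finite \<Rightarrow> real) \<Rightarrow> real \<Rightarrow> real \<Rightarrow> (real^'n \<Rightarrow> complex) \<Rightarrow> real^'n \<Rightarrow> real" where
  "energy_density \<gamma> \<beta> \<delta> \<phi> x =
     1/2 * (norm (weak_grad \<phi> x))\<^sup>2 + harmonic \<gamma> x * (norm (\<phi> x))\<^sup>2
     + \<beta>/2 * (norm (\<phi> x))^4 + \<delta>/2 * (norm (weak_grad (mod_sq \<phi>) x))\<^sup>2"

definition energy :: "('n::finite \<Rightarrow> real) \<Rightarrow> real \<Rightarrow> real \<Rightarrow> (real^'n \<Rightarrow> complex) \<Rightarrow> real" where
  "energy \<gamma> \<beta> \<delta> \<phi> = (LINT x|lebesgue. energy_density \<gamma> \<beta> \<delta> \<phi> x)"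

text \<open>For \<open>\<beta>, \<delta> \<ge> 0\<close> the energy density is nonnegative, so a finite energy means that it is
  integrable. The Bochner integral is \<open>0\<close> on non-integrable functions; this does not matter,
  because energies are compared only on sets where the integrands are integrable.\<close>

definition admissible :: "('n::finite \<Rightarrow> real) \<Rightarrow> real \<Rightarrow> real \<Rightarrow> (real^'n \<Rightarrow> complex) set" where
  "admissible \<gamma> \<beta> \<delta> =
     {\<phi>. in_H1 \<phi> \<and> integrable lebesgue (\<lambda>x. harmonic \<gamma> x * (norm (\<phi> x))\<^sup>2) \<and> L2_norm \<phi> = 1 \<and>
          weakly_differentiable (mod_sq \<phi>) \<and> integrable lebesgue (energy_density \<gamma> \<beta> \<delta> \<phi>)}"

definition ground_state ::
  "('n::finite \<Rightarrow> real) \<Rightarrow> real \<Rightarrow> real \<Rightarrow> (real^'n \<Rightarrow> complex) \<Rightarrow> bool" where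
  "ground_state \<gamma> \<beta> \<delta> \<phi> \<longleftrightarrow>
     is_arg_min (energy \<gamma> \<beta> \<delta>) (\<lambda>\<psi>. \<psi> \<in> admissible \<gamma> \<beta> \<delta>) \<phi>"

definition positive_ae :: "(real^'n::finite \<Rightarrow> complex) \<Rightarrow> bool" where
  "positive_ae \<phi> \<longleftrightarrow> (AE x in lebesgue. \<phi> x \<in> \<real> \<and> 0 < Re (\<phi> x))"

definition nonneg_ae :: "(real^'n::finite \<Rightarrow> complex) \<Rightarrow> bool" where
  "nonneg_ae \<phi> \<longleftrightarrow> (AE x in lebesgue. \<phi> x \<in> \<real> \<and> 0 \<le> Re (\<phi> x))"

definition rescale :: "real \<Rightarrow> (real^'n::finite \<Rightarrow> complex) \<Rightarrow> real^'n \<Rightarrow> complex" where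
  "rescale \<epsilon> \<phi> x = (\<epsilon> powr (- real CARD('n) / 2)) *\<^sub>R \<phi> (x /\<^sub>R \<epsilon>)"


section \<open>The limiting functionals\<close>

definition energy1 :: "('n::finite \<Rightarrow> real) \<Rightarrow> (real^'n \<Rightarrow> complex) \<Rightarrow> real" where
  "energy1 \<gamma> \<phi> = (LINT x|lebesgue. harmonic \<gamma> x * (norm (\<phi> x))\<^sup>2 + 1/2 * (norm (\<phi> x))^4)"

definition energy2 :: "('n::finite \<Rightarrow> real) \<Rightarrow> real \<Rightarrow> (real^'n \<Rightarrow> complex) \<Rightarrow> real" where
  "energy2 \<gamma> \<delta>inf \<phi> =
     (LINT x|lebesgue. harmonic \<gamma> x * (norm (\<phi> x))\<^sup>2 + 1/2 * (norm (\<phi> x))^4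
        + \<delta>inf/2 * (norm (weak_grad (mod_sq \<phi>) x))\<^sup>2)"

definition energy3 :: "('n::finite \<Rightarrow> real) \<Rightarrow> (real^'n \<Rightarrow> complex) \<Rightarrow> real" where
  "energy3 \<gamma> \<phi> =
     (LINT x|lebesgue. harmonic \<gamma> x * (norm (\<phi> x))\<^sup>2
        + 1/2 * (norm (weak_grad (mod_sq \<phi>) x))\<^sup>2)"

definition admissible1 :: "('n::finite \<Rightarrow> real) \<Rightarrow> (real^'n \<Rightarrow> complex) set" where
  "admissible1 \<gamma> =
     {\<phi>. in_L2 \<phi> \<and> L2_norm \<phi> = 1 \<and> integrable lebesgue (\<lambda>x. harmonic \<gamma> x * (norm (\<phi> x))\<^sup>2) \<and>
          integrable lebesgue (\<lambda>x. (norm (\<phi> x))^4)}"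

definition admissible2 :: "('n::finite \<Rightarrow> real) \<Rightarrow> (real^'n \<Rightarrow> complex) set" where
  "admissible2 \<gamma> =
     {\<phi>. in_L2 \<phi> \<and> L2_norm \<phi> = 1 \<and> integrable lebesgue (\<lambda>x. harmonic \<gamma> x * (norm (\<phi> x))\<^sup>2) \<and>
          integrable lebesgue (\<lambda>x. (norm (\<phi> x))^4) \<and>
          weakly_differentiable (mod_sq \<phi>) \<and> in_L2 (weak_grad (mod_sq \<phi>))}"

definition admissible3 :: "('n::finite \<Rightarrow> real) \<Rightarrow> (real^'n \<Rightarrow> complex) set" where
  "admissible3 \<gamma> =
     {\<phi>. in_L2 \<phi> \<and> L2_norm \<phi> = 1 \<and> integrable lebesgue (\<lambda>x. harmonic \<gamma> x * (norm (\<phi> x))\<^sup>2) \<and>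
          weakly_differentiable (mod_sq \<phi>) \<and> in_L2 (weak_grad (mod_sq \<phi>))}"

text \<open>Uniqueness is uniqueness as an element of \<open>L\<^sup>2\<close>, that is, up to null sets.\<close>

definition unique_nonneg_minimizer ::
  "((real^'n::finite \<Rightarrow> complex) \<Rightarrow> real) \<Rightarrow> (real^'n \<Rightarrow> complex) set \<Rightarrow>
   (real^'n \<Rightarrow> complex) \<Rightarrow> bool" where
  "unique_nonneg_minimizer E A \<phi> \<longleftrightarrow>
     is_arg_min E (\<lambda>\<psi>. \<psi> \<in> A) \<phi> \<and> nonneg_ae \<phi> \<and>
     (\<forall>\<psi>. is_arg_min E (\<lambda>\<psi>. \<psi> \<in> A) \<psi> \<and> nonneg_ae \<psi> \<longrightarrow> (AE x in lebesgue. \<psi> x = \<phi> x))"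

end

theory Submission
  imports Defs
begin

text \<open>With \<open>\<rho> = |\<phi>|\<^sup>2\<close> the limiting functionals are
  \<open>J(\<rho>) = \<integral> V \<rho> + a/2 \<rho>\<^sup>2 + b/2 |\<nabla>\<rho>|\<^sup>2\<close> with \<open>(a, b)\<close> equal to \<open>(1, 0)\<close>, \<open>(1, \<delta>\<^sub>\<infinity>)\<close>, \<open>(0, 1)\<close>, and
  \<open>J\<close> satisfies the parallelogram identity
  \<open>J((\<rho> + \<sigma>)/2) = (J(\<rho>) + J(\<sigma>))/2 - (a \<parallel>\<rho> - \<sigma>\<parallel>\<^sup>2 + b \<parallel>\<nabla>\<rho> - \<nabla>\<sigma>\<parallel>\<^sup>2)/8\<close>.
  Hence minimizing sequences are Cauchy, minimizers are unique, and convergence of the energies to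
  the minimum implies convergence of the densities; no compactness theorem is needed. For \<open>a = 0\<close>
  the \<open>L\<^sup>2\<close> distance is controlled by the gradient through Nash's inequality, because all densities
  have mass \<open>1\<close>; mass cannot escape to infinity because \<open>V\<close> grows quadratically.

  In the rescaled variable the energy is \<open>\<epsilon>\<^sup>2 E = \<epsilon>\<^sup>4/2 \<parallel>\<nabla>\<phi>\<parallel>\<^sup>2 + J\<close> with coefficients
  \<open>\<beta> \<epsilon>\<^bsup>d+2\<^esup>\<close> and \<open>\<delta> \<epsilon>\<^bsup>d+4\<^esup>\<close>, which converge to \<open>a\<close> and \<open>b\<close>. To compare the ground state with the
  limit \<open>\<rho>\<close>, which need not have a square root in \<open>H\<^sup>1\<close>, replace \<open>\<rho>\<close> by \<open>\<rho> * K\<close> for a positive kernel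
  with \<open>|\<nabla>K| \<le> C K\<close>: then \<open>|\<nabla>\<surd>(\<rho> * K)|\<^sup>2 \<le> C\<^sup>2/4 \<rho> * K\<close> is integrable, and by convexity the
  convolution increases \<open>J\<close> only through the second moment of \<open>K\<close>.\<close>

section \<open>Test functions\<close>

text \<open>The order of the limits matters. A square root of the limit density may have infinite
  kinetic energy at the edge of its support, and a vanishing coefficient does not repair that. So
  the comparison state is fixed first, with a smoothing width that depends only on the tolerance,
  and only then does \<beta> tend to infinity. In the opposite direction the kinetic term is
  dropped.

  The kernel is a product of factors (1 + t^2)^(-2). Gaussian and compactly supported kernels have
  an unbounded logarithmic gradient; algebraic decay avoids this, and the fourth power leaves the
  second moment finite. Narrow kernels give the comparison states; wide ones, whose peak is small,
  give Nash's inequality.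

  Nash's inequality and the fact that smoothing does not increase the gradient norm both rest on one
  estimate, \<integral> (f(x + y) - f(x))^2 dx \<le> \<integral> (g \<bullet> y)^2 dx. Weak
  gradients are known only through test functions, so this estimate is itself obtained by testing,
  without approximating f by smooth functions.\<close>

lemma partial_deriv_eq:
  "(f has_derivative f') (at x) \<Longrightarrow> partial_deriv i f x = f' (axis i 1)"
  unfolding partial_deriv_def by (metis frechet_derivative_at)

text \<open>\<open>partial_deriv\<close> goes through the choice in
  \<open>frechet_derivative\<close>; this rule lets an induction work with an explicit derivative
  instead.\<close>

lemma C_k_SucI:
  assumes "\<And>x. (f has_derivative f' x) (at x)" "\<And>i. C_k k (\<lambda>x. f' x (axis i 1))"
  shows "C_k (Suc k) f"
proof -
  have "partial_deriv i f = (\<lambda>x. f' x (axis i 1))" for i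
    using partial_deriv_eq[OF assms(1)] by auto
  moreover have "f differentiable_on UNIV"
    using assms(1) unfolding differentiable_on_def differentiable_def by auto
  ultimately show ?thesis using assms(2) by auto
qed

text \<open>The product rule leaves one factor undifferentiated, and for that factor the order of
  smoothness has to be lowered.\<close>

lemma C_k_SucD: "C_k (Suc k) f \<Longrightarrow> C_k k f"
proof (induction k arbitrary: f)
  case 0
  then show ?case by (auto intro: differentiable_imp_continuous_on)
next
  case (Suc k)
  then show ?case by (metis C_k.simps(2))
qed

lemma C_k_Suc_has_derivative:
  "C_k (Suc k) f \<Longrightarrow> (f has_derivative frechet_derivative f (at x)) (at x)"
  by (auto simp: differentiable_on_def frechet_derivative_works)

lemma C_k_const: "C_k k (\<lambda>x. c)"
proof (induction k arbitrary: c)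
  case (Suc k)
  show ?case by (rule C_k_SucI[where f' = "\<lambda>_ _. 0"]) (auto intro: Suc)
qed simp

lemma C_k_add: "C_k k f \<Longrightarrow> C_k k g \<Longrightarrow> C_k k (\<lambda>x. f x + g x)"
proof (induction k arbitrary: f g)
  case 0
  then show ?case by (auto intro: continuous_intros)
next
  case (Suc k)
  show ?case
  proof (rule C_k_SucI)
    show "((\<lambda>x. f x + g x) has_derivative
        (\<lambda>h. frechet_derivative f (at x) h + frechet_derivative g (at x) h)) (at x)" for x
      by (intro has_derivative_add C_k_Suc_has_derivative[OF Suc.prems(1)]
          C_k_Suc_has_derivative[OF Suc.prems(2)])
    have "C_k k (\<lambda>x. partial_deriv i f x + partial_deriv i g x)" for i
      using Suc.prems by (intro Suc.IH) auto
    then show "C_k k (\<lambda>x. frechet_derivative f (at x) (axis i 1)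
        + frechet_derivative g (at x) (axis i 1))" for i
      by (simp add: partial_deriv_def)
  qed
qed

lemma C_k_mult: "C_k k f \<Longrightarrow> C_k k g \<Longrightarrow> C_k k (\<lambda>x. f x * g x)"
proof (induction k arbitrary: f g)
  case 0
  then show ?case by (auto intro: continuous_intros)
next
  case (Suc k)
  show ?case
  proof (rule C_k_SucI)
    show "((\<lambda>x. f x * g x) has_derivative
        (\<lambda>h. f x * frechet_derivative g (at x) h + frechet_derivative f (at x) h * g x)) (at x)" for x
      by (intro has_derivative_mult C_k_Suc_has_derivative[OF Suc.prems(1)]
          C_k_Suc_has_derivative[OF Suc.prems(2)])
    have "C_k k (\<lambda>x. f x * partial_deriv i g x + partial_deriv i f x * g x)" for i
      using Suc.prems C_k_SucD by (intro C_k_add Suc.IH) (auto simp del: C_k.simps(2) simp: C_k.simps(2)[THEN iffD1])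
    then show "C_k k (\<lambda>x. f x * frechet_derivative g (at x) (axis i 1)
        + frechet_derivative f (at x) (axis i 1) * g x)" for i
      by (simp add: partial_deriv_def)
  qed
qed

lemma C_k_prod: "finite I \<Longrightarrow> (\<And>i. i \<in> I \<Longrightarrow> C_k k (f i)) \<Longrightarrow> C_k k (\<lambda>x. \<Prod>i\<in>I. f i x)"
  by (induction I rule: finite_induct) (auto intro: C_k_const C_k_mult)

lemma frechet_derivative_affine:
  fixes f :: "real^'n::finite \<Rightarrow> real"
  assumes "\<And>x. (f has_derivative f' x) (at x)"
  shows "((\<lambda>x. f (c *\<^sub>R x + y)) has_derivative (\<lambda>h. c * f' (c *\<^sub>R x + y) h)) (at x)"
proof -
  have "((\<lambda>x. f (c *\<^sub>R x + y)) has_derivative (\<lambda>h. f' (c *\<^sub>R x + y) (c *\<^sub>R h))) (at x)"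
    by (rule has_derivative_compose[where f = "\<lambda>x. c *\<^sub>R x + y", OF _ assms])
       (auto intro!: derivative_eq_intros)
  moreover have "f' (c *\<^sub>R x + y) (c *\<^sub>R h) = c * f' (c *\<^sub>R x + y) h" for h
    using assms[of "c *\<^sub>R x + y"]
    by (metis has_derivative_linear linear_scale real_scaleR_def)
  ultimately show ?thesis by simp
qed

lemma C_k_affine: "C_k k f \<Longrightarrow> C_k k (\<lambda>x. f (c *\<^sub>R x + y))"
proof (induction k arbitrary: f)
  case 0
  then have "continuous_on UNIV (f \<circ> (\<lambda>x. c *\<^sub>R x + y))"
    by (intro continuous_on_compose) (auto intro!: continuous_intros elim: continuous_on_subset)
  then show ?case by (simp add: o_def)
next
  case (Suc k)
  show ?case
  proof (rule C_k_SucI)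
    show "((\<lambda>x. f (c *\<^sub>R x + y)) has_derivative
        (\<lambda>h. c * frechet_derivative f (at (c *\<^sub>R x + y)) h)) (at x)" for x
      by (rule frechet_derivative_affine[OF C_k_Suc_has_derivative[OF Suc.prems]])
    have "C_k k (\<lambda>x. c * partial_deriv i f (c *\<^sub>R x + y))" for i
      using Suc.prems by (intro C_k_mult C_k_const Suc.IH) auto
    then show "C_k k (\<lambda>x. c * frechet_derivative f (at (c *\<^sub>R x + y)) (axis i 1))" for i
      by (simp add: partial_deriv_def)
  qed
qed

text \<open>The functions \<open>p(1/t) exp(-1/t)\<close>, extended by \<open>0\<close>, are closed under differentiation, so all of
  them are smooth.\<close>

definition flat :: "real poly \<Rightarrow> real \<Rightarrow> real" where
  "flat p t = (if 0 < t then poly p (1 / t) * exp (- 1 / t) else 0)"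

lemma poly_mult_exp_tendsto_0: "((\<lambda>x. poly p x * exp (- x)) \<longlongrightarrow> 0) (at_top :: real filter)"
proof -
  have "((\<lambda>x. \<Sum>i\<le>degree p. coeff p i * (x ^ i / exp x)) \<longlongrightarrow> (\<Sum>i\<le>degree p. coeff p i * 0)) at_top"
    by (intro tendsto_sum tendsto_mult tendsto_const tendsto_power_div_exp_0)
  then show ?thesis
    by (simp add: poly_altdef exp_minus divide_inverse sum_distrib_right mult.assoc)
qed

lemma flat_tendsto_0: "(flat p \<longlongrightarrow> 0) (at 0)"
proof -
  have "((\<lambda>t. poly p (inverse t) * exp (- inverse t)) \<longlongrightarrow> 0) (at_right 0)"
    by (rule filterlim_compose[OF poly_mult_exp_tendsto_0 filterlim_inverse_at_top_right])
  then have "(flat p \<longlongrightarrow> 0) (at_right 0)"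
    by (rule Lim_transform_eventually)
       (auto simp: eventually_at_filter flat_def divide_inverse)
  moreover have "(flat p \<longlongrightarrow> 0) (at_left 0)"
    by (rule Lim_transform_eventually[OF tendsto_const])
       (auto simp: eventually_at_filter flat_def)
  ultimately show ?thesis by (simp add: filterlim_split_at_real)
qed

text \<open>In the variable u = 1/t the derivative in t is -u^2 d/du, and it sends p(u) exp(-u) to
  u^2 (p - p')(u) exp(-u).\<close>

lemma flat_has_derivative:
  "(flat p has_real_derivative flat ([:0, 0, 1:] * (p - pderiv p)) t) (at t)"
proof (cases t "0::real" rule: linorder_cases)
  case greater
  have "((\<lambda>t. poly p (1 / t) * exp (- 1 / t)) has_real_derivative
     flat ([:0, 0, 1:] * (p - pderiv p)) t) (at t)"
    using greater
    by (auto intro!: derivative_eq_intros DERIV_chain2[OF poly_DERIV]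
        simp: flat_def power2_eq_square field_simps)
  then show ?thesis
    by (rule has_field_derivative_transform_within_open[where S = "{0<..}"])
       (use greater in \<open>auto simp: flat_def\<close>)
next
  case less
  have "((\<lambda>t. 0) has_real_derivative flat ([:0, 0, 1:] * (p - pderiv p)) t) (at t)"
    using less by (auto simp: flat_def)
  then show ?thesis
    by (rule has_field_derivative_transform_within_open[where S = "{..<0}"])
       (use less in \<open>auto simp: flat_def\<close>)
next
  case equal
  \<comment> \<open>Dividing by \<open>h\<close> multiplies the polynomial in 1/h by its variable,
    so the difference quotient at 0 is again a flat function and tends to 0.\<close>
  have "(\<lambda>h. flat p h / h) = flat ([:0, 1:] * p)"
    by (auto simp: flat_def fun_eq_iff)
  then have "((\<lambda>h. (flat p (0 + h) - flat p 0) / h) \<longlongrightarrow> 0) (at 0)"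
    using flat_tendsto_0[of "[:0, 1:] * p"] by (simp add: flat_def)
  then show ?thesis using equal by (simp add: DERIV_def flat_def)
qed

text \<open>The polynomial is generalised because each derivative changes it. Affine functions of
  one coordinate are inserted because bumps on boxes are products of such factors.\<close>

lemma C_k_flat: "C_k k (\<lambda>x. flat p (c * x $ i + e))"
proof (induction k arbitrary: p)
  case 0
  have "continuous_on UNIV (flat p)"
    using flat_has_derivative DERIV_continuous_on by blast
  then show ?case
    by (auto intro!: continuous_on_compose2[of UNIV "flat p"] continuous_intros)
next
  case (Suc k)
  let ?q = "[:0, 0, 1:] * (p - pderiv p)"
  show ?case
  proof (rule C_k_SucI)
    fix x
    have "((\<lambda>x. c * x $ i + e) has_derivative (\<lambda>h. c * h $ i)) (at x)"
      by (auto intro!: derivative_eq_intros bounded_linear.has_derivative[OF bounded_linear_vec_nth])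
    from has_derivative_compose[OF this
        flat_has_derivative[of p, THEN has_field_derivative_imp_has_derivative]]
    show "((\<lambda>x. flat p (c * x $ i + e)) has_derivative (\<lambda>h. flat ?q (c * x $ i + e) * (c * h $ i))) (at x)" .
  next
    fix j
    show "C_k k (\<lambda>x. flat ?q (c * x $ i + e) * (c * axis j 1 $ i))"
      by (intro C_k_mult C_k_const Suc)
  qed
qed

lemma flat_1: "flat 1 t = (if 0 < t then exp (- 1 / t) else 0)"
  by (simp add: flat_def)

lemma flat_1_bounds: "0 \<le> flat 1 t" "flat 1 t \<le> 1"
  by (auto simp: flat_1)

text \<open>The steepness \<open>m\<close> enters inside \<open>flat 1\<close>: for m > 0 a factor
  is exp(-1/(m t)) if t > 0, and 0 otherwise. Hence all bumps vanish outside the same box while they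
  converge to its indicator.\<close>

definition box_bump :: "real^'n \<Rightarrow> real^'n \<Rightarrow> nat \<Rightarrow> real^'n \<Rightarrow> real" where
  "box_bump a b m x =
     (\<Prod>i\<in>UNIV. flat 1 (real m * (x $ i - a $ i)) * flat 1 (real m * (b $ i - x $ i)))"

lemma box_bump_outside:
  assumes "x \<notin> box a b" shows "box_bump a b m x = 0"
proof -
  obtain i where "x $ i \<le> a $ i \<or> b $ i \<le> x $ i"
    using assms by (auto simp: mem_box_cart not_less)
  then have "real m * (x $ i - a $ i) \<le> 0 \<or> real m * (b $ i - x $ i) \<le> 0"
    by (meson diff_le_0_iff_le mult_nonneg_nonpos of_nat_0_le_iff)
  then have "flat 1 (real m * (x $ i - a $ i)) * flat 1 (real m * (b $ i - x $ i)) = 0"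
    by (auto simp: flat_1)
  then show ?thesis unfolding box_bump_def by (intro prod_zero) auto
qed

lemma box_bump_bounds: "0 \<le> box_bump a b m x" "box_bump a b m x \<le> 1"
  unfolding box_bump_def
  by (auto intro!: prod_nonneg prod_le_1 mult_nonneg_nonneg mult_le_one flat_1_bounds)

lemma test_function_box_bump: "test_function (box_bump a b m)"
proof -
  have *: "(\<lambda>x. flat 1 (real m * (x $ i - a $ i)) * flat 1 (real m * (b $ i - x $ i))) =
     (\<lambda>x. flat 1 (real m * x $ i + (- real m * a $ i)) * flat 1 ((- real m) * x $ i + real m * b $ i))"
    for i by (simp add: algebra_simps)
  have "C_k k (box_bump a b m)" for k
    unfolding box_bump_def
    by (intro C_k_prod, simp) (simp only: *, intro C_k_mult C_k_flat)
  moreover have "compact (cbox a b)" "\<forall>x. x \<notin> cbox a b \<longrightarrow> box_bump a b m x = 0"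
    using box_bump_outside box_subset_cbox by (auto, blast)
  ultimately show ?thesis unfolding test_function_def by blast
qed

lemma flat_1_scaled_tendsto: "0 < t \<Longrightarrow> (\<lambda>m. flat 1 (real m * t)) \<longlonglongrightarrow> 1"
proof -
  assume t: "0 < t"
  have "(\<lambda>m. exp (- (1 / t) * inverse (real m))) \<longlonglongrightarrow> exp (- (1 / t) * 0)"
    by (intro tendsto_intros lim_inverse_n)
  moreover have "\<forall>\<^sub>F m in sequentially. exp (- (1 / t) * inverse (real m)) = flat 1 (real m * t)"
    using eventually_gt_at_top[of 0]
    by eventually_elim (use t in \<open>auto simp: flat_1 field_simps\<close>)
  ultimately show ?thesis by (simp add: Lim_transform_eventually)
qed

lemma box_bump_tendsto: "(\<lambda>m. box_bump a b m x) \<longlonglongrightarrow> indicator (box a b) x"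
proof (cases "x \<in> box a b")
  case True
  then have "0 < x $ i - a $ i" "0 < b $ i - x $ i" for i by (auto simp: mem_box_cart)
  then have "(\<lambda>m. box_bump a b m x) \<longlonglongrightarrow> (\<Prod>i::'a\<in>UNIV. 1 * 1)"
    unfolding box_bump_def by (intro tendsto_prod tendsto_mult flat_1_scaled_tendsto)
  then show ?thesis using True by simp
qed (simp add: box_bump_outside)

section \<open>Elementary properties of test functions\<close>

lemma test_function_has_derivative:
  "test_function \<psi> \<Longrightarrow> (\<psi> has_derivative frechet_derivative \<psi> (at x)) (at x)"
  unfolding test_function_def by (metis C_k_Suc_has_derivative)

lemma test_function_continuous: "test_function \<psi> \<Longrightarrow> continuous_on UNIV \<psi>"
  unfolding test_function_def by (metis C_k.simps(1))

lemma test_function_support: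
  assumes "test_function \<psi>"
  obtains K where "compact K" "\<And>x. x \<notin> K \<Longrightarrow> \<psi> x = 0"
  using assms unfolding test_function_def by blast

lemma partial_deriv_outside_support:
  assumes "compact K" "\<And>x. x \<notin> K \<Longrightarrow> \<psi> x = 0" "x \<notin> K"
  shows "partial_deriv i \<psi> x = 0"
proof -
  have "((\<lambda>x. 0) has_derivative (\<lambda>_. 0)) (at x)" by simp
  moreover have "open (- K)" using assms(1) by (simp add: compact_imp_closed open_Compl)
  ultimately have "(\<psi> has_derivative (\<lambda>_. 0)) (at x)"
    by (rule has_derivative_transform_within_open) (use assms in auto)
  then show ?thesis by (simp add: partial_deriv_eq)
qed

lemma test_function_partial_deriv:
  assumes "test_function \<psi>" shows "test_function (partial_deriv i \<psi>)"
proof -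
  obtain K where K: "compact K" "\<And>x. x \<notin> K \<Longrightarrow> \<psi> x = 0"
    using test_function_support[OF assms] by metis
  have "partial_deriv i \<psi> x = 0" if "x \<notin> K" for x
    by (rule partial_deriv_outside_support[OF K that])
  moreover have "C_k k (partial_deriv i \<psi>)" for k
    using assms unfolding test_function_def by (metis C_k.simps(2))
  ultimately show ?thesis unfolding test_function_def using K(1) by blast
qed

lemma test_function_directional:
  fixes y :: "real^'n::finite"
  assumes "test_function \<psi>"
  shows "frechet_derivative \<psi> (at x) y = (\<Sum>i\<in>UNIV. y $ i * partial_deriv i \<psi> x)"
proof -
  let ?D = "frechet_derivative \<psi> (at x)"
  have "linear ?D" using has_derivative_linear[OF test_function_has_derivative[OF assms]] .
  then have "?D (\<Sum>i\<in>UNIV. y $ i *\<^sub>R axis i 1) = (\<Sum>i\<in>UNIV. y $ i *\<^sub>R ?D (axis i 1))"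
    by (simp add: linear_sum linear_scale)
  moreover have "(\<Sum>i\<in>UNIV. y $ i *\<^sub>R axis i (1::real)) = y"
    using basis_expansion[of y] by (simp add: scalar_mult_eq_scaleR)
  ultimately show ?thesis by (simp add: partial_deriv_def)
qed

lemma test_function_bounded:
  assumes "test_function \<psi>"
  obtains B where "0 < B" "\<And>x. \<bar>\<psi> x\<bar> \<le> B"
proof -
  obtain K where K: "compact K" "\<And>x. x \<notin> K \<Longrightarrow> \<psi> x = 0"
    using test_function_support[OF assms] by metis
  have "compact (\<psi> ` K)"
    using K(1) test_function_continuous[OF assms]
    by (intro compact_continuous_image) (auto elim: continuous_on_subset)
  then obtain B where "0 < B" "\<forall>y\<in>\<psi> ` K. norm y \<le> B"
    using compact_imp_bounded bounded_pos by metis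
  then show ?thesis using K(2) that[of B] by (metis abs_zero image_eqI less_imp_le real_norm_def)
qed

lemma test_function_affine:
  assumes "test_function \<psi>" "c \<noteq> 0"
  shows "test_function (\<lambda>x. \<psi> (c *\<^sub>R x + y))"
proof -
  obtain K where K: "compact K" "\<And>x. x \<notin> K \<Longrightarrow> \<psi> x = 0"
    using test_function_support[OF assms(1)] by metis
  let ?K = "(\<lambda>x. (1 / c) *\<^sub>R x + (- (1 / c)) *\<^sub>R y) ` K"
  have "compact ?K"
    by (intro compact_continuous_image continuous_intros K(1))
  moreover have "\<psi> (c *\<^sub>R x + y) = 0" if "x \<notin> ?K" for x
  proof (rule K(2), rule notI)
    assume "c *\<^sub>R x + y \<in> K"
    moreover have "x = (1 / c) *\<^sub>R (c *\<^sub>R x + y) + (- (1 / c)) *\<^sub>R y"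
      using assms(2) by (simp add: algebra_simps)
    ultimately show False using that by blast
  qed
  ultimately show ?thesis
    using assms(1) C_k_affine unfolding test_function_def by blast
qed

lemma partial_deriv_affine:
  assumes "test_function \<psi>"
  shows "partial_deriv i (\<lambda>x. \<psi> (c *\<^sub>R x + y)) x = c * partial_deriv i \<psi> (c *\<^sub>R x + y)"
  using partial_deriv_eq[OF frechet_derivative_affine[OF test_function_has_derivative[OF assms]]]
  by (simp add: partial_deriv_def)

lemma test_function_borel:
  "test_function \<psi> \<Longrightarrow> \<psi> \<in> borel_measurable borel"
  by (rule borel_measurable_continuous_onI[OF test_function_continuous])

section \<open>Lebesgue measure under affine maps\<close>

lemma borel_lebesgueI: "f \<in> borel_measurable borel \<Longrightarrow> f \<in> borel_measurable lebesgue"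
  by (simp add: measurable_completion)

context
  fixes c :: real and y :: "'a::euclidean_space"
  assumes c: "c \<noteq> 0"
begin

lemma affine_measurable_lebesgue: "(\<lambda>x. c *\<^sub>R x + y) \<in> lebesgue \<rightarrow>\<^sub>M lebesgue"
  and lebesgue_affine_scaled:
    "lebesgue = density (distr lebesgue lebesgue (\<lambda>x. c *\<^sub>R x + y)) (\<lambda>_. ennreal (\<bar>c\<bar> ^ DIM('a)))"
proof -
  \<comment> \<open>The coordinatewise affine map with equal factors collapses to a single
    scaling.\<close>
  have *: "y + (\<Sum>j\<in>Basis. (c * (x \<bullet> j)) *\<^sub>R j) = c *\<^sub>R x + y" for x
    by (metis (no_types, lifting) add.commute euclidean_representation scaleR_right.sum scaleR_scaleR sum.cong)
  show "(\<lambda>x. c *\<^sub>R x + y) \<in> lebesgue \<rightarrow>\<^sub>M lebesgue"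
    "lebesgue = density (distr lebesgue lebesgue (\<lambda>x. c *\<^sub>R x + y)) (\<lambda>_. ennreal (\<bar>c\<bar> ^ DIM('a)))"
    using lebesgue_affine_measurable[of "\<lambda>_. c" y] lebesgue_affine_euclidean[of "\<lambda>_. c" y] c
    unfolding * by simp_all
qed

lemma nn_integral_lebesgue_affine:
  assumes f: "f \<in> borel_measurable lebesgue"
  shows "(\<integral>\<^sup>+x. f x \<partial>lebesgue) = ennreal (\<bar>c\<bar> ^ DIM('a)) * (\<integral>\<^sup>+x. f (c *\<^sub>R x + y) \<partial>lebesgue)"
proof -
  have "(\<integral>\<^sup>+x. f x \<partial>lebesgue) = (\<integral>\<^sup>+x. f x \<partial>density (distr lebesgue lebesgue (\<lambda>x. c *\<^sub>R x + y)) (\<lambda>_. ennreal (\<bar>c\<bar> ^ DIM('a))))"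
    unfolding lebesgue_affine_scaled[symmetric] ..
  also have "\<dots> = (\<integral>\<^sup>+x. ennreal (\<bar>c\<bar> ^ DIM('a)) * f x \<partial>distr lebesgue lebesgue (\<lambda>x. c *\<^sub>R x + y))"
    using f by (subst nn_integral_density) auto
  also have "\<dots> = (\<integral>\<^sup>+x. ennreal (\<bar>c\<bar> ^ DIM('a)) * f (c *\<^sub>R x + y) \<partial>lebesgue)"
    using f by (intro nn_integral_distr affine_measurable_lebesgue) auto
  also have "\<dots> = ennreal (\<bar>c\<bar> ^ DIM('a)) * (\<integral>\<^sup>+x. f (c *\<^sub>R x + y) \<partial>lebesgue)"
    using measurable_compose[OF affine_measurable_lebesgue f] by (intro nn_integral_cmult) auto
  finally show ?thesis .
qed

lemma integral_lebesgue_affine: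
  fixes f :: "'a \<Rightarrow> 'b::euclidean_space"
  assumes f: "f \<in> borel_measurable lebesgue"
  shows "(LINT x|lebesgue. f x) = (\<bar>c\<bar> ^ DIM('a)) *\<^sub>R (LINT x|lebesgue. f (c *\<^sub>R x + y))"
    and "integrable lebesgue (\<lambda>x. f (c *\<^sub>R x + y)) \<longleftrightarrow> integrable lebesgue f"
proof -
  let ?D = "distr lebesgue lebesgue (\<lambda>x. c *\<^sub>R x + y)"
  have fD: "f \<in> borel_measurable ?D" using f by simp
  have "(LINT x|lebesgue. f x) = (LINT x|density ?D (\<lambda>_. ennreal (\<bar>c\<bar> ^ DIM('a))). f x)"
    unfolding lebesgue_affine_scaled[symmetric] ..
  also have "\<dots> = (LINT x|?D. (\<bar>c\<bar> ^ DIM('a)) *\<^sub>R f x)"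
    using fD by (intro integral_density) auto
  also have "\<dots> = (LINT x|lebesgue. (\<bar>c\<bar> ^ DIM('a)) *\<^sub>R f (c *\<^sub>R x + y))"
    using f by (intro integral_distr affine_measurable_lebesgue) auto
  finally show "(LINT x|lebesgue. f x) = (\<bar>c\<bar> ^ DIM('a)) *\<^sub>R (LINT x|lebesgue. f (c *\<^sub>R x + y))"
    by simp
  have "integrable lebesgue f \<longleftrightarrow> integrable (density ?D (\<lambda>_. ennreal (\<bar>c\<bar> ^ DIM('a)))) f"
    unfolding lebesgue_affine_scaled[symmetric] ..
  also have "\<dots> \<longleftrightarrow> integrable ?D (\<lambda>x. (\<bar>c\<bar> ^ DIM('a)) *\<^sub>R f x)"
    using fD by (intro integrable_density) auto
  also have "\<dots> \<longleftrightarrow> integrable lebesgue (\<lambda>x. (\<bar>c\<bar> ^ DIM('a)) *\<^sub>R f (c *\<^sub>R x + y))"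
    using f by (intro integrable_distr_eq affine_measurable_lebesgue) auto
  also have "\<dots> \<longleftrightarrow> integrable lebesgue (\<lambda>x. f (c *\<^sub>R x + y))"
  proof
    assume "integrable lebesgue (\<lambda>x. (\<bar>c\<bar> ^ DIM('a)) *\<^sub>R f (c *\<^sub>R x + y))"
    then have "integrable lebesgue (\<lambda>x. (1 / \<bar>c\<bar> ^ DIM('a)) *\<^sub>R ((\<bar>c\<bar> ^ DIM('a)) *\<^sub>R f (c *\<^sub>R x + y)))"
      by (rule integrable_bounded_linear[OF bounded_linear_scaleR_right])
    moreover have "(1 / \<bar>c\<bar> ^ DIM('a)) *\<^sub>R ((\<bar>c\<bar> ^ DIM('a)) *\<^sub>R v) = v" for v :: 'b
      using c by simp
    ultimately show "integrable lebesgue (\<lambda>x. f (c *\<^sub>R x + y))" by (simp only:)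
  qed auto
  finally show "integrable lebesgue (\<lambda>x. f (c *\<^sub>R x + y)) \<longleftrightarrow> integrable lebesgue f" by simp
qed

end

section \<open>The fundamental lemma of the calculus of variations\<close>

lemma locally_integrableD:
  "locally_integrable f \<Longrightarrow> compact K \<Longrightarrow> integrable lebesgue (\<lambda>x. indicator K x *\<^sub>R f x)"
  unfolding locally_integrable_def set_integrable_def by simp

text \<open>The function is the pointwise limit of its restrictions to balls of integer radius, and
  each of these is integrable.\<close>

lemma locally_integrable_measurable:
  fixes f :: "real^'n \<Rightarrow> 'b::euclidean_space"
  assumes "locally_integrable f" shows "f \<in> borel_measurable lebesgue"
proof (rule borel_measurable_LIMSEQ_metric)
  show "(\<lambda>x. indicator (cball 0 (real n)) x *\<^sub>R f x) \<in> borel_measurable lebesgue" for n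
    using assms unfolding locally_integrable_def set_integrable_def by (simp add: borel_measurable_integrable)
  fix x :: "real^'n"
  obtain N where N: "norm x \<le> real N" using real_arch_simple by blast
  have "\<forall>\<^sub>F n in sequentially. indicator (cball 0 (real n)) x *\<^sub>R f x = f x"
    using eventually_ge_at_top[of N] by eventually_elim (use N in \<open>auto simp: indicator_def\<close>)
  then show "(\<lambda>n. indicator (cball 0 (real n)) x *\<^sub>R f x) \<longlonglongrightarrow> f x"
    by (rule tendsto_eventually)
qed

lemma locally_integrable_bounded_mult:
  fixes u :: "real^'n \<Rightarrow> 'b::euclidean_space" and w :: "real^'n \<Rightarrow> real"
  assumes u: "locally_integrable u" and w: "w \<in> borel_measurable lebesgue"
    and "compact K" "\<And>x. \<bar>w x\<bar> \<le> B * indicator K x"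
  shows "integrable lebesgue (\<lambda>x. w x *\<^sub>R u x)"
proof (rule Bochner_Integration.integrable_bound)
  show "integrable lebesgue (\<lambda>x. B *\<^sub>R (indicator K x *\<^sub>R u x))"
    by (intro integrable_scaleR_right locally_integrableD[OF u \<open>compact K\<close>])
  show "(\<lambda>x. w x *\<^sub>R u x) \<in> borel_measurable lebesgue"
    using w locally_integrable_measurable[OF u] by measurable
  have "norm (w x *\<^sub>R u x) \<le> norm (B *\<^sub>R (indicator K x *\<^sub>R u x))" for x
  proof -
    \<comment> \<open>The sign of \<open>B\<close> is unknown when \<open>K\<close> is empty, hence
      the absolute value.\<close>
    have "\<bar>w x\<bar> \<le> \<bar>B\<bar> * indicator K x" using assms(4)[of x] by (auto simp: indicator_def)
    then show ?thesis by (auto simp: indicator_def mult_right_mono)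
  qed
  then show "AE x in lebesgue. norm (w x *\<^sub>R u x) \<le> norm (B *\<^sub>R (indicator K x *\<^sub>R u x))" by simp
qed

lemma test_function_dominated:
  assumes "test_function \<psi>"
  obtains K B where "compact K" "0 < B" "\<And>x. \<bar>\<psi> x\<bar> \<le> B * indicator K x"
proof -
  obtain K where K: "compact K" "\<And>x. x \<notin> K \<Longrightarrow> \<psi> x = 0"
    using test_function_support[OF assms] by metis
  obtain B where B: "0 < B" "\<And>x. \<bar>\<psi> x\<bar> \<le> B" using test_function_bounded[OF assms] by metis
  show ?thesis using K B by (intro that[of K B]) (auto simp: indicator_def)
qed

lemma integrable_test_function_scaleR:
  fixes u :: "real^'n \<Rightarrow> 'b::euclidean_space"
  assumes "test_function \<psi>" "locally_integrable u"
  shows "integrable lebesgue (\<lambda>x. \<psi> x *\<^sub>R u x)"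
proof -
  obtain K B where "compact K" "\<And>x. \<bar>\<psi> x\<bar> \<le> B * indicator K x"
    using test_function_dominated[OF assms(1)] by metis
  then show ?thesis
    using assms by (intro locally_integrable_bounded_mult borel_lebesgueI test_function_borel)
qed

text \<open>Boxes are stable under intersection and generate the Borel sets, so vanishing extends to
  all Borel sets by Dynkin's argument. The whole space is not a box; its integral is a separate
  hypothesis, used for complements.\<close>

lemma AE_zero_if_box_integrals_zero:
  fixes f :: "'a::euclidean_space \<Rightarrow> real"
  assumes int: "integrable lborel f" and total: "(LINT x|lborel. f x) = 0"
    and box: "\<And>a b. (LINT x:box a b|lborel. f x) = 0"
  shows "AE x in lborel. f x = 0"
proof (rule density_unique_real[OF int, of "\<lambda>x. 0"])
  have si: "set_integrable lborel A f" if "A \<in> sets borel" for A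
    unfolding set_integrable_def by (rule integrable_mult_indicator[OF _ int]) (simp add: that)
  fix A :: "'a set" assume "A \<in> sets lborel"
  then have A: "A \<in> sigma_sets UNIV (range (\<lambda>(a, b). box a b))"
    by (simp add: borel_eq_box)
  have "Int_stable (range (\<lambda>(a, b). box a (b::'a)))"
    by (auto simp: Int_stable_def box_Int_box)
  moreover have "range (\<lambda>(a, b). box a (b::'a)) \<subseteq> Pow UNIV" by auto
  moreover note A
  ultimately have "(LINT x:A|lborel. f x) = 0"
  proof (induction rule: sigma_sets_induct_disjoint)
    case (basic A)
    then show ?case using box by auto
  next
    case empty
    then show ?case by (simp add: set_lebesgue_integral_def)
  next
    case (compl A)
    then have A: "A \<in> sets borel" unfolding borel_eq_box by simp
    have "indicator (UNIV - A) x *\<^sub>R f x = f x - indicator A x *\<^sub>R f x" for x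
      by (auto simp: indicator_def)
    then have "(LINT x:UNIV - A|lborel. f x) = (LINT x|lborel. f x) - (LINT x:A|lborel. f x)"
      using int si[OF A] unfolding set_lebesgue_integral_def set_integrable_def by simp
    then show ?case using compl total by simp
  next
    case (union A)
    then have A: "A i \<in> sets borel" for i unfolding borel_eq_box by auto
    have "(LINT x:(\<Union>i. A i)|lborel. f x) = (\<Sum>i. LINT x:A i|lborel. f x)"
    proof (rule lebesgue_integral_countable_add)
      show "A i \<inter> A j = {}" if "i \<noteq> j" for i j
        using union(1) that unfolding disjoint_family_on_def by blast
    qed (use A in \<open>auto intro!: si\<close>)
    then show ?case using union by simp
  qed
  then show "(LINT x:A|lborel. f x) = (LINT x:A|lborel. 0)" by simp
qed simp

text \<open>Bumps converge boundedly to indicators of boxes, so all box integrals of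
  \<open>F\<close> vanish. As \<open>F\<close> is only locally integrable,
  \<open>AE_zero_if_box_integrals_zero\<close> is applied on one box at a time.\<close>

theorem fundamental_lemma:
  fixes F :: "real^'n \<Rightarrow> real"
  assumes F: "locally_integrable F"
    and zero: "\<And>\<psi>. test_function \<psi> \<Longrightarrow> (LINT x|lebesgue. \<psi> x * F x) = 0"
  shows "AE x in lebesgue. F x = 0"
proof -
  have Fm [measurable]: "F \<in> borel_measurable lebesgue"
    by (rule locally_integrable_measurable[OF F])
  have [measurable]: "box a b \<in> sets lebesgue" for a b :: "real^'n" by simp
  have si: "integrable lebesgue (\<lambda>x. indicator (cbox a b) x *\<^sub>R F x)" for a b
    by (rule locally_integrableD[OF F compact_cbox])
  have box: "(LINT x|lebesgue. indicator (box a b) x * F x) = 0" for a b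
  proof -
    have "(\<lambda>m. LINT x|lebesgue. box_bump a b m x * F x) \<longlonglongrightarrow> (LINT x|lebesgue. indicator (box a b) x * F x)"
    proof (rule integral_dominated_convergence[where w = "\<lambda>x. norm (indicator (cbox a b) x *\<^sub>R F x)"])
      show "(\<lambda>x. box_bump a b m x * F x) \<in> borel_measurable lebesgue" for m
        using borel_lebesgueI[OF test_function_borel[OF test_function_box_bump[of a b m]]] by measurable
      show "AE x in lebesgue. (\<lambda>m. box_bump a b m x * F x) \<longlonglongrightarrow> indicator (box a b) x * F x"
        by (intro AE_I2 tendsto_mult box_bump_tendsto tendsto_const)
      have "\<bar>box_bump a b m x * F x\<bar> \<le> norm (indicator (cbox a b) x *\<^sub>R F x)" for m x
      proof (cases "x \<in> box a b")
        case True
        then have "x \<in> cbox a b" using box_subset_cbox by blast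
        then show ?thesis
          using box_bump_bounds[of a b m x] by (simp add: abs_mult mult_left_le_one_le)
      qed (simp add: box_bump_outside)
      then show "AE x in lebesgue. norm (box_bump a b m x * F x) \<le> norm (indicator (cbox a b) x *\<^sub>R F x)" for m
        by simp
    qed (use si in auto)
    moreover have "(LINT x|lebesgue. box_bump a b m x * F x) = 0" for m
      by (rule zero[OF test_function_box_bump])
    ultimately have "(\<lambda>m::nat. 0) \<longlonglongrightarrow> (LINT x|lebesgue. indicator (box a b) x * F x)" by simp
    then show ?thesis by (simp add: LIMSEQ_const_iff)
  qed
  have loc: "AE x in lebesgue. x \<in> box a b \<longrightarrow> F x = 0" for a b
  proof -
    let ?f = "\<lambda>x. indicator (box a b) x * F x"
    \<comment> \<open>That lemma is about \<open>lborel\<close>, so the truncated function is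
      replaced by a Borel representative.\<close>
    obtain f' where f' [measurable]: "f' \<in> borel_measurable lborel" and eq: "AE x in lborel. ?f x = f' x"
      using completion_ex_borel_measurable_real[of ?f lborel] by auto
    have eq': "AE x in lebesgue. ?f x = f' x" by (rule AE_completion[OF eq])
    have f'm: "f' \<in> borel_measurable lebesgue" using f' by (simp add: borel_lebesgueI)
    have "integrable lebesgue ?f"
    proof (rule Bochner_Integration.integrable_bound[OF si[of a b]])
      show "AE x in lebesgue. norm (?f x) \<le> norm (indicator (cbox a b) x *\<^sub>R F x)"
        using box_subset_cbox[of a b] by (intro AE_I2) (auto simp: indicator_def)
    qed simp
    then have "integrable lebesgue f'"
      using integrable_cong_AE[OF _ f'm eq'] by simp
    then have int: "integrable lborel f'" using integrable_completion[OF f'] by simp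
    have ib: "(LINT x:box c d|lborel. f' x) = (LINT x|lebesgue. indicator (box c d \<inter> box a b) x * F x)" for c d
    proof -
      have "(LINT x:box c d|lborel. f' x) = (LINT x|lebesgue. indicator (box c d) x * f' x)"
        unfolding set_lebesgue_integral_def by (subst integral_completion) auto
      also have "\<dots> = (LINT x|lebesgue. indicator (box c d) x * ?f x)"
        using eq' f'm by (intro integral_cong_AE) auto
      finally show ?thesis by (simp add: indicator_inter_arith mult.assoc)
    qed
    have "(LINT x|lborel. f' x) = (LINT x|lebesgue. f' x)"
      by (simp add: integral_completion)
    also have "\<dots> = (LINT x|lebesgue. ?f x)"
      using eq' f'm by (intro integral_cong_AE) auto
    finally have "(LINT x|lborel. f' x) = 0" using box by simp
    \<comment> \<open>Two boxes intersect in a box, so truncation again leads to box integrals of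
      \<open>F\<close>.\<close>
    moreover have "(LINT x:box c d|lborel. f' x) = 0" for c d
      unfolding ib box_Int_box by (rule box)
    ultimately have "AE x in lborel. f' x = 0"
      by (rule AE_zero_if_box_integrals_zero[OF int])
    then have "AE x in lebesgue. f' x = 0" by (rule AE_completion)
    with eq' show ?thesis by eventually_elim (auto simp: indicator_def split: if_splits)
  qed
  \<comment> \<open>Countably many boxes exhaust the space, and the union of their exceptional null
    sets is null.\<close>
  have "AE x in lebesgue. \<forall>n. x \<in> box (- (real n *\<^sub>R One)) (real n *\<^sub>R One) \<longrightarrow> F x = 0"
    unfolding AE_all_countable using loc by blast
  then show ?thesis
  proof eventually_elim
    case (elim x)
    then show ?case using UN_box_eq_UNIV[where 'a = "real^'n"] by blast
  qed
qed

section \<open>Weak gradients\<close>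

lemma locally_integrable_componentI:
  fixes g :: "real^'n \<Rightarrow> 'b::euclidean_space^'n"
  assumes "locally_integrable g"
  shows "locally_integrable (\<lambda>x. g x $ i)"
  unfolding locally_integrable_def
proof (intro allI impI)
  fix K :: "(real^'n) set" assume "compact K"
  then have "integrable lebesgue (\<lambda>x. indicator K x *\<^sub>R g x)"
    by (rule locally_integrableD[OF assms])
  from integrable_bounded_linear[OF bounded_linear_vec_nth[of i] this]
  show "set_integrable lebesgue K (\<lambda>x. g x $ i)"
    unfolding set_integrable_def by simp
qed

lemma locally_integrable_bounded_linear:
  fixes g :: "real^'n \<Rightarrow> 'b::euclidean_space" and T :: "'b \<Rightarrow> 'c::euclidean_space"
  assumes "locally_integrable g" "bounded_linear T"
  shows "locally_integrable (\<lambda>x. T (g x))"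
  unfolding locally_integrable_def
proof (intro allI impI)
  fix K :: "(real^'n) set" assume "compact K"
  from integrable_bounded_linear[OF assms(2) locally_integrableD[OF assms(1) this]]
  show "set_integrable lebesgue K (\<lambda>x. T (g x))"
    unfolding set_integrable_def by (simp add: linear_scale[OF bounded_linear.linear[OF assms(2)]])
qed

lemma locally_integrable_lincomb:
  fixes u v :: "real^'n \<Rightarrow> 'b::euclidean_space"
  assumes "locally_integrable u" "locally_integrable v"
  shows "locally_integrable (\<lambda>x. a *\<^sub>R u x + b *\<^sub>R v x)"
  using assms unfolding locally_integrable_def
  by (auto intro!: set_integral_add set_integrable_scaleR_right)

lemma has_weak_gradientD:
  assumes "has_weak_gradient u g" "test_function \<psi>"
  shows "(LINT x|lebesgue. partial_deriv i \<psi> x *\<^sub>R u x) = - (LINT x|lebesgue. \<psi> x *\<^sub>R (g x $ i))"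
  using assms unfolding has_weak_gradient_def by simp

lemma has_weak_gradientI:
  assumes "locally_integrable u" "locally_integrable g"
    and "\<And>\<psi> i. test_function \<psi> \<Longrightarrow>
      (LINT x|lebesgue. partial_deriv i \<psi> x *\<^sub>R u x) = - (LINT x|lebesgue. \<psi> x *\<^sub>R (g x $ i))"
  shows "has_weak_gradient u g"
  using assms unfolding has_weak_gradient_def by simp

lemma has_weak_gradient_locally_integrable:
  assumes "has_weak_gradient u g" shows "locally_integrable u" "locally_integrable g"
  using assms unfolding has_weak_gradient_def by simp_all

text \<open>The fundamental lemma is scalar, so it is applied to each coordinate of each partial
  derivative; there are finitely many.\<close>

lemma has_weak_gradient_unique:
  fixes u :: "real^'n \<Rightarrow> 'b::euclidean_space"
  assumes g: "has_weak_gradient u g" and h: "has_weak_gradient u h"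
  shows "AE x in lebesgue. g x = h x"
proof -
  have "AE x in lebesgue. (g x $ i - h x $ i) \<bullet> b = 0" if b: "b \<in> Basis" for i b
  proof (rule fundamental_lemma)
    have li: "locally_integrable g" "locally_integrable h"
      by (rule has_weak_gradient_locally_integrable[OF g] has_weak_gradient_locally_integrable[OF h])+
    have "locally_integrable (\<lambda>x. (1 *\<^sub>R (g x $ i) + (-1) *\<^sub>R (h x $ i)) \<bullet> b)"
      by (rule locally_integrable_bounded_linear[OF locally_integrable_lincomb])
         (auto intro: locally_integrable_componentI li bounded_linear_inner_left)
    then show "locally_integrable (\<lambda>x. (g x $ i - h x $ i) \<bullet> b)" by simp
    fix \<psi> :: "real^'n \<Rightarrow> real" assume \<psi>: "test_function \<psi>"
    have I: "integrable lebesgue (\<lambda>x. \<psi> x *\<^sub>R (g x $ i))" "integrable lebesgue (\<lambda>x. \<psi> x *\<^sub>R (h x $ i))"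
      by (intro integrable_test_function_scaleR \<psi> locally_integrable_componentI li)+
    have "(LINT x|lebesgue. \<psi> x *\<^sub>R (g x $ i)) = (LINT x|lebesgue. \<psi> x *\<^sub>R (h x $ i))"
      using has_weak_gradientD[OF g \<psi>, of i] has_weak_gradientD[OF h \<psi>, of i] by simp
    then have "(LINT x|lebesgue. \<psi> x *\<^sub>R (g x $ i) - \<psi> x *\<^sub>R (h x $ i)) = 0"
      using I by simp
    then have "(LINT x|lebesgue. (\<psi> x *\<^sub>R (g x $ i) - \<psi> x *\<^sub>R (h x $ i)) \<bullet> b) = 0"
      using I by (subst integral_inner_left) auto
    then show "(LINT x|lebesgue. \<psi> x * ((g x $ i - h x $ i) \<bullet> b)) = 0"
      by (simp add: inner_diff_left right_diff_distrib)
  qed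
  then have "AE x in lebesgue. \<forall>i. \<forall>b\<in>Basis. (g x $ i - h x $ i) \<bullet> b = 0"
    by (simp add: AE_all_countable AE_ball_countable countable_finite)
  then show ?thesis
    by eventually_elim (auto simp: vec_eq_iff inner_diff_left intro: euclidean_eqI)
qed

lemma has_weak_gradient_weak_grad:
  "weakly_differentiable u \<Longrightarrow> has_weak_gradient u (weak_grad u)"
  unfolding weakly_differentiable_def weak_grad_def
  by (erule someI_ex[where P = "has_weak_gradient u"])

text \<open>\<open>weak_grad\<close> is a chosen representative, so a gradient found by computation
  can replace it only almost everywhere.\<close>

lemma weak_grad_AE:
  fixes u :: "real^'n \<Rightarrow> 'b::euclidean_space"
  assumes "has_weak_gradient u g"
  shows "AE x in lebesgue. weak_grad u x = g x"
  using assms has_weak_gradient_unique has_weak_gradient_weak_grad weakly_differentiable_def by blast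

lemma has_weak_gradient_measurable:
  fixes u :: "real^'n \<Rightarrow> 'b::euclidean_space"
  assumes "has_weak_gradient u g"
  shows "u \<in> borel_measurable lebesgue" "g \<in> borel_measurable lebesgue"
  by (rule locally_integrable_measurable, rule has_weak_gradient_locally_integrable[OF assms])+

text \<open>Lebesgue measure is complete, so a modification on a null set preserves
  measurability.\<close>

lemma borel_measurable_lebesgue_AE:
  fixes f g :: "'a::euclidean_space \<Rightarrow> 'b::second_countable_topology"
  assumes f: "f \<in> borel_measurable lebesgue" and eq: "AE x in lebesgue. f x = g x"
  shows "g \<in> borel_measurable lebesgue"
proof (rule measurableI)
  fix A :: "'b set" assume "A \<in> sets borel"
  then have "f -` A \<in> sets lebesgue" using measurable_sets[OF f, of A] by simp
  moreover have "AE x in lebesgue. x \<in> f -` A \<longleftrightarrow> x \<in> g -` A"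
    using eq by eventually_elim auto
  ultimately show "g -` A \<inter> space lebesgue \<in> sets lebesgue"
    using completion.in_sets_AE[of "f -` A" "g -` A" lborel] by simp
qed simp

lemma locally_integrable_cong_AE:
  fixes f g :: "real^'n \<Rightarrow> 'b::euclidean_space"
  assumes f: "locally_integrable f" and eq: "AE x in lebesgue. f x = g x"
  shows "locally_integrable g"
  unfolding locally_integrable_def set_integrable_def
proof (intro allI impI)
  fix K :: "(real^'n) set" assume "compact K"
  then have int: "integrable lebesgue (\<lambda>x. indicator K x *\<^sub>R f x)"
    by (rule locally_integrableD[OF f])
  have eqK: "AE x in lebesgue. indicator K x *\<^sub>R f x = indicator K x *\<^sub>R g x"
    using eq by eventually_elim auto
  show "integrable lebesgue (\<lambda>x. indicator K x *\<^sub>R g x)"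
    using integrable_cong_AE[OF borel_measurable_integrable[OF int]
        borel_measurable_lebesgue_AE[OF borel_measurable_integrable[OF int] eqK] eqK] int by (rule iffD1)
qed

lemma integral_lebesgue_cong_AE:
  fixes f g :: "'a::euclidean_space \<Rightarrow> 'b::euclidean_space"
  assumes "AE x in lebesgue. f x = g x"
  shows "(LINT x|lebesgue. f x) = (LINT x|lebesgue. g x)"
proof (cases "f \<in> borel_measurable lebesgue")
  case True
  then show ?thesis using borel_measurable_lebesgue_AE[OF True assms] assms
    by (intro integral_cong_AE)
next
  case False
  \<comment> \<open>In this case neither function is measurable, so both integrals have the default
    value 0.\<close>
  have "AE x in lebesgue. g x = f x" using assms by eventually_elim simp
  then have "g \<notin> borel_measurable lebesgue"
    using False borel_measurable_lebesgue_AE[of g f] by blast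
  then show ?thesis using False not_integrable_integral_eq borel_measurable_integrable by metis
qed

lemma has_weak_gradient_cong_AE:
  fixes u v :: "real^'n \<Rightarrow> 'b::euclidean_space"
  assumes "has_weak_gradient u g" "AE x in lebesgue. u x = v x" "AE x in lebesgue. g x = h x"
  shows "has_weak_gradient v h"
proof -
  have "(LINT x|lebesgue. \<psi> x *\<^sub>R u x) = (LINT x|lebesgue. \<psi> x *\<^sub>R v x)" for \<psi>
    by (rule integral_lebesgue_cong_AE) (use assms(2) in eventually_elim, simp)
  moreover have "(LINT x|lebesgue. \<psi> x *\<^sub>R (g x $ i)) = (LINT x|lebesgue. \<psi> x *\<^sub>R (h x $ i))" for \<psi> i
    by (rule integral_lebesgue_cong_AE) (use assms(3) in eventually_elim, simp)
  ultimately show ?thesis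
    using has_weak_gradientD[OF assms(1)]
      locally_integrable_cong_AE[OF has_weak_gradient_locally_integrable(1)[OF assms(1)] assms(2)]
      locally_integrable_cong_AE[OF has_weak_gradient_locally_integrable(2)[OF assms(1)] assms(3)]
    by (intro has_weak_gradientI) simp_all
qed

text \<open>One rule for all linear operations: midpoints use the coefficients 1/2 and 1/2,
  differences 1 and -1, multiples \<open>c\<close> and 0.\<close>

lemma has_weak_gradient_lincomb:
  fixes u v :: "real^'n \<Rightarrow> 'b::euclidean_space"
  assumes u: "has_weak_gradient u g" and v: "has_weak_gradient v h"
  shows "has_weak_gradient (\<lambda>x. a *\<^sub>R u x + b *\<^sub>R v x) (\<lambda>x. a *\<^sub>R g x + b *\<^sub>R h x)"
proof -
  have li: "locally_integrable u" "locally_integrable g" "locally_integrable v" "locally_integrable h"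
    by (rule has_weak_gradient_locally_integrable[OF u] has_weak_gradient_locally_integrable[OF v])+
  have lc: "(LINT x|lebesgue. \<psi> x *\<^sub>R (a *\<^sub>R p x + b *\<^sub>R q x)) =
     a *\<^sub>R (LINT x|lebesgue. \<psi> x *\<^sub>R p x) + b *\<^sub>R (LINT x|lebesgue. \<psi> x *\<^sub>R q x)"
    if "test_function \<psi>" "locally_integrable p" "locally_integrable q" for \<psi> and p q :: "real^'n \<Rightarrow> 'b"
  proof -
    have "(LINT x|lebesgue. \<psi> x *\<^sub>R (a *\<^sub>R p x + b *\<^sub>R q x)) =
       (LINT x|lebesgue. a *\<^sub>R (\<psi> x *\<^sub>R p x) + b *\<^sub>R (\<psi> x *\<^sub>R q x))"
      by (simp add: scaleR_add_right mult.commute)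
    also have "\<dots> = (LINT x|lebesgue. a *\<^sub>R (\<psi> x *\<^sub>R p x)) + (LINT x|lebesgue. b *\<^sub>R (\<psi> x *\<^sub>R q x))"
      by (intro Bochner_Integration.integral_add integrable_scaleR_right integrable_test_function_scaleR that)
    finally show ?thesis by (simp only: integral_scaleR_right)
  qed
  have "(LINT x|lebesgue. partial_deriv i \<psi> x *\<^sub>R (a *\<^sub>R u x + b *\<^sub>R v x)) =
      - (LINT x|lebesgue. \<psi> x *\<^sub>R ((a *\<^sub>R g x + b *\<^sub>R h x) $ i))" if \<psi>: "test_function \<psi>" for \<psi> i
    using has_weak_gradientD[OF u \<psi>, of i] has_weak_gradientD[OF v \<psi>, of i] \<psi>
    by (simp add: lc test_function_partial_deriv li locally_integrable_componentI)
  then show ?thesis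
    by (intro has_weak_gradientI locally_integrable_lincomb li)
qed

lemma locally_integrable_affine:
  fixes f :: "real^'n \<Rightarrow> 'b::euclidean_space"
  assumes f: "locally_integrable f" and c: "c \<noteq> 0"
  shows "locally_integrable (\<lambda>x. f (c *\<^sub>R x + y))"
  unfolding locally_integrable_def
proof (intro allI impI)
  fix K :: "(real^'n) set" assume K: "compact K"
  let ?K = "(\<lambda>x. c *\<^sub>R x + y) ` K"
  have K': "compact ?K" by (intro compact_continuous_image continuous_intros K)
  then have int: "integrable lebesgue (\<lambda>x. indicator ?K x *\<^sub>R f x)"
    by (rule locally_integrableD[OF f])
  moreover have "indicator ?K (c *\<^sub>R x + y) = (indicator K x :: real)" for x
    using c by (auto simp: indicator_def)
  ultimately show "set_integrable lebesgue K (\<lambda>x. f (c *\<^sub>R x + y))"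
    using integral_lebesgue_affine(2)[OF c borel_measurable_integrable[OF int], of y]
    unfolding set_integrable_def by simp
qed

lemma has_weak_gradient_scale:
  fixes u :: "real^'n \<Rightarrow> 'b::euclidean_space"
  assumes u: "has_weak_gradient u g" and c: "c \<noteq> 0"
  shows "has_weak_gradient (\<lambda>x. u (c *\<^sub>R x)) (\<lambda>x. c *\<^sub>R g (c *\<^sub>R x))"
proof -
  have li: "locally_integrable u" "locally_integrable g"
    by (rule has_weak_gradient_locally_integrable[OF u])+
  have li': "locally_integrable (\<lambda>x. u (c *\<^sub>R x))" "locally_integrable (\<lambda>x. g (c *\<^sub>R x))"
    using locally_integrable_affine[OF li(1) c, of 0] locally_integrable_affine[OF li(2) c, of 0] by auto
  have "(LINT x|lebesgue. partial_deriv i \<psi> x *\<^sub>R u (c *\<^sub>R x)) =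
      - (LINT x|lebesgue. \<psi> x *\<^sub>R ((c *\<^sub>R g (c *\<^sub>R x)) $ i))" if \<psi>: "test_function \<psi>" for \<psi> i
  proof -
    \<comment> \<open>Testing \<open>u\<close> with the inversely dilated \<psi> and substituting
      puts the same Jacobian on both sides; the chain rule contributes the factor 1/c.\<close>
    define \<eta> where "\<eta> = (\<lambda>x. \<psi> (inverse c *\<^sub>R x + 0))"
    have \<eta>: "test_function \<eta>"
      unfolding \<eta>_def using \<psi> c by (intro test_function_affine) auto
    have ch: "\<eta> (c *\<^sub>R x) = \<psi> x" for x unfolding \<eta>_def using c by simp
    have pd: "partial_deriv i \<eta> (c *\<^sub>R x) = inverse c * partial_deriv i \<psi> x" for x
      unfolding \<eta>_def using c by (simp only: partial_deriv_affine[OF \<psi>]) simp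
    have m1: "(\<lambda>x. partial_deriv i \<eta> x *\<^sub>R u x) \<in> borel_measurable lebesgue"
      by (rule borel_measurable_integrable, rule integrable_test_function_scaleR)
         (auto intro: \<eta> test_function_partial_deriv li)
    have m2: "(\<lambda>x. \<eta> x *\<^sub>R (g x $ i)) \<in> borel_measurable lebesgue"
      by (rule borel_measurable_integrable, rule integrable_test_function_scaleR)
         (auto intro: \<eta> locally_integrable_componentI li)
    have "(LINT x|lebesgue. partial_deriv i \<eta> x *\<^sub>R u x) = - (LINT x|lebesgue. \<eta> x *\<^sub>R (g x $ i))"
      by (rule has_weak_gradientD[OF u \<eta>])
    then have "(\<bar>c\<bar> ^ DIM(real^'n)) *\<^sub>R (inverse c *\<^sub>R (LINT x|lebesgue. partial_deriv i \<psi> x *\<^sub>R u (c *\<^sub>R x))) =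
       (\<bar>c\<bar> ^ DIM(real^'n)) *\<^sub>R (- (LINT x|lebesgue. \<psi> x *\<^sub>R (g (c *\<^sub>R x) $ i)))"
      using integral_lebesgue_affine(1)[OF c m1, of 0] integral_lebesgue_affine(1)[OF c m2, of 0]
      by (simp add: ch pd flip: scaleR_scaleR)
    then have "inverse c *\<^sub>R (LINT x|lebesgue. partial_deriv i \<psi> x *\<^sub>R u (c *\<^sub>R x)) =
       - (LINT x|lebesgue. \<psi> x *\<^sub>R (g (c *\<^sub>R x) $ i))"
      by (rule scaleR_left_imp_eq[rotated]) (use c in simp)
    from arg_cong[OF this, of "\<lambda>z. c *\<^sub>R z"]
    have "(LINT x|lebesgue. partial_deriv i \<psi> x *\<^sub>R u (c *\<^sub>R x)) =
       c *\<^sub>R (- (LINT x|lebesgue. \<psi> x *\<^sub>R (g (c *\<^sub>R x) $ i)))"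
      using c by simp
    also have "\<dots> = - (LINT x|lebesgue. c *\<^sub>R (\<psi> x *\<^sub>R (g (c *\<^sub>R x) $ i)))"
      by (simp only: integral_scaleR_right scaleR_minus_right)
    finally show ?thesis by (simp add: mult.commute)
  qed
  then show ?thesis
    by (intro has_weak_gradientI li' locally_integrable_bounded_linear[OF li'(2) bounded_linear_scaleR_right[of c]])
qed

section \<open>Classical derivatives are weak derivatives\<close>

lemma has_vector_derivative_iff_quotient:
  "(f has_vector_derivative f') (at t) \<longleftrightarrow> ((\<lambda>h. (f (t + h) - f t) /\<^sub>R h) \<longlongrightarrow> f') (at 0)"
proof -
  have "(f has_vector_derivative f') (at t) \<longleftrightarrow>
    ((\<lambda>h. norm (f (t + h) - f t - h *\<^sub>R f') / norm h) \<longlongrightarrow> 0) (at 0)"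
    by (simp add: has_vector_derivative_def has_derivative_at bounded_linear_scaleR_left)
  also have "\<dots> \<longleftrightarrow> ((\<lambda>h. norm ((f (t + h) - f t) /\<^sub>R h - f')) \<longlongrightarrow> 0) (at 0)"
  proof (rule filterlim_cong)
    have "norm (f (t + h) - f t - h *\<^sub>R f') / norm h = norm ((f (t + h) - f t) /\<^sub>R h - f')"
      if "h \<noteq> 0" for h
    proof -
      have "(f (t + h) - f t) /\<^sub>R h - f' = (f (t + h) - f t - h *\<^sub>R f') /\<^sub>R h"
        using that by (simp add: scaleR_diff_right)
      then show ?thesis by (simp add: divide_inverse mult.commute)
    qed
    then show "\<forall>\<^sub>F h in at 0. norm (f (t + h) - f t - h *\<^sub>R f') / norm h = norm ((f (t + h) - f t) /\<^sub>R h - f')"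
      by (simp add: eventually_at_filter)
  qed simp_all
  also have "\<dots> \<longleftrightarrow> ((\<lambda>h. (f (t + h) - f t) /\<^sub>R h) \<longlongrightarrow> f') (at 0)"
    by (simp add: tendsto_norm_zero_iff LIM_zero_iff)
  finally show ?thesis .
qed

text \<open>The mean value inequality turns the bound on the derivative into a bound on all
  difference quotients, so dominated convergence applies along sequences.\<close>

lemma has_vector_derivative_integral:
  fixes F F' :: "real \<Rightarrow> 'a \<Rightarrow> 'b::euclidean_space"
  assumes int: "\<And>t. t \<in> {a<..<b} \<Longrightarrow> integrable M (F t)"
    and der: "\<And>t x. t \<in> {a<..<b} \<Longrightarrow> ((\<lambda>t. F t x) has_vector_derivative F' t x) (at t)"
    and bound: "\<And>t x. t \<in> {a<..<b} \<Longrightarrow> norm (F' t x) \<le> w x"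
    and w: "integrable M w" and t: "t \<in> {a<..<b}"
  shows "((\<lambda>t. LINT x|M. F t x) has_vector_derivative (LINT x|M. F' t x)) (at t)"
proof -
  have lip: "norm (F s x - F t x) \<le> w x * \<bar>s - t\<bar>" if s: "s \<in> {a<..<b}" for s x
  proof -
    have "norm (F s x - F t x) \<le> w x * norm (s - t)"
    proof (rule differentiable_bound[of "{a<..<b}" _ "\<lambda>s h. h *\<^sub>R F' s x"])
      fix r assume r: "r \<in> {a<..<b}"
      show "((\<lambda>s. F s x) has_derivative (\<lambda>h. h *\<^sub>R F' r x)) (at r within {a<..<b})"
        using der[OF r] unfolding has_vector_derivative_def by (rule has_derivative_at_withinI)
      show "onorm (\<lambda>h. h *\<^sub>R F' r x) \<le> w x"
        using bound[OF r, of x] order_trans[OF norm_ge_zero bound[OF r, of x]]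
        by (intro onorm_bound) (auto simp: mult.commute[of "w x"] intro: mult_left_mono)
    qed (use s t in auto)
    then show ?thesis by simp
  qed
  have lim: "(\<lambda>n. LINT x|M. (F (t + X n) x - F t x) /\<^sub>R X n) \<longlonglongrightarrow> (LINT x|M. F' t x)"
    if X: "\<And>n. X n \<noteq> 0" "X \<longlonglongrightarrow> 0" "\<And>n. t + X n \<in> {a<..<b}" for X :: "nat \<Rightarrow> real"
  proof (rule integral_dominated_convergence[where w = w])
    have meas: "(\<lambda>x. (F (t + X n) x - F t x) /\<^sub>R X n) \<in> borel_measurable M" for n
      using int[OF X(3)[of n]] int[OF t] by measurable
    then show "(\<lambda>x. (F (t + X n) x - F t x) /\<^sub>R X n) \<in> borel_measurable M" for n .
    have "filterlim X (at 0) sequentially"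
      using X by (simp add: filterlim_at)
    then have conv: "(\<lambda>n. (F (t + X n) x - F t x) /\<^sub>R X n) \<longlonglongrightarrow> F' t x" for x
      using filterlim_compose[OF der[OF t, of x, unfolded has_vector_derivative_iff_quotient]] by blast
    then show "AE x in M. (\<lambda>n. (F (t + X n) x - F t x) /\<^sub>R X n) \<longlonglongrightarrow> F' t x" by simp
    \<comment> \<open>Measurability of the derivative is inherited from the difference
      quotients.\<close>
    show "F' t \<in> borel_measurable M"
      using conv meas by (rule borel_measurable_LIMSEQ_metric[rotated])
    have "norm ((F (t + X n) x - F t x) /\<^sub>R X n) \<le> w x" for n x
    proof -
      have "norm ((F (t + X n) x - F t x) /\<^sub>R X n) = norm (F (t + X n) x - F t x) / \<bar>X n\<bar>"
        by (simp add: divide_inverse mult.commute)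
      also have "\<dots> \<le> w x"
        using lip[OF X(3)[of n], of x] X(1)[of n] by (simp add: pos_divide_le_eq)
      finally show ?thesis .
    qed
    then show "AE x in M. norm ((F (t + X n) x - F t x) /\<^sub>R X n) \<le> w x" for n by simp
  qed (rule w)
  show ?thesis
    unfolding has_vector_derivative_iff_quotient
  proof (rule tendsto_at_iff_sequentially[THEN iffD2], intro allI impI)
    fix X :: "nat \<Rightarrow> real"
    assume X: "\<forall>i. X i \<in> UNIV - {0}" "X \<longlonglongrightarrow> 0"
    have "(\<lambda>n. t + X n) \<longlonglongrightarrow> t + 0" by (intro tendsto_intros X)
    then have "\<forall>\<^sub>F n in sequentially. t + X n \<in> {a<..<b}"
      using t by (intro topological_tendstoD) auto
    \<comment> \<open>A sequence tending to 0 may leave the interval for finitely many indices;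
      these are shifted away.\<close>
    then obtain N where N: "\<And>n. n \<ge> N \<Longrightarrow> t + X n \<in> {a<..<b}"
      unfolding eventually_sequentially by blast
    have "(\<lambda>n. LINT x|M. (F (t + X (n + N)) x - F t x) /\<^sub>R X (n + N)) \<longlonglongrightarrow> (LINT x|M. F' t x)"
      using X N by (intro lim LIMSEQ_ignore_initial_segment) auto
    moreover have "(LINT x|M. (F (t + X (n + N)) x - F t x) /\<^sub>R X (n + N)) =
        ((LINT x|M. F (t + X (n + N)) x) - (LINT x|M. F t x)) /\<^sub>R X (n + N)" for n
      using int[OF N[of "n + N"]] int[OF t] by simp
    ultimately have "(\<lambda>n. ((LINT x|M. F (t + X (n + N)) x) - (LINT x|M. F t x)) /\<^sub>R X (n + N)) \<longlonglongrightarrow> (LINT x|M. F' t x)"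
      by (simp only:)
    then show "((\<lambda>h. ((LINT x|M. F (t + h) x) - (LINT x|M. F t x)) /\<^sub>R h) \<circ> X) \<longlonglongrightarrow> (LINT x|M. F' t x)"
      unfolding o_def by (rule LIMSEQ_offset)
  qed
qed

section \<open>Integration by parts for compactly supported functions\<close>

lemma compact_support_bounded:
  fixes f :: "'a::topological_space \<Rightarrow> 'b::real_normed_vector"
  assumes "continuous_on UNIV f" "compact K" "\<And>x. x \<notin> K \<Longrightarrow> f x = 0"
  obtains B where "0 < B" "\<And>x. norm (f x) \<le> B"
proof -
  have "compact (f ` K)"
    using assms by (intro compact_continuous_image) (auto elim: continuous_on_subset)
  then obtain B where B: "0 < B" "\<forall>y\<in>f ` K. norm y \<le> B"
    using compact_imp_bounded bounded_pos by metis
  have "norm (f x) \<le> B" for x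
    using B assms(3)[of x] by (cases "x \<in> K") auto
  then show ?thesis using B(1) that by blast
qed

lemma integrable_compact_support:
  fixes f :: "'a::euclidean_space \<Rightarrow> 'b::euclidean_space"
  assumes "continuous_on UNIV f" "compact K" "\<And>x. x \<notin> K \<Longrightarrow> f x = 0"
  shows "integrable lebesgue f" "integrable lborel f"
proof -
  have "integrable lborel (\<lambda>x. indicator K x *\<^sub>R f x)"
    using assms by (intro borel_integrable_compact) (auto elim: continuous_on_subset)
  moreover have "indicator K x *\<^sub>R f x = f x" for x
    using assms(3)[of x] by (auto simp: indicator_def)
  ultimately show "integrable lborel f" by simp
  then show "integrable lebesgue f"
    by (subst integrable_completion) (auto intro: borel_measurable_integrable)
qed

lemma compact_integrable_indicator:
  fixes K :: "'a::euclidean_space set"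
  assumes "compact K"
  shows "K \<in> sets lebesgue" "integrable lebesgue (indicat_real K)"
  using lmeasurable_compact[OF assms] by (auto simp: fmeasurable_def)

text \<open>By translation invariance \<open>\<integral> F(x + t v) dx\<close> does not depend on \<open>t\<close>; differentiate at \<open>t = 0\<close>.\<close>

lemma integral_directional_derivative_eq_0:
  fixes F G :: "'a::euclidean_space \<Rightarrow> 'b::euclidean_space"
  assumes F: "continuous_on UNIV F" and G: "continuous_on UNIV G" and K: "compact K"
    and F0: "\<And>x. x \<notin> K \<Longrightarrow> F x = 0" and G0: "\<And>x. x \<notin> K \<Longrightarrow> G x = 0"
    and der: "\<And>x. ((\<lambda>t. F (x + t *\<^sub>R v)) has_vector_derivative G x) (at 0)"
  shows "(LINT x|lebesgue. G x) = 0"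
proof -
  obtain B where B: "0 < B" "\<And>x. norm (G x) \<le> B"
    using compact_support_bounded[OF G K G0] by metis
  have Fm: "F \<in> borel_measurable lebesgue"
    by (rule borel_measurable_integrable[OF integrable_compact_support(1)[OF F K F0]])
  \<comment> \<open>The supports of all translates with |t| \<le> 1 lie in one compact set, which
    gives a single integrable majorant.\<close>
  define K' where "K' = (\<lambda>(x, t). x + t *\<^sub>R (- v)) ` (K \<times> {-1..(1::real)})"
  have K': "compact K'"
    unfolding K'_def
    by (intro compact_continuous_image compact_Times K compact_Icc)
       (auto intro!: continuous_intros simp: case_prod_beta)
  have G0': "G (x + t *\<^sub>R v) = 0" if "x \<notin> K'" "t \<in> {-1<..<1}" for x t
  proof (rule G0, rule notI)
    assume "x + t *\<^sub>R v \<in> K"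
    then have "(x + t *\<^sub>R v, t) \<in> K \<times> {-1..1}" using that by auto
    then have "(\<lambda>(x, t). x + t *\<^sub>R (- v)) (x + t *\<^sub>R v, t) \<in> K'"
      unfolding K'_def by (rule imageI)
    then show False using that by simp
  qed
  have trans: "integrable lebesgue (\<lambda>x. F (x + t *\<^sub>R v))"
    "(LINT x|lebesgue. F (x + t *\<^sub>R v)) = (LINT x|lebesgue. F x)" for t
    using integral_lebesgue_affine[OF _ Fm, of 1 "t *\<^sub>R v"] integrable_compact_support(1)[OF F K F0]
    by auto
  have "((\<lambda>t. LINT x|lebesgue. F (x + t *\<^sub>R v)) has_vector_derivative
      (LINT x|lebesgue. G (x + 0 *\<^sub>R v))) (at 0)"
  proof (rule has_vector_derivative_integral[where a = "-1" and b = 1 and w = "\<lambda>x. B * indicator K' x"])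
    fix t :: real and x assume t: "t \<in> {-1<..<1}"
    show "norm (G (x + t *\<^sub>R v)) \<le> B * indicator K' x"
      using G0'[of x t] B(2)[of "x + t *\<^sub>R v"] t by (auto simp: indicator_def)
    have "(\<lambda>s. F (x + (t + s) *\<^sub>R v)) = (\<lambda>s. F ((x + t *\<^sub>R v) + s *\<^sub>R v))"
      by (simp add: scaleR_add_left add.assoc)
    then show "((\<lambda>t. F (x + t *\<^sub>R v)) has_vector_derivative G (x + t *\<^sub>R v)) (at t)"
      using der[of "x + t *\<^sub>R v"] by (simp add: has_vector_derivative_iff_quotient algebra_simps)
  next
    have "integrable lebesgue (indicat_real K')"
      by (rule compact_integrable_indicator[OF K'])
    then show "integrable lebesgue (\<lambda>x. B * indicat_real K' x)" by simp
  qed (use trans in auto)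
  then have "((\<lambda>t. LINT x|lebesgue. F x) has_vector_derivative (LINT x|lebesgue. G x)) (at 0)"
    by (simp add: trans)
  then show ?thesis
    using has_vector_derivative_const vector_derivative_unique_at by blast
qed

lemma continuous_locally_integrable:
  fixes u :: "real^'n \<Rightarrow> 'b::euclidean_space"
  assumes "continuous_on UNIV u" shows "locally_integrable u"
  unfolding locally_integrable_def set_integrable_def
proof (intro allI impI)
  fix K :: "(real^'n) set" assume K: "compact K"
  then have "integrable lborel (\<lambda>x. indicator K x *\<^sub>R u x)"
    using assms by (intro borel_integrable_compact) (auto elim: continuous_on_subset)
  then show "integrable lebesgue (\<lambda>x. indicator K x *\<^sub>R u x)"
    by (subst integrable_completion) (auto intro: borel_measurable_integrable)
qed

text \<open>Integration by parts without boundary terms: the derivative of \<psi> u along an axis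
  has integral 0 by \<open>integral_directional_derivative_eq_0\<close>, and the product rule splits
  it.\<close>

theorem has_weak_gradient_classical:
  fixes u :: "real^'n \<Rightarrow> 'b::euclidean_space"
  assumes u: "continuous_on UNIV u" and g: "continuous_on UNIV g"
    and der: "\<And>x i. ((\<lambda>t. u (x + t *\<^sub>R axis i 1)) has_vector_derivative g x $ i) (at 0)"
  shows "has_weak_gradient u g"
proof (rule has_weak_gradientI)
  show li: "locally_integrable u" "locally_integrable g"
    using u g by (auto intro: continuous_locally_integrable)
  fix \<psi> :: "real^'n \<Rightarrow> real" and i :: 'n
  assume \<psi>: "test_function \<psi>"
  have p\<psi>: "test_function (partial_deriv i \<psi>)" by (rule test_function_partial_deriv[OF \<psi>])
  obtain K1 where K1: "compact K1" "\<And>x. x \<notin> K1 \<Longrightarrow> \<psi> x = 0"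
    using test_function_support[OF \<psi>] by metis
  obtain K2 where K2: "compact K2" "\<And>x. x \<notin> K2 \<Longrightarrow> partial_deriv i \<psi> x = 0"
    using test_function_support[OF p\<psi>] by metis
  have cont: "continuous_on UNIV (\<lambda>x. g x $ i)"
    by (intro continuous_intros g)
  have "(LINT x|lebesgue. \<psi> x *\<^sub>R (g x $ i) + partial_deriv i \<psi> x *\<^sub>R u x) = 0"
  proof (rule integral_directional_derivative_eq_0[where K = "K1 \<union> K2" and v = "axis i 1"
        and F = "\<lambda>x. \<psi> x *\<^sub>R u x"])
    show "continuous_on UNIV (\<lambda>x. \<psi> x *\<^sub>R u x)"
      "continuous_on UNIV (\<lambda>x. \<psi> x *\<^sub>R (g x $ i) + partial_deriv i \<psi> x *\<^sub>R u x)"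
      by (intro continuous_intros u cont test_function_continuous \<psi> p\<psi>)+
    show "compact (K1 \<union> K2)" by (rule compact_Un[OF K1(1) K2(1)])
    fix x :: "real^'n"
    have "((\<lambda>t. x + t *\<^sub>R axis i 1) has_vector_derivative axis i 1) (at 0)"
      by (auto intro!: derivative_eq_intros)
    then have "((\<psi> \<circ> (\<lambda>t. x + t *\<^sub>R axis i 1)) has_vector_derivative
        frechet_derivative \<psi> (at (x + 0 *\<^sub>R axis i 1)) (axis i 1)) (at 0)"
      by (rule vector_derivative_diff_chain_within[of _ _ _ UNIV, simplified])
         (use has_derivative_at_withinI[OF test_function_has_derivative[OF \<psi>, of x]] in simp)
    then have "((\<lambda>t. \<psi> (x + t *\<^sub>R axis i 1)) has_real_derivative partial_deriv i \<psi> x) (at 0)"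
      by (simp add: o_def partial_deriv_def has_real_derivative_iff_has_vector_derivative)
    from has_vector_derivative_scaleR[OF this der[of x i]]
    show "((\<lambda>t. \<psi> (x + t *\<^sub>R axis i 1) *\<^sub>R u (x + t *\<^sub>R axis i 1)) has_vector_derivative
        \<psi> x *\<^sub>R g x $ i + partial_deriv i \<psi> x *\<^sub>R u x) (at 0)"
      by simp
  next
    fix x assume "x \<notin> K1 \<union> K2"
    then have "\<psi> x = 0" "partial_deriv i \<psi> x = 0" using K1(2)[of x] K2(2)[of x] by auto
    then show "\<psi> x *\<^sub>R u x = 0" "\<psi> x *\<^sub>R (g x $ i) + partial_deriv i \<psi> x *\<^sub>R u x = 0" by auto
  qed
  moreover have "(LINT x|lebesgue. \<psi> x *\<^sub>R (g x $ i) + partial_deriv i \<psi> x *\<^sub>R u x) =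
     (LINT x|lebesgue. \<psi> x *\<^sub>R (g x $ i)) + (LINT x|lebesgue. partial_deriv i \<psi> x *\<^sub>R u x)"
    by (intro Bochner_Integration.integral_add integrable_test_function_scaleR \<psi> p\<psi> li
        locally_integrable_componentI)
  ultimately show "(LINT x|lebesgue. partial_deriv i \<psi> x *\<^sub>R u x) = - (LINT x|lebesgue. \<psi> x *\<^sub>R (g x $ i))"
    by (simp add: eq_neg_iff_add_eq_0 add.commute)
qed

section \<open>Square-integrable functions\<close>

lemma abs_mult_le_sum_squares: "\<bar>a * b\<bar> \<le> a\<^sup>2 + (b::real)\<^sup>2"
proof -
  have "2 * (\<bar>a\<bar> * \<bar>b\<bar>) \<le> \<bar>a\<bar>\<^sup>2 + \<bar>b\<bar>\<^sup>2"
    using sum_squares_bound[of "\<bar>a\<bar>" "\<bar>b\<bar>"] by (simp add: mult.assoc)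
  moreover have "0 \<le> \<bar>a\<bar> * \<bar>b\<bar>" by simp
  ultimately show ?thesis unfolding abs_mult by (simp only: power2_abs)
qed

lemma integrable_mult_square_integrable:
  fixes f g :: "'a \<Rightarrow> real"
  assumes [measurable]: "f \<in> borel_measurable M" "g \<in> borel_measurable M"
    and "integrable M (\<lambda>x. (f x)\<^sup>2)" "integrable M (\<lambda>x. (g x)\<^sup>2)"
  shows "integrable M (\<lambda>x. f x * g x)"
proof (rule Bochner_Integration.integrable_bound[OF Bochner_Integration.integrable_add[OF assms(3,4)]])
  show "AE x in M. norm (f x * g x) \<le> norm ((f x)\<^sup>2 + (g x)\<^sup>2)"
    using abs_mult_le_sum_squares by (intro AE_I2) (simp add: abs_of_nonneg)
qed measurable

lemma Cauchy_Schwarz_integral: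
  fixes f g :: "'a \<Rightarrow> real"
  assumes m [measurable]: "f \<in> borel_measurable M" "g \<in> borel_measurable M"
    and f: "integrable M (\<lambda>x. (f x)\<^sup>2)" and g: "integrable M (\<lambda>x. (g x)\<^sup>2)"
  shows "(LINT x|M. \<bar>f x * g x\<bar>)\<^sup>2 \<le> (LINT x|M. (f x)\<^sup>2) * (LINT x|M. (g x)\<^sup>2)"
proof -
  have fg: "integrable M (\<lambda>x. \<bar>f x * g x\<bar>)"
    by (rule integrable_abs[OF integrable_mult_square_integrable[OF m f g]])
  have "ennreal ((LINT x|M. \<bar>f x * g x\<bar>)\<^sup>2) = (\<integral>\<^sup>+x. ennreal \<bar>f x\<bar> * ennreal \<bar>g x\<bar> \<partial>M)\<^sup>2"
    using nn_integral_eq_integral[OF fg] by (simp add: abs_mult ennreal_mult ennreal_power)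
  also have "\<dots> \<le> (\<integral>\<^sup>+x. ennreal \<bar>f x\<bar> ^ 2 \<partial>M) * (\<integral>\<^sup>+x. ennreal \<bar>g x\<bar> ^ 2 \<partial>M)"
    by (rule Cauchy_Schwarz_nn_integral) measurable
  also have "\<dots> = ennreal ((LINT x|M. (f x)\<^sup>2) * (LINT x|M. (g x)\<^sup>2))"
    using nn_integral_eq_integral[OF f] nn_integral_eq_integral[OF g]
    by (simp add: ennreal_power ennreal_mult)
  finally show ?thesis by (subst (asm) ennreal_le_iff) auto
qed

lemma square_integrable_locally_integrable:
  fixes u :: "real^'n \<Rightarrow> 'b::euclidean_space"
  assumes [measurable]: "u \<in> borel_measurable lebesgue"
    and u: "integrable lebesgue (\<lambda>x. (norm (u x))\<^sup>2)"
  shows "locally_integrable u"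
  unfolding locally_integrable_def set_integrable_def
proof (intro allI impI)
  fix K :: "(real^'n) set" assume K: "compact K"
  have [measurable]: "K \<in> sets lebesgue" using K by (simp add: compact_imp_closed)
  have K1: "integrable lebesgue (indicat_real K)"
    by (rule compact_integrable_indicator[OF K])
  show "integrable lebesgue (\<lambda>x. indicator K x *\<^sub>R u x)"
  proof (rule Bochner_Integration.integrable_bound[OF Bochner_Integration.integrable_add[OF K1 u]])
    \<comment> \<open>On a set of finite measure L2 controls L1, since |u| \<le> 1 + |u|^2.\<close>
    have "norm (indicator K x *\<^sub>R u x) \<le> indicat_real K x + (norm (u x))\<^sup>2" for x
      using abs_mult_le_sum_squares[of 1 "norm (u x)"] by (auto simp: indicator_def)
    then show "AE x in lebesgue. norm (indicator K x *\<^sub>R u x) \<le> norm (indicat_real K x + (norm (u x))\<^sup>2)"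
      by (intro AE_I2) (smt (verit) real_norm_def)
  qed measurable
qed

lemma LIMSEQ_squeeze_0:
  fixes a b :: "nat \<Rightarrow> real"
  assumes "\<And>k. 0 \<le> a k" "\<And>k. a k \<le> b k" "b \<longlonglongrightarrow> 0"
  shows "a \<longlonglongrightarrow> 0"
  by (rule tendsto_sandwich[OF _ _ tendsto_const assms(3)]) (simp_all add: assms)

text \<open>A test function is square integrable, so by Cauchy-Schwarz pairing with it is continuous
  for L2 convergence.\<close>

lemma integral_test_function_L2_tendsto:
  fixes w :: "real^'n \<Rightarrow> 'b::euclidean_space"
  assumes \<psi>: "test_function \<psi>" and wk: "\<And>k. locally_integrable (wk k)" and w: "locally_integrable w"
    and int: "\<And>k. integrable lebesgue (\<lambda>x. (norm (wk k x - w x))\<^sup>2)"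
    and lim: "(\<lambda>k. LINT x|lebesgue. (norm (wk k x - w x))\<^sup>2) \<longlonglongrightarrow> 0"
  shows "(\<lambda>k. LINT x|lebesgue. \<psi> x *\<^sub>R wk k x) \<longlonglongrightarrow> (LINT x|lebesgue. \<psi> x *\<^sub>R w x)"
proof -
  have m [measurable]: "\<psi> \<in> borel_measurable lebesgue" "w \<in> borel_measurable lebesgue"
    "\<And>k. wk k \<in> borel_measurable lebesgue"
    by (auto intro: borel_lebesgueI test_function_borel \<psi> locally_integrable_measurable w wk)
  obtain K where K: "compact K" "\<And>x. x \<notin> K \<Longrightarrow> \<psi> x = 0"
    using test_function_support[OF \<psi>] by metis
  have \<psi>2: "integrable lebesgue (\<lambda>x. (\<psi> x)\<^sup>2)"
    by (rule integrable_compact_support[of _ K])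
       (auto intro!: continuous_on_power test_function_continuous[OF \<psi>] K)
  let ?C = "LINT x|lebesgue. (\<psi> x)\<^sup>2"
  have bound: "(norm ((LINT x|lebesgue. \<psi> x *\<^sub>R wk k x) - (LINT x|lebesgue. \<psi> x *\<^sub>R w x)))\<^sup>2
      \<le> ?C * (LINT x|lebesgue. (norm (wk k x - w x))\<^sup>2)" for k
  proof -
    have I: "integrable lebesgue (\<lambda>x. \<psi> x *\<^sub>R wk k x)" "integrable lebesgue (\<lambda>x. \<psi> x *\<^sub>R w x)"
      by (intro integrable_test_function_scaleR \<psi> w wk)+
    have "(LINT x|lebesgue. \<psi> x *\<^sub>R wk k x) - (LINT x|lebesgue. \<psi> x *\<^sub>R w x) =
        (LINT x|lebesgue. \<psi> x *\<^sub>R wk k x - \<psi> x *\<^sub>R w x)"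
      using I by simp
    then have "norm ((LINT x|lebesgue. \<psi> x *\<^sub>R wk k x) - (LINT x|lebesgue. \<psi> x *\<^sub>R w x))
      \<le> (LINT x|lebesgue. norm (\<psi> x *\<^sub>R wk k x - \<psi> x *\<^sub>R w x))"
      by (simp add: integral_norm_bound)
    also have "\<dots> = (LINT x|lebesgue. \<bar>\<psi> x * norm (wk k x - w x)\<bar>)"
      by (simp flip: scaleR_diff_right add: abs_mult)
    finally have "(norm ((LINT x|lebesgue. \<psi> x *\<^sub>R wk k x) - (LINT x|lebesgue. \<psi> x *\<^sub>R w x)))\<^sup>2 \<le>
        (LINT x|lebesgue. \<bar>\<psi> x * norm (wk k x - w x)\<bar>)\<^sup>2"
      by (intro power_mono) auto
    also have "\<dots> \<le> ?C * (LINT x|lebesgue. (norm (wk k x - w x))\<^sup>2)"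
      by (intro Cauchy_Schwarz_integral \<psi>2 int) measurable
    finally show ?thesis .
  qed
  have "(\<lambda>k. ?C * (LINT x|lebesgue. (norm (wk k x - w x))\<^sup>2)) \<longlonglongrightarrow> ?C * 0"
    by (intro tendsto_intros lim)
  then have "(\<lambda>k. (norm ((LINT x|lebesgue. \<psi> x *\<^sub>R wk k x) - (LINT x|lebesgue. \<psi> x *\<^sub>R w x)))\<^sup>2) \<longlonglongrightarrow> 0"
    by (intro LIMSEQ_squeeze_0[OF _ bound]) simp_all
  from tendsto_real_sqrt[OF this] show ?thesis
    by (simp add: LIM_zero_iff tendsto_norm_zero_iff)
qed

text \<open>The weak gradient is a closed operator: both sides of its defining identity pass to the
  limit in L2. The weak differentiability of the minimizing density comes from here.\<close>

theorem has_weak_gradient_L2_limit: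
  fixes u :: "real^'n \<Rightarrow> 'b::euclidean_space"
  assumes wk: "\<And>k. has_weak_gradient (uk k) (gk k)"
    and u: "locally_integrable u" and g: "locally_integrable g"
    and iu: "\<And>k. integrable lebesgue (\<lambda>x. (norm (uk k x - u x))\<^sup>2)"
    and ig: "\<And>k. integrable lebesgue (\<lambda>x. (norm (gk k x - g x))\<^sup>2)"
    and lu: "(\<lambda>k. LINT x|lebesgue. (norm (uk k x - u x))\<^sup>2) \<longlonglongrightarrow> 0"
    and lg: "(\<lambda>k. LINT x|lebesgue. (norm (gk k x - g x))\<^sup>2) \<longlonglongrightarrow> 0"
  shows "has_weak_gradient u g"
proof (rule has_weak_gradientI[OF u g])
  fix \<psi> :: "real^'n \<Rightarrow> real" and i :: 'n
  assume \<psi>: "test_function \<psi>"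
  note li = has_weak_gradient_locally_integrable[OF wk]
  have m [measurable]: "g \<in> borel_measurable lebesgue" "\<And>k. gk k \<in> borel_measurable lebesgue"
    by (auto intro: locally_integrable_measurable g li)
  have le: "(norm (gk k x $ i - g x $ i))\<^sup>2 \<le> (norm (gk k x - g x))\<^sup>2" for k x
    using Finite_Cartesian_Product.norm_nth_le[of "gk k x - g x" i] by (intro power_mono) auto
  have mi: "(\<lambda>x. (norm (gk k x $ i - g x $ i))\<^sup>2) \<in> borel_measurable lebesgue" for k
    using locally_integrable_measurable[OF locally_integrable_componentI[OF g, of i]]
      locally_integrable_measurable[OF locally_integrable_componentI[OF li(2)[of k], of i]]
    by measurable
  have ii: "integrable lebesgue (\<lambda>x. (norm (gk k x $ i - g x $ i))\<^sup>2)" for k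
    by (rule Bochner_Integration.integrable_bound[OF ig[of k] mi]) (use le in auto)
  have l1: "(\<lambda>k. LINT x|lebesgue. partial_deriv i \<psi> x *\<^sub>R uk k x) \<longlonglongrightarrow> (LINT x|lebesgue. partial_deriv i \<psi> x *\<^sub>R u x)"
    by (intro integral_test_function_L2_tendsto test_function_partial_deriv \<psi> li u iu lu)
  have l2: "(\<lambda>k. LINT x|lebesgue. \<psi> x *\<^sub>R (gk k x $ i)) \<longlonglongrightarrow> (LINT x|lebesgue. \<psi> x *\<^sub>R (g x $ i))"
  proof (intro integral_test_function_L2_tendsto \<psi> locally_integrable_componentI li g ii)
    have "(LINT x|lebesgue. (norm (gk k x $ i - g x $ i))\<^sup>2) \<le> (LINT x|lebesgue. (norm (gk k x - g x))\<^sup>2)" for k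
      by (intro integral_mono ii ig le)
    then show "(\<lambda>k. LINT x|lebesgue. (norm (gk k x $ i - g x $ i))\<^sup>2) \<longlonglongrightarrow> 0"
      by (rule LIMSEQ_squeeze_0[OF _ _ lg, rotated]) simp
  qed
  have "(\<lambda>k. LINT x|lebesgue. partial_deriv i \<psi> x *\<^sub>R uk k x) \<longlonglongrightarrow> - (LINT x|lebesgue. \<psi> x *\<^sub>R (g x $ i))"
    using tendsto_minus[OF l2] has_weak_gradientD[OF wk \<psi>] by simp
  then show "(LINT x|lebesgue. partial_deriv i \<psi> x *\<^sub>R u x) = - (LINT x|lebesgue. \<psi> x *\<^sub>R (g x $ i))"
    using LIMSEQ_unique[OF l1] by simp
qed

section \<open>Translation estimate\<close>

text \<open>Jensen's inequality for a weight of mass at most 1, obtained from Cauchy-Schwarz by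
  splitting the weight into two square roots.\<close>

lemma nn_jensen_square:
  fixes k h :: "'a \<Rightarrow> real"
  assumes [measurable]: "k \<in> borel_measurable M" "h \<in> borel_measurable M"
    and k: "\<And>t. 0 \<le> k t" "(\<integral>\<^sup>+t. ennreal (k t) \<partial>M) \<le> 1"
  shows "(\<integral>\<^sup>+t. ennreal (k t) * ennreal \<bar>h t\<bar> \<partial>M)\<^sup>2 \<le> (\<integral>\<^sup>+t. ennreal (k t) * ennreal ((h t)\<^sup>2) \<partial>M)"
proof -
  have "ennreal (k t) * ennreal \<bar>h t\<bar> = ennreal (sqrt (k t)) * ennreal (sqrt (k t) * \<bar>h t\<bar>)" for t
    using k(1)[of t] by (simp flip: ennreal_mult mult.assoc)
  then have "(\<integral>\<^sup>+t. ennreal (k t) * ennreal \<bar>h t\<bar> \<partial>M)\<^sup>2 =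
      (\<integral>\<^sup>+t. ennreal (sqrt (k t)) * ennreal (sqrt (k t) * \<bar>h t\<bar>) \<partial>M)\<^sup>2" by (simp only:)
  also have "\<dots> \<le> (\<integral>\<^sup>+t. ennreal (sqrt (k t)) ^ 2 \<partial>M) * (\<integral>\<^sup>+t. ennreal (sqrt (k t) * \<bar>h t\<bar>) ^ 2 \<partial>M)"
    by (rule Cauchy_Schwarz_nn_integral) measurable
  also have "\<dots> = (\<integral>\<^sup>+t. ennreal (k t) \<partial>M) * (\<integral>\<^sup>+t. ennreal (k t) * ennreal ((h t)\<^sup>2) \<partial>M)"
    using k(1) by (simp add: ennreal_power power_mult_distrib ennreal_mult)
  also have "\<dots> \<le> 1 * (\<integral>\<^sup>+t. ennreal (k t) * ennreal ((h t)\<^sup>2) \<partial>M)"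
    by (intro mult_right_mono k(2)) simp
  finally show ?thesis by simp
qed

lemma ennreal_integral_square_le:
  fixes k h :: "'a \<Rightarrow> real"
  assumes m: "k \<in> borel_measurable M" "h \<in> borel_measurable M"
    and k: "\<And>t. 0 \<le> k t" "(\<integral>\<^sup>+t. ennreal (k t) \<partial>M) \<le> 1"
  shows "ennreal ((LINT t|M. k t * h t)\<^sup>2) \<le> (\<integral>\<^sup>+t. ennreal (k t) * ennreal ((h t)\<^sup>2) \<partial>M)"
proof (cases "integrable M (\<lambda>t. k t * h t)")
  case True
  have "ennreal \<bar>LINT t|M. k t * h t\<bar> \<le> (\<integral>\<^sup>+t. ennreal (k t) * ennreal \<bar>h t\<bar> \<partial>M)"
    using integral_norm_bound_ennreal[OF True] k(1) by (simp add: abs_mult ennreal_mult)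
  then have "ennreal \<bar>LINT t|M. k t * h t\<bar> ^ 2 \<le> (\<integral>\<^sup>+t. ennreal (k t) * ennreal \<bar>h t\<bar> \<partial>M)\<^sup>2"
    by (intro power_mono) simp_all
  also have "\<dots> \<le> (\<integral>\<^sup>+t. ennreal (k t) * ennreal ((h t)\<^sup>2) \<partial>M)"
    by (rule nn_jensen_square[OF m k])
  finally show ?thesis by (simp add: ennreal_power)
\<comment> \<open>A non-integrable integrand has integral 0, and the bound is trivial.\<close>
qed (simp add: not_integrable_integral_eq)

lemma nn_integral_lborel_shift:
  fixes f :: "'a::euclidean_space \<Rightarrow> ennreal"
  assumes "f \<in> borel_measurable borel"
  shows "(\<integral>\<^sup>+x. f (x + a) \<partial>lborel) = (\<integral>\<^sup>+x. f x \<partial>lborel)"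
  using nn_integral_lebesgue_affine[of 1 f a] borel_lebesgueI[OF assms]
  by (simp add: nn_integral_completion)

lemma lborel_Fubini_nn:
  fixes f :: "'a::euclidean_space \<Rightarrow> 'b::euclidean_space \<Rightarrow> ennreal"
  assumes "(\<lambda>(x, y). f x y) \<in> borel_measurable (lborel \<Otimes>\<^sub>M lborel)"
  shows "(\<integral>\<^sup>+y. (\<integral>\<^sup>+x. f x y \<partial>lborel) \<partial>lborel) = (\<integral>\<^sup>+x. (\<integral>\<^sup>+y. f x y \<partial>lborel) \<partial>lborel)"
  by (rule lborel_pair.Fubini'[OF assms])

lemma test_function_translate:
  assumes "test_function \<psi>"
  shows "test_function (\<lambda>x. \<psi> (x - t *\<^sub>R y))"
    and "partial_deriv i (\<lambda>x. \<psi> (x - t *\<^sub>R y)) x = partial_deriv i \<psi> (x - t *\<^sub>R y)"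
  using test_function_affine[OF assms, of 1 "- (t *\<^sub>R y)"]
    partial_deriv_affine[OF assms, of i 1 "- (t *\<^sub>R y)" x] by auto

section \<open>Translation estimate and Nash's inequality for Borel representatives\<close>

context
  fixes f :: "real^'n \<Rightarrow> real" and g :: "real^'n \<Rightarrow> real^'n"
  assumes wg: "has_weak_gradient f g"
    and fm [measurable]: "f \<in> borel_measurable borel"
    and gm [measurable]: "g \<in> borel_measurable borel"
    and g2: "integrable lborel (\<lambda>x. (norm (g x))\<^sup>2)"
begin

lemma square_integrable_directional: "integrable lborel (\<lambda>x. (g x \<bullet> y)\<^sup>2)"
proof (rule Bochner_Integration.integrable_bound)
  show "integrable lborel (\<lambda>x. (norm y)\<^sup>2 * (norm (g x))\<^sup>2)" using g2 by simp
  have "(g x \<bullet> y)\<^sup>2 \<le> (norm y)\<^sup>2 * (norm (g x))\<^sup>2" for x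
    using power_mono[OF Cauchy_Schwarz_ineq2[of "g x" y], of 2]
    by (simp add: power_mult_distrib mult.commute)
  then show "AE x in lborel. norm ((g x \<bullet> y)\<^sup>2) \<le> norm ((norm y)\<^sup>2 * (norm (g x))\<^sup>2)" by simp
qed simp

text \<open>Differentiating \<psi>(x - t y) in t gives minus the derivative of \<psi> along y; the
  minus sign in the definition of the weak gradient cancels it.\<close>

lemma translated_pairing_derivative:
  assumes \<psi>: "test_function \<psi>"
  shows "((\<lambda>t. LINT x|lebesgue. \<psi> (x - t *\<^sub>R y) * f x) has_vector_derivative
      (LINT x|lebesgue. \<psi> (x - t *\<^sub>R y) * (g x \<bullet> y))) (at t)"
proof -
  have lf: "locally_integrable f" and lg: "locally_integrable g"
    using has_weak_gradient_locally_integrable[OF wg] by auto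
  obtain K where K: "compact K" "\<And>x. x \<notin> K \<Longrightarrow> \<psi> x = 0"
    using test_function_support[OF \<psi>] by metis
  define p where "p = (\<lambda>x. \<Sum>i\<in>UNIV. y $ i * partial_deriv i \<psi> x)"
  have pc: "continuous_on UNIV p"
    unfolding p_def
    by (intro continuous_on_sum continuous_on_mult continuous_on_const
        test_function_continuous test_function_partial_deriv \<psi>)
  have p0: "p x = 0" if "x \<notin> K" for x
    unfolding p_def using partial_deriv_outside_support[OF K that] by simp
  obtain B where B: "0 < B" "\<And>x. norm (p x) \<le> B"
    using compact_support_bounded[OF pc K(1) p0] by metis
  define K' where "K' = (\<lambda>(x, t). x + t *\<^sub>R y) ` (K \<times> {t - 1..t + 1})"
  have K': "compact K'"
    unfolding K'_def
    by (intro compact_continuous_image compact_Times K compact_Icc)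
       (auto intro!: continuous_intros simp: case_prod_beta)
  have p0': "p (x - s *\<^sub>R y) = 0" if "x \<notin> K'" "s \<in> {t - 1<..<t + 1}" for x s
  proof (rule p0, rule notI)
    assume "x - s *\<^sub>R y \<in> K"
    then have "(x - s *\<^sub>R y, s) \<in> K \<times> {t - 1..t + 1}" using that by auto
    then have "(\<lambda>(x, t). x + t *\<^sub>R y) (x - s *\<^sub>R y, s) \<in> K'"
      unfolding K'_def by (rule imageI)
    then show False using that by simp
  qed
  have "((\<lambda>t. LINT x|lebesgue. \<psi> (x - t *\<^sub>R y) * f x) has_vector_derivative
      (LINT x|lebesgue. - p (x - t *\<^sub>R y) * f x)) (at t)"
  proof (rule has_vector_derivative_integral[where a = "t - 1" and b = "t + 1"
        and w = "\<lambda>x. B * norm (indicator K' x *\<^sub>R f x)"])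
    fix s :: real and x assume s: "s \<in> {t - 1<..<t + 1}"
    show "norm (- p (x - s *\<^sub>R y) * f x) \<le> B * norm (indicator K' x *\<^sub>R f x)"
      using p0'[OF _ s, of x] B(2)[of "x - s *\<^sub>R y"]
      by (auto simp: indicator_def abs_mult mult_right_mono)
    have "((\<lambda>t. x - t *\<^sub>R y) has_vector_derivative - y) (at s)"
      by (auto intro!: derivative_eq_intros)
    then have "((\<psi> \<circ> (\<lambda>t. x - t *\<^sub>R y)) has_vector_derivative
        frechet_derivative \<psi> (at (x - s *\<^sub>R y)) (- y)) (at s)"
      by (rule vector_derivative_diff_chain_within[of _ _ _ UNIV, simplified])
         (use has_derivative_at_withinI[OF test_function_has_derivative[OF \<psi>]] in simp)
    moreover have "frechet_derivative \<psi> (at (x - s *\<^sub>R y)) (- y) = - p (x - s *\<^sub>R y)"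
      by (simp add: test_function_directional[OF \<psi>] p_def sum_negf)
    ultimately have "((\<lambda>t. \<psi> (x - t *\<^sub>R y)) has_vector_derivative - p (x - s *\<^sub>R y)) (at s)"
      by (simp add: o_def)
    from has_vector_derivative_mult[OF this has_vector_derivative_const[of "f x"]]
    show "((\<lambda>t. \<psi> (x - t *\<^sub>R y) * f x) has_vector_derivative - p (x - s *\<^sub>R y) * f x) (at s)"
      by simp
  next
    fix s :: real
    show "integrable lebesgue (\<lambda>x. \<psi> (x - s *\<^sub>R y) * f x)"
      using integrable_test_function_scaleR[OF test_function_translate(1)[OF \<psi>] lf] by simp
  next
    show "integrable lebesgue (\<lambda>x. B * norm (indicator K' x *\<^sub>R f x))"
      by (intro integrable_mult_right integrable_norm locally_integrableD[OF lf K'])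
  qed simp
  moreover have "(LINT x|lebesgue. - p (x - t *\<^sub>R y) * f x) = (LINT x|lebesgue. \<psi> (x - t *\<^sub>R y) * (g x \<bullet> y))"
  proof -
    let ?\<psi> = "\<lambda>x. \<psi> (x - t *\<^sub>R y)"
    note tt = test_function_translate[OF \<psi>]
    have i1: "integrable lebesgue (\<lambda>x. partial_deriv i ?\<psi> x * f x)" for i
      using integrable_test_function_scaleR[OF test_function_partial_deriv[OF tt(1)] lf] by simp
    have i2: "integrable lebesgue (\<lambda>x. ?\<psi> x * (g x $ i))" for i
      using integrable_test_function_scaleR[OF tt(1) locally_integrable_componentI[OF lg]] by simp
    have "(LINT x|lebesgue. - p (x - t *\<^sub>R y) * f x) =
        (LINT x|lebesgue. (\<Sum>i\<in>UNIV. (- (y $ i)) * (partial_deriv i ?\<psi> x * f x)))"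
      by (intro Bochner_Integration.integral_cong)
         (simp_all add: p_def tt sum_distrib_right sum_negf mult.assoc)
    also have "\<dots> = (\<Sum>i\<in>UNIV. (- (y $ i)) * (LINT x|lebesgue. partial_deriv i ?\<psi> x * f x))"
      using i1 by simp
    also have "\<dots> = (\<Sum>i\<in>UNIV. y $ i * (LINT x|lebesgue. ?\<psi> x * (g x $ i)))"
      using has_weak_gradientD[OF wg tt(1)] by simp
    also have "\<dots> = (LINT x|lebesgue. (\<Sum>i\<in>UNIV. y $ i * (?\<psi> x * (g x $ i))))"
      using i2 by simp
    also have "\<dots> = (LINT x|lebesgue. ?\<psi> x * (g x \<bullet> y))"
      by (intro Bochner_Integration.integral_cong)
         (simp_all add: inner_vec_def sum_distrib_left algebra_simps)
    finally show ?thesis .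
  qed
  ultimately show ?thesis by simp
qed

text \<open>Jensen in t, then Fubini; the inner integral does not depend on t, because Lebesgue
  measure is translation invariant.\<close>

lemma line_average_square_bound:
  "(\<integral>\<^sup>+x. ennreal ((LINT t|lborel. indicator {0..1} t * (g (x + t *\<^sub>R y) \<bullet> y))\<^sup>2) \<partial>lborel)
     \<le> (\<integral>\<^sup>+x. ennreal ((g x \<bullet> y)\<^sup>2) \<partial>lborel)"
proof -
  have "(\<integral>\<^sup>+x. ennreal ((LINT t|lborel. indicator {0..1} t * (g (x + t *\<^sub>R y) \<bullet> y))\<^sup>2) \<partial>lborel)
     \<le> (\<integral>\<^sup>+x. \<integral>\<^sup>+t. ennreal (indicator {0..1} t) * ennreal ((g (x + t *\<^sub>R y) \<bullet> y)\<^sup>2) \<partial>lborel \<partial>lborel)"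
    by (intro nn_integral_mono ennreal_integral_square_le) (simp_all add: ennreal_indicator)
  also have "\<dots> = (\<integral>\<^sup>+t. \<integral>\<^sup>+x. ennreal (indicator {0..1} t) * ennreal ((g (x + t *\<^sub>R y) \<bullet> y)\<^sup>2) \<partial>lborel \<partial>lborel)"
    by (rule lborel_Fubini_nn) measurable
  also have "\<dots> = (\<integral>\<^sup>+t. ennreal (indicator {0..1} (t::real)) * (\<integral>\<^sup>+x. ennreal ((g x \<bullet> y)\<^sup>2) \<partial>lborel) \<partial>lborel)"
    by (intro nn_integral_cong)
       (simp add: nn_integral_cmult nn_integral_lborel_shift[of "\<lambda>x. ennreal ((g x \<bullet> y)\<^sup>2)"])
  also have "\<dots> = (\<integral>\<^sup>+x. ennreal ((g x \<bullet> y)\<^sup>2) \<partial>lborel)"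
    by (simp add: nn_integral_multc ennreal_indicator)
  finally show ?thesis .
qed

text \<open>Tested against \<open>\<psi>\<close>, both sides are \<open>H(1) - H(0)\<close> for \<open>H(t) = \<integral> \<psi>(x - t y) f(x) dx\<close>.\<close>

lemma weak_translation_identity:
  "AE x in lebesgue. f (x + y) - f x = (LINT t|lborel. indicator {0..1} t * (g (x + t *\<^sub>R y) \<bullet> y))"
proof -
  define G where "G = (\<lambda>x. g x \<bullet> y)"
  have Gm [measurable]: "G \<in> borel_measurable borel" unfolding G_def by measurable
  have G2: "integrable lborel (\<lambda>x. (G x)\<^sup>2)" unfolding G_def by (rule square_integrable_directional)
  define W where "W = (\<lambda>x. LINT t|lborel. indicator {0..1} t * G (x + t *\<^sub>R y))"
  have Wm [measurable]: "W \<in> borel_measurable borel"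
    unfolding W_def by measurable
  have lf: "locally_integrable f" by (rule has_weak_gradient_locally_integrable[OF wg])
  have lf': "locally_integrable (\<lambda>x. f (x + y))"
    using locally_integrable_affine[OF lf, of 1 y] by simp
  \<comment> \<open>Square integrability of the line average yields the local integrability that
    \<open>fundamental_lemma\<close> requires.\<close>
  have W2: "integrable lborel (\<lambda>x. (W x)\<^sup>2)"
  proof (rule integrableI_bounded)
    have "(\<integral>\<^sup>+x. ennreal (norm ((W x)\<^sup>2)) \<partial>lborel) \<le> (\<integral>\<^sup>+x. ennreal ((G x)\<^sup>2) \<partial>lborel)"
      using line_average_square_bound[of y] by (simp add: W_def G_def)
    also have "\<dots> < \<infinity>" using nn_integral_eq_integral[OF G2] by simp
    finally show "(\<integral>\<^sup>+x. ennreal (norm ((W x)\<^sup>2)) \<partial>lborel) < \<infinity>" .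
  qed measurable
  have lW: "locally_integrable W"
    using W2 by (intro square_integrable_locally_integrable borel_lebesgueI Wm)
      (simp add: integrable_completion)
  have "AE x in lebesgue. (f (x + y) - f x) - W x = 0"
  proof (rule fundamental_lemma)
    have l1: "locally_integrable (\<lambda>x. 1 *\<^sub>R f (x + y) + (-1) *\<^sub>R f x)"
      by (rule locally_integrable_lincomb[OF lf' lf])
    show "locally_integrable (\<lambda>x. (f (x + y) - f x) - W x)"
      using locally_integrable_lincomb[OF l1 lW, of 1 "-1"] by simp
    fix \<psi> :: "real^'n \<Rightarrow> real" assume \<psi>: "test_function \<psi>"
    have \<psi>m [measurable]: "\<psi> \<in> borel_measurable borel" by (rule test_function_borel[OF \<psi>])
    obtain K where K: "compact K" "\<And>x. x \<notin> K \<Longrightarrow> \<psi> x = 0"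
      using test_function_support[OF \<psi>] by metis
    have \<psi>2: "integrable lborel (\<lambda>x. (\<psi> x)\<^sup>2)"
      by (rule integrable_compact_support(2)[of _ K])
         (auto intro!: continuous_on_power test_function_continuous[OF \<psi>] K)
    define H where "H = (\<lambda>t. LINT x|lebesgue. \<psi> (x - t *\<^sub>R y) * f x)"
    \<comment> \<open>The translation is moved from \<psi> to the other factor, so that \<psi> is
      paired with the line average.\<close>
    have shift: "(LINT x|lebesgue. \<psi> (x - t *\<^sub>R y) * h x) = (LINT x|lebesgue. \<psi> x * h (x + t *\<^sub>R y))"
      if "h \<in> borel_measurable borel" for h t
    proof -
      have "(\<lambda>x. \<psi> (x - t *\<^sub>R y) * h x) \<in> borel_measurable lebesgue"
        using that by (intro borel_lebesgueI) measurable
      from integral_lebesgue_affine(1)[OF _ this, of 1 "t *\<^sub>R y"] show ?thesis by simp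
    qed
    have H': "(H has_vector_derivative (LINT x|lborel. \<psi> x * G (x + t *\<^sub>R y))) (at t)" for t
      using translated_pairing_derivative[OF \<psi>, of y t] shift[of G t]
      by (simp add: H_def G_def integral_completion)
    have "((\<lambda>t. LINT x|lborel. \<psi> x * G (x + t *\<^sub>R y)) has_integral H 1 - H 0) {0..1}"
      by (rule fundamental_theorem_of_calculus) (auto intro: has_vector_derivative_at_within H')
    moreover
    let ?\<Phi> = "\<lambda>t x. indicator {0..1} t * (\<psi> x * G (x + t *\<^sub>R y))"
    \<comment> \<open>Absolute integrability on the product, from |\<psi> G| \<le> \<psi>^2 + G^2,
      permits the exchange of the two integrals.\<close>
    have \<Phi>: "integrable (lborel \<Otimes>\<^sub>M lborel) (case_prod ?\<Phi>)"
    proof (rule integrableI_bounded)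
      have "(\<integral>\<^sup>+z. ennreal (norm (case_prod ?\<Phi> z)) \<partial>(lborel \<Otimes>\<^sub>M lborel)) =
          (\<integral>\<^sup>+t. \<integral>\<^sup>+x. ennreal (norm (?\<Phi> t x)) \<partial>lborel \<partial>lborel)"
        by (subst lborel.nn_integral_fst[symmetric]) simp_all
      also have "\<dots> \<le> (\<integral>\<^sup>+t. \<integral>\<^sup>+x. indicator {0..1} t * (ennreal ((\<psi> x)\<^sup>2) + ennreal ((G (x + t *\<^sub>R y))\<^sup>2)) \<partial>lborel \<partial>lborel)"
      proof (intro nn_integral_mono)
        fix t :: real and x
        show "ennreal (norm (?\<Phi> t x)) \<le> indicator {0..1} t * (ennreal ((\<psi> x)\<^sup>2) + ennreal ((G (x + t *\<^sub>R y))\<^sup>2))"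
          using abs_mult_le_sum_squares[of "\<psi> x" "G (x + t *\<^sub>R y)"]
          by (auto simp: indicator_def ennreal_plus[symmetric] simp del: ennreal_plus intro!: ennreal_leI)
      qed
      also have "\<dots> = (\<integral>\<^sup>+t. indicator {0..1} (t::real) * ((\<integral>\<^sup>+x. ennreal ((\<psi> x)\<^sup>2) \<partial>lborel) + (\<integral>\<^sup>+x. ennreal ((G x)\<^sup>2) \<partial>lborel)) \<partial>lborel)"
        by (intro nn_integral_cong)
           (simp add: nn_integral_cmult nn_integral_add nn_integral_lborel_shift[of "\<lambda>x. ennreal ((G x)\<^sup>2)"])
      also have "\<dots> = (\<integral>\<^sup>+x. ennreal ((\<psi> x)\<^sup>2) \<partial>lborel) + (\<integral>\<^sup>+x. ennreal ((G x)\<^sup>2) \<partial>lborel)"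
        by (simp add: nn_integral_multc)
      also have "\<dots> < \<infinity>"
        using nn_integral_eq_integral[OF \<psi>2] nn_integral_eq_integral[OF G2] by simp
      finally show "(\<integral>\<^sup>+z. ennreal (norm (case_prod ?\<Phi> z)) \<partial>(lborel \<Otimes>\<^sub>M lborel)) < \<infinity>" .
    qed measurable
    have Ht: "(LINT x|lborel. ?\<Phi> t x) = indicator {0..1} t *\<^sub>R (LINT x|lborel. \<psi> x * G (x + t *\<^sub>R y))" for t
      by (simp only: real_scaleR_def integral_mult_right_zero)
    \<comment> \<open>The fundamental theorem speaks of the gauge integral; set integrability
      converts its value into a Lebesgue integral.\<close>
    have si: "set_integrable lborel {0..1} (\<lambda>t. LINT x|lborel. \<psi> x * G (x + t *\<^sub>R y))"
      unfolding set_integrable_def Ht[symmetric] using lborel_pair.integrable_fst'[OF \<Phi>] by (simp only: case_prod_conv)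
    note si' = set_borel_integral_eq_integral[OF si]
    have "((\<lambda>t. LINT x|lborel. \<psi> x * G (x + t *\<^sub>R y)) has_integral
        (LINT t|lborel. LINT x|lborel. ?\<Phi> t x)) {0..1}"
      unfolding Ht using integrable_integral[OF si'(1)] si'(2)
      unfolding set_lebesgue_integral_def by (simp only:)
    moreover have "(LINT t|lborel. LINT x|lborel. ?\<Phi> t x) = (LINT x|lborel. LINT t|lborel. ?\<Phi> t x)"
      by (rule lborel_pair.Fubini_integral[OF \<Phi>, symmetric])
    moreover have "(LINT t|lborel. ?\<Phi> t x) = \<psi> x * W x" for x
    proof -
      have "(LINT t|lborel. ?\<Phi> t x) = (LINT t|lborel. \<psi> x * (indicator {0..1} t * G (x + t *\<^sub>R y)))"
        by (intro Bochner_Integration.integral_cong) auto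
      then show ?thesis unfolding W_def by simp
    qed
    ultimately have "H 1 - H 0 = (LINT x|lborel. \<psi> x * W x)"
      by (simp only: has_integral_unique[of "\<lambda>t. LINT x|lborel. \<psi> x * G (x + t *\<^sub>R y)" _ "{0..1}"])
    then have *: "H 1 - H 0 = (LINT x|lebesgue. \<psi> x * W x)"
      by (simp add: integral_completion)
    have "integrable lebesgue (\<lambda>x. \<psi> x * f (x + y))" "integrable lebesgue (\<lambda>x. \<psi> x * f x)"
      "integrable lebesgue (\<lambda>x. \<psi> x * W x)"
      using integrable_test_function_scaleR[OF \<psi> lf'] integrable_test_function_scaleR[OF \<psi> lf]
        integrable_test_function_scaleR[OF \<psi> lW] by simp_all
    moreover have "H 1 = (LINT x|lebesgue. \<psi> x * f (x + y))" "H 0 = (LINT x|lebesgue. \<psi> x * f x)"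
      using shift[OF fm, of 1] by (simp_all add: H_def)
    ultimately show "(LINT x|lebesgue. \<psi> x * ((f (x + y) - f x) - W x)) = 0"
      using * by (simp add: right_diff_distrib)
  qed
  then show ?thesis by eventually_elim (simp add: W_def G_def)
qed

text \<open>Keeping the directional derivative on the right, instead of the full gradient norm,
  later allows a componentwise comparison of gradients.\<close>

theorem translation_estimate:
  "(\<integral>\<^sup>+x. ennreal ((f (x + y) - f x)\<^sup>2) \<partial>lborel) \<le> (\<integral>\<^sup>+x. ennreal ((g x \<bullet> y)\<^sup>2) \<partial>lborel)"
proof -
  have "AE x in lborel. f (x + y) - f x = (LINT t|lborel. indicator {0..1} t * (g (x + t *\<^sub>R y) \<bullet> y))"
    using weak_translation_identity by (simp add: AE_completion_iff)
  then have "(\<integral>\<^sup>+x. ennreal ((f (x + y) - f x)\<^sup>2) \<partial>lborel) =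
     (\<integral>\<^sup>+x. ennreal ((LINT t|lborel. indicator {0..1} t * (g (x + t *\<^sub>R y) \<bullet> y))\<^sup>2) \<partial>lborel)"
    by (intro nn_integral_cong_AE) (auto elim: eventually_mono)
  then show ?thesis using line_average_square_bound by simp
qed

text \<open>Split \<open>f(x)\<close> into an average of \<open>f(x + y)\<close>, bounded by the \<open>L\<^sup>1\<close> norm, and an average of the
  increments, bounded by the translation estimate.\<close>

lemma nash_inequality:
  fixes K :: "real^'n \<Rightarrow> real"
  assumes Km [measurable]: "K \<in> borel_measurable borel" and K: "\<And>y. 0 \<le> K y" "\<And>y. K y \<le> C"
    and K1: "(\<integral>\<^sup>+y. ennreal (K y) \<partial>lborel) = 1"
  shows "(\<integral>\<^sup>+x. ennreal ((f x)\<^sup>2) \<partial>lborel) \<le>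
     2 * (ennreal C * (\<integral>\<^sup>+x. ennreal \<bar>f x\<bar> \<partial>lborel)\<^sup>2)
     + 2 * ((\<integral>\<^sup>+y. ennreal (K y * (norm y)\<^sup>2) \<partial>lborel) * (\<integral>\<^sup>+x. ennreal ((norm (g x))\<^sup>2) \<partial>lborel))"
proof -
  define a where "a = (\<lambda>x. \<integral>\<^sup>+y. ennreal (K y) * ennreal \<bar>f (x + y)\<bar> \<partial>lborel)"
  define b where "b = (\<lambda>x. \<integral>\<^sup>+y. ennreal (K y) * ennreal \<bar>f (x + y) - f x\<bar> \<partial>lborel)"
  let ?N = "\<integral>\<^sup>+x. ennreal \<bar>f x\<bar> \<partial>lborel" and ?G = "\<integral>\<^sup>+x. ennreal ((norm (g x))\<^sup>2) \<partial>lborel"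
  have am [measurable]: "a \<in> borel_measurable borel" and bm [measurable]: "b \<in> borel_measurable borel"
    unfolding a_def b_def by measurable
  have sq: "(p + q)\<^sup>2 \<le> 2 * p\<^sup>2 + 2 * q\<^sup>2" for p q :: ennreal
  proof (cases p; cases q)
    fix r s :: real assume "0 \<le> r" "p = ennreal r" "0 \<le> s" "q = ennreal s"
    moreover have "(r + s)\<^sup>2 \<le> 2 * r\<^sup>2 + 2 * s\<^sup>2"
      using sum_squares_bound[of r s] by (simp add: power2_sum)
    ultimately show ?thesis
      by (simp add: ennreal_power ennreal_plus[symmetric] ennreal_mult''[symmetric] ennreal_leI
          flip: ennreal_numeral del: ennreal_plus)
  qed (auto simp: ennreal_top_mult power2_eq_square)
  have "ennreal ((f x)\<^sup>2) \<le> 2 * (a x)\<^sup>2 + 2 * (b x)\<^sup>2" for x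
  proof -
    have "ennreal \<bar>f x\<bar> = (\<integral>\<^sup>+y. ennreal (K y) * ennreal \<bar>f x\<bar> \<partial>lborel)"
      by (simp add: nn_integral_multc K1)
    also have "\<dots> \<le> (\<integral>\<^sup>+y. ennreal (K y) * ennreal \<bar>f (x + y)\<bar> + ennreal (K y) * ennreal \<bar>f (x + y) - f x\<bar> \<partial>lborel)"
      by (intro nn_integral_mono)
         (auto simp flip: distrib_left ennreal_plus intro!: mult_left_mono ennreal_leI)
    also have "\<dots> = a x + b x" unfolding a_def b_def by (rule nn_integral_add) measurable
    finally have "ennreal \<bar>f x\<bar> ^ 2 \<le> (a x + b x)\<^sup>2" by (intro power_mono) simp_all
    also note sq
    finally show ?thesis by (simp add: ennreal_power)
  qed
  then have "(\<integral>\<^sup>+x. ennreal ((f x)\<^sup>2) \<partial>lborel) \<le> (\<integral>\<^sup>+x. 2 * (a x)\<^sup>2 + 2 * (b x)\<^sup>2 \<partial>lborel)"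
    by (intro nn_integral_mono)
  also have "\<dots> = 2 * (\<integral>\<^sup>+x. (a x)\<^sup>2 \<partial>lborel) + 2 * (\<integral>\<^sup>+x. (b x)\<^sup>2 \<partial>lborel)"
    by (simp add: nn_integral_add nn_integral_cmult)
  also have "\<dots> \<le> 2 * (ennreal C * ?N\<^sup>2) + 2 * ((\<integral>\<^sup>+y. ennreal (K y * (norm y)\<^sup>2) \<partial>lborel) * ?G)"
  proof (intro add_mono mult_left_mono)
    \<comment> \<open>The L2 norm of \<open>a\<close> is interpolated: its supremum is at most
      \<open>C\<close> times the L1 norm of \<open>f\<close>, and its integral equals that norm by
      Fubini.\<close>
    have "a x \<le> ennreal C * ?N" for x
    proof -
      have "a x \<le> (\<integral>\<^sup>+y. ennreal C * ennreal \<bar>f (x + y)\<bar> \<partial>lborel)"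
        unfolding a_def by (intro nn_integral_mono mult_right_mono ennreal_leI K) simp
      also have "\<dots> = ennreal C * ?N"
        using nn_integral_lborel_shift[of "\<lambda>x. ennreal \<bar>f x\<bar>" x]
        by (simp add: nn_integral_cmult add.commute)
      finally show ?thesis .
    qed
    then have "(\<integral>\<^sup>+x. (a x)\<^sup>2 \<partial>lborel) \<le> (\<integral>\<^sup>+x. (ennreal C * ?N) * a x \<partial>lborel)"
      unfolding power2_eq_square by (intro nn_integral_mono mult_right_mono) simp_all
    also have "\<dots> = (ennreal C * ?N) * (\<integral>\<^sup>+x. a x \<partial>lborel)" by (simp add: nn_integral_cmult)
    also have "(\<integral>\<^sup>+x. a x \<partial>lborel) = (\<integral>\<^sup>+y. \<integral>\<^sup>+x. ennreal (K y) * ennreal \<bar>f (x + y)\<bar> \<partial>lborel \<partial>lborel)"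
      unfolding a_def by (rule lborel_Fubini_nn[symmetric]) measurable
    also have "\<dots> = ?N"
      by (simp add: nn_integral_cmult nn_integral_lborel_shift[of "\<lambda>x. ennreal \<bar>f x\<bar>"] nn_integral_multc K1)
    finally show "(\<integral>\<^sup>+x. (a x)\<^sup>2 \<partial>lborel) \<le> ennreal C * ?N\<^sup>2"
      by (simp add: power2_eq_square mult.assoc)
    have "(\<integral>\<^sup>+x. (b x)\<^sup>2 \<partial>lborel) \<le> (\<integral>\<^sup>+x. \<integral>\<^sup>+y. ennreal (K y) * ennreal ((f (x + y) - f x)\<^sup>2) \<partial>lborel \<partial>lborel)"
      unfolding b_def by (intro nn_integral_mono nn_jensen_square) (use K K1 in auto)
    also have "\<dots> = (\<integral>\<^sup>+y. \<integral>\<^sup>+x. ennreal (K y) * ennreal ((f (x + y) - f x)\<^sup>2) \<partial>lborel \<partial>lborel)"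
      by (rule lborel_Fubini_nn[symmetric]) measurable
    also have "\<dots> = (\<integral>\<^sup>+y. ennreal (K y) * (\<integral>\<^sup>+x. ennreal ((f (x + y) - f x)\<^sup>2) \<partial>lborel) \<partial>lborel)"
      by (intro nn_integral_cong) (simp add: nn_integral_cmult)
    also have "\<dots> \<le> (\<integral>\<^sup>+y. ennreal (K y) * (ennreal ((norm y)\<^sup>2) * ?G) \<partial>lborel)"
    proof (intro nn_integral_mono mult_left_mono)
      fix y
      have "(g x \<bullet> y)\<^sup>2 \<le> (norm y)\<^sup>2 * (norm (g x))\<^sup>2" for x
        using power_mono[OF Cauchy_Schwarz_ineq2[of "g x" y], of 2]
        by (simp add: power_mult_distrib mult.commute)
      then have "(\<integral>\<^sup>+x. ennreal ((g x \<bullet> y)\<^sup>2) \<partial>lborel) \<le> (\<integral>\<^sup>+x. ennreal ((norm y)\<^sup>2) * ennreal ((norm (g x))\<^sup>2) \<partial>lborel)"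
        by (intro nn_integral_mono) (simp add: ennreal_leI flip: ennreal_mult)
      also have "\<dots> = ennreal ((norm y)\<^sup>2) * ?G" by (simp add: nn_integral_cmult)
      finally show "(\<integral>\<^sup>+x. ennreal ((f (x + y) - f x)\<^sup>2) \<partial>lborel) \<le> ennreal ((norm y)\<^sup>2) * ?G"
        using translation_estimate[of y] by (rule order_trans[rotated])
    qed simp
    also have "\<dots> = (\<integral>\<^sup>+y. ennreal (K y * (norm y)\<^sup>2) \<partial>lborel) * ?G"
      by (simp add: nn_integral_multc K ennreal_mult flip: mult.assoc)
    finally show "(\<integral>\<^sup>+x. (b x)\<^sup>2 \<partial>lborel) \<le> (\<integral>\<^sup>+y. ennreal (K y * (norm y)\<^sup>2) \<partial>lborel) * ?G" .
  qed simp_all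
  finally show ?thesis .
qed

end

section \<open>A smoothing kernel\<close>

text \<open>The logarithmic derivative -4 t / (1 + t^2) is bounded by 2 in absolute value, and
  multiplication by t^2 leaves an integrable function.\<close>

definition quartic_decay :: "real \<Rightarrow> real" where
  "quartic_decay t = inverse ((1 + t\<^sup>2)\<^sup>2)"

lemma one_plus_square_pos: "0 < 1 + (t::real)\<^sup>2"
  by (rule add_pos_nonneg) auto

lemma quartic_decay_pos: "0 < quartic_decay t"
  unfolding quartic_decay_def using one_plus_square_pos[of t] by simp

lemma quartic_decay_le: "quartic_decay t \<le> inverse (1 + t\<^sup>2)" "quartic_decay t \<le> 1"
  "t\<^sup>2 * quartic_decay t \<le> inverse (1 + t\<^sup>2)"
proof -
  let ?p = "1 + t\<^sup>2"
  have p: "1 \<le> ?p" by simp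
  have q: "quartic_decay t = inverse ?p * inverse ?p"
    unfolding quartic_decay_def by (simp add: power2_eq_square)
  have i: "0 < inverse ?p" "inverse ?p \<le> 1"
    using p one_plus_square_pos[of t] by (auto intro: inverse_le_1_iff[THEN iffD2])
  show 1: "quartic_decay t \<le> inverse ?p"
    unfolding q using i by (simp add: mult_left_le)
  then show "quartic_decay t \<le> 1" using i by linarith
  have "t\<^sup>2 * inverse ?p \<le> 1"
    using one_plus_square_pos[of t] by (simp add: divide_simps)
  then have "(t\<^sup>2 * inverse ?p) * inverse ?p \<le> 1 * inverse ?p"
    using i by (intro mult_right_mono) auto
  then show "t\<^sup>2 * quartic_decay t \<le> inverse ?p" unfolding q by (simp add: mult.assoc)
qed

lemma quartic_decay_has_derivative:
  "(quartic_decay has_real_derivative (- 4 * t / (1 + t\<^sup>2) * quartic_decay t)) (at t)"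
proof -
  have p: "1 + t\<^sup>2 \<noteq> 0" using one_plus_square_pos[of t] by simp
  have "((\<lambda>t. inverse ((1 + t\<^sup>2)\<^sup>2)) has_real_derivative
      - (inverse ((1 + t\<^sup>2)\<^sup>2) * (2 * (1 + t\<^sup>2) * (2 * t)) * inverse ((1 + t\<^sup>2)\<^sup>2))) (at t)"
    using p by (auto intro!: derivative_eq_intros)
  moreover have "- (inverse ((1 + t\<^sup>2)\<^sup>2) * (2 * (1 + t\<^sup>2) * (2 * t)) * inverse ((1 + t\<^sup>2)\<^sup>2)) =
      - 4 * t / (1 + t\<^sup>2) * quartic_decay t"
  proof -
    define P where "P = 1 + t\<^sup>2"
    have "P \<noteq> 0" using p by (simp add: P_def)
    then show ?thesis unfolding quartic_decay_def P_def[symmetric]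
      by (simp add: field_simps power2_eq_square)
  qed
  ultimately show ?thesis unfolding quartic_decay_def[abs_def] by simp
qed

lemma quartic_decay_continuous: "continuous_on UNIV quartic_decay"
  by (rule DERIV_continuous_on) (rule has_field_derivative_at_within[OF quartic_decay_has_derivative])

lemma quartic_decay_borel [measurable]: "quartic_decay \<in> borel_measurable borel"
  by (rule borel_measurable_continuous_onI[OF quartic_decay_continuous])

text \<open>The primitive arctan settles the half-line; the other half follows by
  reflection.\<close>

lemma nn_integral_inverse_one_plus_square: "(\<integral>\<^sup>+t. ennreal (inverse (1 + t\<^sup>2)) \<partial>lborel) < \<infinity>"
proof -
  let ?f = "\<lambda>t::real. ennreal (inverse (1 + t\<^sup>2)) * indicator {0..} t"
  have *: "(\<integral>\<^sup>+t. ?f t \<partial>lborel) = ennreal (pi / 2 - arctan 0)"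
  proof (rule nn_integral_FTC_atLeast)
    show "(arctan has_real_derivative inverse (1 + x\<^sup>2)) (at x)" for x by (rule DERIV_arctan)
    show "0 \<le> inverse (1 + x\<^sup>2)" for x :: real using one_plus_square_pos[of x] by simp
  qed (auto intro: tendsto_arctan_at_top)
  have "(\<integral>\<^sup>+t. ?f t \<partial>lebesgue) = (\<integral>\<^sup>+t. ?f (- t) \<partial>lebesgue)"
  proof -
    have "?f \<in> borel_measurable lebesgue" by (intro borel_lebesgueI) measurable
    from nn_integral_lebesgue_affine[OF _ this, of "-1" 0] show ?thesis by simp
  qed
  then have **: "(\<integral>\<^sup>+t. ?f (- t) \<partial>lborel) = ennreal (pi / 2 - arctan 0)"
    using * by (simp add: nn_integral_completion)
  have "(\<integral>\<^sup>+t. ennreal (inverse (1 + t\<^sup>2)) \<partial>lborel) \<le> (\<integral>\<^sup>+t. ?f t + ?f (- t) \<partial>lborel)"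
    by (intro nn_integral_mono) (auto simp: indicator_def)
  also have "\<dots> = (\<integral>\<^sup>+t. ?f t \<partial>lborel) + (\<integral>\<^sup>+t. ?f (- t) \<partial>lborel)"
    by (rule nn_integral_add) measurable
  also have "\<dots> < \<infinity>" unfolding * ** by simp
  finally show ?thesis .
qed

section \<open>Integrals of products of one-variable functions\<close>

lemma prod_Basis_vec:
  fixes H :: "real^'n \<Rightarrow> 'c::comm_monoid_mult"
  shows "(\<Prod>b\<in>Basis. H b) = (\<Prod>i\<in>UNIV. H (axis i (1::real)))"
proof -
  have B: "(Basis :: (real^'n) set) = range (\<lambda>i. axis i 1)" by (auto simp: Basis_vec_def)
  have inj: "inj (\<lambda>i::'n. axis i (1::real))" by (auto simp: inj_def axis_eq_axis)
  show ?thesis unfolding B prod.reindex[OF inj] by (simp add: o_def)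
qed

lemma nn_integral_prod_vec:
  fixes p :: "'n::finite \<Rightarrow> real \<Rightarrow> real"
  assumes m: "\<And>i. p i \<in> borel_measurable borel" and nn: "\<And>i t. 0 \<le> p i t"
  shows "(\<integral>\<^sup>+x. ennreal (\<Prod>i\<in>UNIV. p i (x $ i)) \<partial>lborel) = (\<Prod>i\<in>UNIV. \<integral>\<^sup>+t. ennreal (p i t) \<partial>lborel)"
proof -
  \<comment> \<open>The product formula is indexed by basis vectors; \<open>P\<close> recovers the
    coordinate that belongs to such a vector.\<close>
  define P where "P = (\<lambda>b::real^'n. p (SOME i. b = axis i 1))"
  have P: "P (axis i 1) = p i" for i
    unfolding P_def by (auto simp: axis_eq_axis)
  have "(\<integral>\<^sup>+x. (\<Prod>b\<in>Basis. ennreal (P b (x \<bullet> b))) \<partial>(lborel :: (real^'n) measure)) = (\<Prod>b\<in>Basis. \<integral>\<^sup>+t. ennreal (P b t) \<partial>lborel)"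
    using m by (intro nn_integral_lborel_prod) (auto simp: P_def)
  then show ?thesis
    by (simp add: prod_Basis_vec P inner_axis prod_ennreal nn)
qed

text \<open>The shift falls on the bounded continuous factor, and a multiple of the integrable one
  dominates.\<close>

lemma continuous_on_convolution:
  fixes h \<rho> :: "real^'n \<Rightarrow> real"
  assumes "continuous_on UNIV h" "\<And>y. \<bar>h y\<bar> \<le> B" "\<rho> \<in> borel_measurable borel" "integrable lborel \<rho>"
  shows "continuous_on UNIV (\<lambda>x. LINT y|lborel. h (y - x) * \<rho> y)"
  unfolding continuous_on_sequentially
proof (intro allI ballI impI)
  fix X and a :: "real^'n" assume X: "(\<forall>n. X n \<in> UNIV) \<and> X \<longlonglongrightarrow> a"
  have hm [measurable]: "h \<in> borel_measurable borel" by (rule borel_measurable_continuous_onI[OF assms(1)])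
  have [measurable]: "\<rho> \<in> borel_measurable borel" by (rule assms)
  have "(\<lambda>n. LINT y|lborel. h (y - X n) * \<rho> y) \<longlonglongrightarrow> (LINT y|lborel. h (y - a) * \<rho> y)"
  proof (rule integral_dominated_convergence[where w = "\<lambda>y. B * \<bar>\<rho> y\<bar>"])
    have "(\<lambda>n. h (y - X n)) \<longlonglongrightarrow> h (y - a)" for y
    proof -
      have "isCont h (y - a)" using assms(1) by (simp add: continuous_on_eq_continuous_at)
      moreover have "(\<lambda>n. y - X n) \<longlonglongrightarrow> y - a" using X by (intro tendsto_intros) auto
      ultimately show ?thesis by (rule isCont_tendsto_compose)
    qed
    then show "AE y in lborel. (\<lambda>n. h (y - X n) * \<rho> y) \<longlonglongrightarrow> h (y - a) * \<rho> y"
      by (intro AE_I2 tendsto_mult tendsto_const)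
    show "AE y in lborel. norm (h (y - X n) * \<rho> y) \<le> B * \<bar>\<rho> y\<bar>" for n
      using assms(2) by (simp add: abs_mult mult_right_mono)
    show "integrable lborel (\<lambda>y. B * \<bar>\<rho> y\<bar>)" using assms(4) by simp
  qed measurable
  then show "((\<lambda>x. LINT y|lborel. h (y - x) * \<rho> y) \<circ> X) \<longlonglongrightarrow> (LINT y|lborel. h (y - a) * \<rho> y)"
    by (simp add: o_def)
qed

text \<open>\<open>s\<close> is the width, \<open>C\<close> bounds the peak and \<open>M\<close> is
  the second moment at unit width. The factor 2 in the gradient bound is the supremum of |4 t / (1 +
  t^2)|.\<close>

definition smoothing_kernel ::
  "real \<Rightarrow> real \<Rightarrow> real \<Rightarrow> (real^'n::finite \<Rightarrow> real) \<Rightarrow> (real^'n \<Rightarrow> real^'n) \<Rightarrow> bool" where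
  "smoothing_kernel C M s K D \<longleftrightarrow>
     (\<forall>x. 0 < K x \<and> K x \<le> C) \<and> continuous_on UNIV K \<and> continuous_on UNIV D \<and>
     (\<forall>x i. ((\<lambda>t. K (x + t *\<^sub>R axis i 1)) has_vector_derivative D x $ i) (at 0)) \<and>
     (\<forall>x i. \<bar>D x $ i\<bar> \<le> 2 / s * K x) \<and>
     (\<integral>\<^sup>+x. ennreal (K x) \<partial>lborel) = 1 \<and>
     (\<integral>\<^sup>+x. ennreal (K x * (norm x)\<^sup>2) \<partial>lborel) = ennreal (s\<^sup>2 * M)"

lemma unit_smoothing_kernel:
  "\<exists>C M (K :: real^'n \<Rightarrow> real) D. 0 \<le> M \<and> 0 \<le> C \<and> smoothing_kernel C M 1 K D"
proof -
  define P :: "real^'n \<Rightarrow> real" where "P = (\<lambda>x. \<Prod>i\<in>UNIV. quartic_decay (x $ i))"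
  have Ppos: "0 < P x" for x unfolding P_def by (intro prod_pos) (simp add: quartic_decay_pos)
  have P1: "P x \<le> 1" for x
    unfolding P_def by (intro prod_le_1) (simp add: quartic_decay_le less_imp_le[OF quartic_decay_pos])
  have Pc: "continuous_on UNIV P"
    unfolding P_def
    by (intro continuous_on_prod continuous_on_compose2[OF quartic_decay_continuous] continuous_intros) auto
  have [measurable]: "P \<in> borel_measurable borel" by (rule borel_measurable_continuous_onI[OF Pc])
  have fin: "(\<integral>\<^sup>+x. ennreal (P x) \<partial>lborel) < \<infinity>"
  proof -
    have "(\<integral>\<^sup>+x. ennreal (P x) \<partial>lborel) = (\<Prod>i\<in>(UNIV::'n set). \<integral>\<^sup>+t. ennreal (quartic_decay t) \<partial>lborel)"
      unfolding P_def by (rule nn_integral_prod_vec) (simp_all add: less_imp_le[OF quartic_decay_pos])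
    also have "\<dots> < \<infinity>"
    proof -
      have "(\<integral>\<^sup>+t. ennreal (quartic_decay t) \<partial>lborel) \<le> (\<integral>\<^sup>+t. ennreal (inverse (1 + t\<^sup>2)) \<partial>lborel)"
        by (intro nn_integral_mono ennreal_leI quartic_decay_le)
      also note nn_integral_inverse_one_plus_square
      finally show ?thesis by (simp add: power_less_top_ennreal)
    qed
    finally show ?thesis .
  qed
  have mom: "(\<integral>\<^sup>+x. ennreal (P x * (norm x)\<^sup>2) \<partial>lborel) < \<infinity>"
  proof -
    \<comment> \<open>The second moment in direction i is again a product of one-variable integrals,
      with an additional factor t^2 in position i.\<close>
    let ?p = "\<lambda>i j t. if j = i then t\<^sup>2 * quartic_decay t else quartic_decay t"
    have eq: "(x $ i)\<^sup>2 * P x = (\<Prod>j\<in>UNIV. ?p i j (x $ j))" for x :: "real^'n" and i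
    proof -
      have "(\<Prod>j\<in>UNIV. ?p i j (x $ j)) = (x $ i)\<^sup>2 * quartic_decay (x $ i) * (\<Prod>j\<in>UNIV - {i}. quartic_decay (x $ j))"
        by (subst prod.remove[of _ i]) (auto intro!: prod.cong)
      also have "\<dots> = (x $ i)\<^sup>2 * P x"
        unfolding P_def by (subst (2) prod.remove[of _ i]) (auto simp: mult.assoc)
      finally show ?thesis by simp
    qed
    have "P x * (norm x)\<^sup>2 = (\<Sum>i\<in>UNIV. (x $ i)\<^sup>2 * P x)" for x :: "real^'n"
      by (simp add: norm_vec_def L2_set_def sum_nonneg sum_distrib_left mult.commute[of _ "P x"])
    then have "(\<integral>\<^sup>+x. ennreal (P x * (norm x)\<^sup>2) \<partial>lborel) = (\<integral>\<^sup>+x. (\<Sum>i\<in>UNIV. ennreal ((x $ i)\<^sup>2 * P x)) \<partial>lborel)"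
      using Ppos by (simp add: sum_ennreal less_imp_le)
    also have "\<dots> = (\<Sum>i\<in>UNIV. \<integral>\<^sup>+x. ennreal ((x $ i)\<^sup>2 * P x) \<partial>lborel)"
      by (rule nn_integral_sum) measurable
    also have "\<dots> = (\<Sum>i\<in>(UNIV::'n set). \<Prod>j\<in>UNIV. \<integral>\<^sup>+t. ennreal (?p i j t) \<partial>lborel)"
      unfolding eq
    proof (rule sum.cong[OF refl])
      show "(\<integral>\<^sup>+x. ennreal (\<Prod>j\<in>UNIV. ?p i j (x $ j)) \<partial>lborel) = (\<Prod>j\<in>UNIV. \<integral>\<^sup>+t. ennreal (?p i j t) \<partial>lborel)" for i :: 'n
        by (rule nn_integral_prod_vec[of "?p i"]) (auto simp: less_imp_le[OF quartic_decay_pos])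
    qed
    also have "\<dots> < \<infinity>"
    proof -
      have "(\<integral>\<^sup>+t. ennreal (?p i j t) \<partial>lborel) \<le> (\<integral>\<^sup>+t. ennreal (inverse (1 + t\<^sup>2)) \<partial>lborel)" for i j :: 'n
        by (intro nn_integral_mono ennreal_leI) (auto intro: quartic_decay_le)
      then have "(\<integral>\<^sup>+t. ennreal (?p i j t) \<partial>lborel) < \<infinity>" for i j :: 'n
        using nn_integral_inverse_one_plus_square by (rule le_less_trans)
      then have "(\<Prod>j\<in>UNIV. \<integral>\<^sup>+t. ennreal (?p i j t) \<partial>lborel) \<noteq> top" for i :: 'n
        unfolding ennreal_prod_eq_top by (metis infinity_ennreal_def less_irrefl)
      then show ?thesis by (simp add: less_top)
    qed
    finally show ?thesis .
  qed
  \<comment> \<open>\<open>P\<close> will be divided by its mass. A positive function with integral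
    0 would make the whole space a null set.\<close>
  have pos: "0 < (\<integral>\<^sup>+x. ennreal (P x) \<partial>lborel)"
  proof (rule ccontr)
    assume "\<not> ?thesis"
    then have "(\<integral>\<^sup>+x. ennreal (P x) \<partial>lborel) = 0" by simp
    then have "AE x in (lborel :: (real^'n) measure). False"
      using Ppos by (subst (asm) nn_integral_0_iff_AE) (auto simp: not_le[symmetric] ennreal_eq_0_iff)
    then have "emeasure lborel (UNIV :: (real^'n) set) = 0"
      by (simp add: AE_iff_null null_sets_def)
    then show False by simp
  qed
  obtain Z where Z: "0 < Z" "(\<integral>\<^sup>+x. ennreal (P x) \<partial>lborel) = ennreal Z"
    using fin pos by (cases "\<integral>\<^sup>+x. ennreal (P x) \<partial>lborel") auto
  obtain M where M: "0 \<le> M" "(\<integral>\<^sup>+x. ennreal (P x * (norm x)\<^sup>2) \<partial>lborel) = ennreal M"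
    using mom by (cases "\<integral>\<^sup>+x. ennreal (P x * (norm x)\<^sup>2) \<partial>lborel") auto
  define K where "K = (\<lambda>x. P x / Z)"
  define D :: "real^'n \<Rightarrow> real^'n" where "D = (\<lambda>x. vec_lambda (\<lambda>i. - 4 * (x $ i) / (1 + (x $ i)\<^sup>2) * K x))"
  have "smoothing_kernel (1 / Z) (M / Z) 1 K D"
    unfolding smoothing_kernel_def
  proof (intro conjI allI)
    show "0 < K x" for x unfolding K_def using Ppos Z by simp
    show "K x \<le> 1 / Z" for x unfolding K_def using P1 Z by (simp add: divide_right_mono)
    show Kc: "continuous_on UNIV K" unfolding K_def using Z by (intro continuous_intros Pc) simp
    show "continuous_on UNIV D"
      unfolding D_def
      by (intro continuous_on_vec_lambda continuous_intros Kc)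
         (metis one_plus_square_pos order_less_irrefl)
    show "((\<lambda>t. K (x + t *\<^sub>R axis i 1)) has_vector_derivative D x $ i) (at 0)" for x i
    proof -
      \<comment> \<open>Along axis i only one factor moves; the others form the constant
        \<open>?R\<close>.\<close>
      let ?R = "\<Prod>j\<in>UNIV - {i}. quartic_decay (x $ j)"
      have K_eq: "K (x + t *\<^sub>R axis i 1) = quartic_decay (x $ i + t) * (?R / Z)" for t
        unfolding K_def P_def by (subst prod.remove[of _ i]) (auto simp: axis_def intro!: prod.cong)
      have "((\<lambda>t. quartic_decay (x $ i + t)) has_real_derivative
          (- 4 * (x $ i + 0) / (1 + (x $ i + 0)\<^sup>2) * quartic_decay (x $ i + 0)) * 1) (at 0)"
        by (rule DERIV_chain2[OF quartic_decay_has_derivative]) (auto intro!: derivative_eq_intros)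
      from DERIV_cmult_right[OF this, of "?R / Z"]
      have "((\<lambda>t. quartic_decay (x $ i + t) * (?R / Z)) has_real_derivative
          (- 4 * (x $ i) / (1 + (x $ i)\<^sup>2)) * (quartic_decay (x $ i) * (?R / Z))) (at 0)"
        by (simp add: mult.assoc)
      moreover have "quartic_decay (x $ i) * (?R / Z) = K x" using K_eq[of 0] by simp
      ultimately have "((\<lambda>t. quartic_decay (x $ i + t) * (?R / Z)) has_real_derivative
          (- 4 * (x $ i) / (1 + (x $ i)\<^sup>2)) * K x) (at 0)" by (simp only:)
      then show ?thesis
        unfolding K_eq D_def has_real_derivative_iff_has_vector_derivative by simp
    qed
    show "\<bar>D x $ i\<bar> \<le> 2 / 1 * K x" for x i
    proof -
      have "2 * \<bar>x $ i\<bar> \<le> 1 + (x $ i)\<^sup>2"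
        using sum_squares_bound[of 1 "\<bar>x $ i\<bar>"] by simp
      then have le: "4 * \<bar>x $ i\<bar> / (1 + (x $ i)\<^sup>2) \<le> 2"
        using one_plus_square_pos[of "x $ i"] by (simp add: divide_le_eq)
      have "0 < K x" unfolding K_def using Ppos Z by simp
      have "\<bar>D x $ i\<bar> = 4 * \<bar>x $ i\<bar> / (1 + (x $ i)\<^sup>2) * K x"
        unfolding D_def using \<open>0 < K x\<close> one_plus_square_pos[of "x $ i"] by (simp add: abs_mult)
      also have "\<dots> \<le> 2 * K x" using le \<open>0 < K x\<close> by (intro mult_right_mono) auto
      finally show ?thesis by simp
    qed
    have "(\<integral>\<^sup>+x. ennreal (K x) \<partial>lborel) = (\<integral>\<^sup>+x. ennreal (1 / Z) * ennreal (P x) \<partial>lborel)"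
      unfolding K_def using Z Ppos by (simp add: less_imp_le flip: ennreal_mult)
    also have "\<dots> = 1"
      using Z by (simp add: nn_integral_cmult flip: ennreal_mult)
    finally show "(\<integral>\<^sup>+x. ennreal (K x) \<partial>lborel) = 1" .
    have "(\<integral>\<^sup>+x. ennreal (K x * (norm x)\<^sup>2) \<partial>lborel) = (\<integral>\<^sup>+x. ennreal (1 / Z) * ennreal (P x * (norm x)\<^sup>2) \<partial>lborel)"
      unfolding K_def using Z Ppos by (simp add: less_imp_le flip: ennreal_mult)
    also have "\<dots> = ennreal (1\<^sup>2 * (M / Z))"
      using Z M by (simp add: nn_integral_cmult flip: ennreal_mult)
    finally show "(\<integral>\<^sup>+x. ennreal (K x * (norm x)\<^sup>2) \<partial>lborel) = ennreal (1\<^sup>2 * (M / Z))" .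
  qed
  moreover have "0 \<le> M / Z" "0 \<le> 1 / Z" using M Z by simp_all
  ultimately show ?thesis by blast
qed

text \<open>The dilation preserves the mass: the peak scales like s^(-n), the logarithmic gradient
  like 1/s and the second moment like s^2.\<close>

lemma smoothing_kernel_rescale:
  fixes K :: "real^'n \<Rightarrow> real"
  assumes K: "smoothing_kernel C M 1 K D" and s: "0 < s" and C: "0 \<le> C"
  shows "smoothing_kernel (C / s ^ CARD('n)) M s
    (\<lambda>x. K (inverse s *\<^sub>R x) / s ^ CARD('n)) (\<lambda>x. (inverse s / s ^ CARD('n)) *\<^sub>R D (inverse s *\<^sub>R x))"
proof -
  let ?n = "CARD('n)"
  have sn: "0 < s ^ ?n" using s by simp
  have Kp: "0 < K x" and KC: "K x \<le> C" and Kc: "continuous_on UNIV K" and Dc: "continuous_on UNIV D"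
    and der: "((\<lambda>t. K (x + t *\<^sub>R axis i 1)) has_vector_derivative D x $ i) (at 0)"
    and DK: "\<bar>D x $ i\<bar> \<le> 2 * K x" and K1: "(\<integral>\<^sup>+x. ennreal (K x) \<partial>lborel) = 1"
    and KM: "(\<integral>\<^sup>+x. ennreal (K x * (norm x)\<^sup>2) \<partial>lborel) = ennreal M" for x i
    using K unfolding smoothing_kernel_def by auto
  have [measurable]: "K \<in> borel_measurable borel" by (rule borel_measurable_continuous_onI[OF Kc])
  have scale: "(\<integral>\<^sup>+x. ennreal (h (inverse s *\<^sub>R x) / s ^ ?n) \<partial>lborel) = (\<integral>\<^sup>+x. ennreal (h x) \<partial>lborel)"
    if [measurable]: "h \<in> borel_measurable borel" and nn: "\<And>x. 0 \<le> h x" for h :: "real^'n \<Rightarrow> real"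
  proof -
    have "(\<lambda>x. ennreal (h x)) \<in> borel_measurable lebesgue" by (intro borel_lebesgueI) measurable
    from nn_integral_lebesgue_affine[OF _ this, of "inverse s" 0] s
    have "(\<integral>\<^sup>+x. ennreal (h x) \<partial>lborel) = ennreal (inverse s ^ ?n) * (\<integral>\<^sup>+x. ennreal (h (inverse s *\<^sub>R x)) \<partial>lborel)"
      by (simp add: nn_integral_completion)
    also have "\<dots> = (\<integral>\<^sup>+x. ennreal (inverse s ^ ?n) * ennreal (h (inverse s *\<^sub>R x)) \<partial>lborel)"
      by (rule nn_integral_cmult[symmetric]) measurable
    also have "\<dots> = (\<integral>\<^sup>+x. ennreal (h (inverse s *\<^sub>R x) / s ^ ?n) \<partial>lborel)"
      using s nn by (intro nn_integral_cong) (simp add: power_inverse divide_inverse mult.commute flip: ennreal_mult)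
    finally show ?thesis by simp
  qed
  show ?thesis
    unfolding smoothing_kernel_def
  proof (intro conjI allI)
    fix x i
    show "0 < K (inverse s *\<^sub>R x) / s ^ ?n" using Kp sn by simp
    show "K (inverse s *\<^sub>R x) / s ^ ?n \<le> C / s ^ ?n" using KC sn by (simp add: divide_right_mono)
    show "continuous_on UNIV (\<lambda>x. K (inverse s *\<^sub>R x) / s ^ ?n)"
      using s by (intro continuous_on_divide continuous_on_compose2[OF Kc] continuous_intros) auto
    show "continuous_on UNIV (\<lambda>x. (inverse s / s ^ ?n) *\<^sub>R D (inverse s *\<^sub>R x))"
      by (intro continuous_on_scaleR continuous_on_compose2[OF Dc] continuous_intros) auto
    let ?x = "inverse s *\<^sub>R x"
    have "((\<lambda>t. inverse s * t) has_vector_derivative inverse s) (at 0)"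
      by (auto intro!: derivative_eq_intros)
    moreover have "((\<lambda>t. K (?x + t *\<^sub>R axis i 1)) has_vector_derivative D ?x $ i) (at (inverse s * 0))"
      using der by simp
    ultimately have "(((\<lambda>t. K (?x + t *\<^sub>R axis i 1)) \<circ> (\<lambda>t. inverse s * t)) has_vector_derivative
        inverse s *\<^sub>R (D ?x $ i)) (at 0)"
      by (rule vector_diff_chain_at)
    then have "((\<lambda>t. K (inverse s *\<^sub>R (x + t *\<^sub>R axis i 1))) has_vector_derivative inverse s *\<^sub>R (D ?x $ i)) (at 0)"
      by (simp add: o_def scaleR_add_right)
    from has_vector_derivative_divide[OF this, of "s ^ ?n"]
    show "((\<lambda>t. K (inverse s *\<^sub>R (x + t *\<^sub>R axis i 1)) / s ^ ?n) has_vector_derivative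
        ((inverse s / s ^ ?n) *\<^sub>R D ?x) $ i) (at 0)" by simp
    have "\<bar>((inverse s / s ^ ?n) *\<^sub>R D ?x) $ i\<bar> = (inverse s / s ^ ?n) * \<bar>D ?x $ i\<bar>"
      using s by (simp add: abs_mult)
    also have "\<dots> \<le> (inverse s / s ^ ?n) * (2 * K ?x)"
      using s by (intro mult_left_mono DK) simp
    finally show "\<bar>((inverse s / s ^ ?n) *\<^sub>R D ?x) $ i\<bar> \<le> 2 / s * (K ?x / s ^ ?n)"
      by (simp add: divide_inverse mult_ac)
    show "(\<integral>\<^sup>+x. ennreal (K (inverse s *\<^sub>R x) / s ^ ?n) \<partial>lborel) = 1"
      by (subst scale) (simp_all add: K1 less_imp_le[OF Kp])
    have eq: "K (inverse s *\<^sub>R x) / s ^ ?n * (norm x)\<^sup>2 =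
        (s\<^sup>2 * (K (inverse s *\<^sub>R x) * (norm (inverse s *\<^sub>R x))\<^sup>2)) / s ^ ?n" for x
      using s by (simp add: power_mult_distrib power_divide divide_inverse power_inverse)
    have "(\<integral>\<^sup>+x. ennreal (K (inverse s *\<^sub>R x) / s ^ ?n * (norm x)\<^sup>2) \<partial>lborel) =
        (\<integral>\<^sup>+x. ennreal (s\<^sup>2 * (K x * (norm x)\<^sup>2)) \<partial>lborel)"
      unfolding eq by (rule scale) (simp_all add: less_imp_le[OF Kp])
    also have "\<dots> = ennreal (s\<^sup>2) * (\<integral>\<^sup>+x. ennreal (K x * (norm x)\<^sup>2) \<partial>lborel)"
      using Kp by (simp add: ennreal_mult less_imp_le nn_integral_cmult)
    also have "\<dots> = ennreal (s\<^sup>2 * M)"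
      unfolding KM by (simp add: ennreal_mult')
    finally show "(\<integral>\<^sup>+x. ennreal (K (inverse s *\<^sub>R x) / s ^ ?n * (norm x)\<^sup>2) \<partial>lborel) = ennreal (s\<^sup>2 * M)" .
  qed
qed

text \<open>\<open>C\<close> and \<open>M\<close> are common to all widths. Large \<open>s\<close>
  makes the peak small, for Nash's inequality; small \<open>s\<close> makes the second moment small,
  for the recovery state.\<close>

lemma smoothing_kernels_exist:
  obtains C M where "0 \<le> C" "0 \<le> M"
    "\<And>s. 0 < s \<Longrightarrow> \<exists>(K :: real^'n \<Rightarrow> real) D. smoothing_kernel (C / s ^ CARD('n)) M s K D"
  using unit_smoothing_kernel smoothing_kernel_rescale by metis

section \<open>Smoothing of densities\<close>

lemma in_L2_cong_AE:
  fixes u v :: "real^'n \<Rightarrow> 'b::euclidean_space"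
  assumes u: "in_L2 u" and eq: "AE x in lebesgue. u x = v x"
  shows "in_L2 v"
proof -
  have m: "u \<in> borel_measurable lebesgue" "v \<in> borel_measurable lebesgue"
    using u borel_measurable_lebesgue_AE[OF _ eq] unfolding in_L2_def by auto
  have "integrable lebesgue (\<lambda>x. (norm (v x))\<^sup>2)"
  proof (rule integrable_cong_AE[THEN iffD1])
    show "integrable lebesgue (\<lambda>x. (norm (u x))\<^sup>2)" using u unfolding in_L2_def by simp
    show "AE x in lebesgue. (norm (u x))\<^sup>2 = (norm (v x))\<^sup>2" using eq by eventually_elim simp
  qed (use m in measurable)
  then show ?thesis unfolding in_L2_def using m by simp
qed

lemma in_L2_weak_grad:
  fixes u :: "real^'n \<Rightarrow> 'b::euclidean_space"
  assumes "has_weak_gradient u g" "in_L2 g"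
  shows "in_L2 (weak_grad u)"
proof (rule in_L2_cong_AE[OF assms(2)])
  show "AE x in lebesgue. g x = weak_grad u x" using weak_grad_AE[OF assms(1)] by eventually_elim simp
qed

lemma in_L2_I_borel:
  fixes u :: "real^'n \<Rightarrow> 'b::euclidean_space"
  assumes "u \<in> borel_measurable borel" "integrable lborel w" "\<And>x. (norm (u x))\<^sup>2 \<le> w x"
  shows "in_L2 u"
proof -
  have "(\<lambda>x. (norm (u x))\<^sup>2) \<in> borel_measurable lborel" using assms(1) by simp
  then have "integrable lborel (\<lambda>x. (norm (u x))\<^sup>2)"
    by (rule Bochner_Integration.integrable_bound[OF assms(2)])
       (use assms(3) in \<open>auto intro!: AE_I2 order_trans[OF _ abs_ge_self]\<close>)
  then show ?thesis
    unfolding in_L2_def using assms(1) by (simp add: integrable_completion borel_lebesgueI)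
qed

section \<open>The harmonic potential\<close>

lemma harmonic_nonneg: "0 \<le> harmonic \<gamma> x"
  unfolding harmonic_def by (simp add: sum_nonneg)

lemma harmonic_continuous: "continuous_on UNIV (harmonic \<gamma>)"
  unfolding harmonic_def by (intro continuous_intros) simp_all

lemma harmonic_borel [measurable]: "harmonic \<gamma> \<in> borel_measurable borel"
  by (rule borel_measurable_continuous_onI[OF harmonic_continuous])

lemma harmonic_le: "harmonic \<gamma> x \<le> (\<Sum>i\<in>UNIV. (\<gamma> i)\<^sup>2) * (norm x)\<^sup>2"
proof -
  have "(\<Sum>i\<in>UNIV. (\<gamma> i)\<^sup>2 * (x $ i)\<^sup>2) \<le> (\<Sum>i\<in>UNIV. (\<gamma> i)\<^sup>2 * (norm x)\<^sup>2)"
    by (intro sum_mono mult_left_mono) (simp_all add: abs_le_square_iff[symmetric] component_le_norm_cart)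
  moreover have "0 \<le> (\<Sum>i\<in>UNIV. (\<gamma> i)\<^sup>2 * (norm x)\<^sup>2)" by (simp add: sum_nonneg)
  ultimately show ?thesis unfolding harmonic_def sum_distrib_right by linarith
qed

text \<open>Young's inequality with weight \<open>s\<close>. The potential at \<open>z\<close> is
  multiplied by a factor close to 1 for small \<open>s\<close>, and the large factor 1/s will meet a
  second moment of order s^2.\<close>

lemma harmonic_diff_le:
  assumes s: "0 < s"
  shows "harmonic \<gamma> (z - y) \<le> (1 + s) * harmonic \<gamma> z + (1 + 1 / s) * harmonic \<gamma> y"
proof -
  have "(a - b)\<^sup>2 \<le> (1 + s) * a\<^sup>2 + (1 + 1 / s) * b\<^sup>2" for a b :: real
  proof -
    have "0 \<le> (s * a + b)\<^sup>2 / s" using s by simp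
    also have "\<dots> = s * a\<^sup>2 + 2 * a * b + b\<^sup>2 / s"
      using s by (simp add: power2_eq_square field_simps)
    finally show ?thesis using s by (simp add: power2_diff algebra_simps)
  qed
  then have "(\<gamma> i)\<^sup>2 * ((z - y) $ i)\<^sup>2 \<le> (\<gamma> i)\<^sup>2 * ((1 + s) * (z $ i)\<^sup>2 + (1 + 1 / s) * (y $ i)\<^sup>2)" for i
    unfolding vector_minus_component by (intro mult_left_mono) simp_all
  then have "(\<gamma> i)\<^sup>2 * ((z - y) $ i)\<^sup>2 \<le> (1 + s) * ((\<gamma> i)\<^sup>2 * (z $ i)\<^sup>2) + (1 + 1 / s) * ((\<gamma> i)\<^sup>2 * (y $ i)\<^sup>2)" for i
    by (simp only: distrib_left mult.left_commute)
  then have "(\<Sum>i\<in>UNIV. (\<gamma> i)\<^sup>2 * ((z - y) $ i)\<^sup>2) \<le>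
      (\<Sum>i\<in>UNIV. (1 + s) * ((\<gamma> i)\<^sup>2 * (z $ i)\<^sup>2) + (1 + 1 / s) * ((\<gamma> i)\<^sup>2 * (y $ i)\<^sup>2))"
    by (rule sum_mono)
  then show ?thesis
    unfolding harmonic_def by (simp add: sum.distrib sum_distrib_left[symmetric])
qed

lemma ennreal_norm_square_vec: "ennreal ((norm (v :: real^'m))\<^sup>2) = (\<Sum>i\<in>UNIV. ennreal ((v $ i)\<^sup>2))"
  by (simp add: norm_vec_def L2_set_def sum_nonneg sum_ennreal)

text \<open>The bounds for potential and square are inequalities in [0, \<infinity>], so they are
  meaningful for every probability density \<open>\<rho>\<close>.\<close>

locale smoothing =
  fixes C M s :: real and K :: "real^'n \<Rightarrow> real" and D :: "real^'n \<Rightarrow> real^'n"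
    and \<rho> :: "real^'n \<Rightarrow> real"
  assumes kernel: "smoothing_kernel C M s K D" and s: "0 < s" and M: "0 \<le> M"
    and \<rho>m [measurable]: "\<rho> \<in> borel_measurable borel" and \<rho>_nonneg: "\<And>x. 0 \<le> \<rho> x"
    and \<rho>_mass: "(\<integral>\<^sup>+x. ennreal (\<rho> x) \<partial>lborel) = 1"
begin

text \<open>With the argument \<open>y - x\<close> the variable \<open>x\<close> sits in the
  differentiable factor, so derivatives fall on \<open>K\<close>. After a shift this is an average
  of translates of \<open>\<rho>\<close>, the form used for convexity.\<close>

definition smoothed :: "real^'n \<Rightarrow> real" where
  "smoothed x = (LINT y|lborel. K (y - x) * \<rho> y)"

definition smoothed_grad :: "real^'n \<Rightarrow> real^'n" where
  "smoothed_grad x = vec_lambda (\<lambda>i. LINT y|lborel. (- (D (y - x) $ i)) * \<rho> y)"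

lemma K_pos: "0 < K x" and K_le: "K x \<le> C" and K_cont: "continuous_on UNIV K"
  and D_cont: "continuous_on UNIV D"
  and K_der: "((\<lambda>t. K (x + t *\<^sub>R axis i 1)) has_vector_derivative D x $ i) (at 0)"
  and D_le: "\<bar>D x $ i\<bar> \<le> 2 / s * K x"
  and K_mass: "(\<integral>\<^sup>+x. ennreal (K x) \<partial>lborel) = 1"
  and K_moment: "(\<integral>\<^sup>+x. ennreal (K x * (norm x)\<^sup>2) \<partial>lborel) = ennreal (s\<^sup>2 * M)"
  using kernel unfolding smoothing_kernel_def by auto

lemma K_nonneg: "0 \<le> K x"
  using K_pos[of x] by simp

lemma K_borel [measurable]: "K \<in> borel_measurable borel"
  by (rule borel_measurable_continuous_onI[OF K_cont])

lemma Di_cont: "continuous_on UNIV (\<lambda>x. - (D x $ i))"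
  by (intro continuous_intros D_cont)

lemma Di_borel [measurable]: "(\<lambda>x. D x $ i) \<in> borel_measurable borel"
  using borel_measurable_continuous_onI[OF continuous_on_minus[OF Di_cont]] by simp

lemma Di_bound: "\<bar>- (D x $ i)\<bar> \<le> 2 / s * C"
proof -
  have "2 / s * K x \<le> 2 / s * C" by (rule mult_left_mono[OF K_le]) (use s in simp)
  then show ?thesis using D_le[of x i] by simp
qed

lemma \<rho>_integrable: "integrable lborel \<rho>" and \<rho>_integral: "(LINT x|lborel. \<rho> x) = 1"
proof -
  show "integrable lborel \<rho>"
    by (rule integrableI_bounded) (use \<rho>_mass \<rho>_nonneg in auto)
  then show "(LINT x|lborel. \<rho> x) = 1"
    using nn_integral_eq_integral[of lborel \<rho>] \<rho>_nonneg \<rho>_mass by simp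
qed

lemma K\<rho>_integrable: "integrable lborel (\<lambda>y. K (y - x) * \<rho> y)"
proof (rule Bochner_Integration.integrable_bound)
  show "integrable lborel (\<lambda>y. C * \<rho> y)" using \<rho>_integrable by simp
  show "AE y in lborel. norm (K (y - x) * \<rho> y) \<le> norm (C * \<rho> y)"
    using K_le K_nonneg \<rho>_nonneg order_trans[OF K_nonneg K_le]
    by (intro AE_I2) (auto simp: abs_mult intro!: mult_right_mono)
qed measurable

lemma D\<rho>_integrable: "integrable lborel (\<lambda>y. (- (D (y - x) $ i)) * \<rho> y)"
proof (rule Bochner_Integration.integrable_bound)
  show "integrable lborel (\<lambda>y. (2 / s * C) * \<rho> y)" using \<rho>_integrable by simp
  have "\<bar>- (D (y - x) $ i) * \<rho> y\<bar> \<le> (2 / s * C) * \<rho> y" for y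
    unfolding abs_mult abs_of_nonneg[OF \<rho>_nonneg] by (rule mult_right_mono[OF Di_bound \<rho>_nonneg])
  then show "AE y in lborel. norm (- (D (y - x) $ i) * \<rho> y) \<le> norm ((2 / s * C) * \<rho> y)"
    by (intro AE_I2) (simp only: real_norm_def, rule order_trans[OF _ abs_ge_self])
qed measurable

text \<open>As \<open>K\<close> is positive everywhere, a zero would force \<open>\<rho>\<close> to
  vanish almost everywhere, against its mass 1.\<close>

lemma smoothed_pos: "0 < smoothed x"
proof -
  have "0 \<le> smoothed x"
    unfolding smoothed_def using K_nonneg \<rho>_nonneg by (intro integral_nonneg_AE) simp
  moreover have "smoothed x \<noteq> 0"
  proof
    assume "smoothed x = 0"
    then have "AE y in lborel. K (y - x) * \<rho> y = 0"
      unfolding smoothed_def using K_nonneg \<rho>_nonneg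
      by (subst (asm) integral_nonneg_eq_0_iff_AE[OF K\<rho>_integrable]) auto
    then have "AE y in lborel. ennreal (\<rho> y) = 0"
    proof eventually_elim
      case (elim y)
      then show ?case using K_pos[of "y - x"] by simp
    qed
    then have "(\<integral>\<^sup>+y. ennreal (\<rho> y) \<partial>lborel) = 0"
      by (subst nn_integral_0_iff_AE) auto
    then show False using \<rho>_mass by simp
  qed
  ultimately show ?thesis by simp
qed

lemma smoothed_le: "smoothed x \<le> C"
proof -
  have "smoothed x \<le> (LINT y|lborel. C * \<rho> y)"
    unfolding smoothed_def
    by (intro integral_mono K\<rho>_integrable) (simp_all add: \<rho>_integrable mult_right_mono K_le \<rho>_nonneg)
  then show ?thesis by (simp add: \<rho>_integral)
qed

lemma smoothed_continuous: "continuous_on UNIV smoothed"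
  unfolding smoothed_def[abs_def]
  by (rule continuous_on_convolution[OF K_cont _ \<rho>m \<rho>_integrable, where B = C])
     (use K_nonneg K_le in simp)

lemma smoothed_borel [measurable]: "smoothed \<in> borel_measurable borel"
  by (rule borel_measurable_continuous_onI[OF smoothed_continuous])

lemma smoothed_grad_continuous: "continuous_on UNIV smoothed_grad"
  unfolding smoothed_grad_def[abs_def]
  by (intro continuous_on_vec_lambda continuous_on_convolution[OF Di_cont Di_bound \<rho>m \<rho>_integrable])

lemma smoothed_grad_borel [measurable]: "smoothed_grad \<in> borel_measurable borel"
  by (rule borel_measurable_continuous_onI[OF smoothed_grad_continuous])

text \<open>The pointwise bound of \<open>D\<close> by \<open>K\<close> survives integration against
  the nonnegative \<open>\<rho>\<close>.\<close>

lemma smoothed_grad_le: "\<bar>smoothed_grad x $ i\<bar> \<le> 2 / s * smoothed x"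
proof -
  have "\<bar>smoothed_grad x $ i\<bar> \<le> (LINT y|lborel. \<bar>- (D (y - x) $ i) * \<rho> y\<bar>)"
    unfolding smoothed_grad_def vec_lambda_beta by (rule integral_abs_bound)
  also have "\<dots> \<le> (LINT y|lborel. 2 / s * (K (y - x) * \<rho> y))"
  proof (rule integral_mono)
    show "integrable lborel (\<lambda>y. \<bar>- (D (y - x) $ i) * \<rho> y\<bar>)" by (rule integrable_abs[OF D\<rho>_integrable])
    show "integrable lborel (\<lambda>y. 2 / s * (K (y - x) * \<rho> y))" by (rule integrable_mult_right[OF K\<rho>_integrable])
    show "\<bar>- (D (y - x) $ i) * \<rho> y\<bar> \<le> 2 / s * (K (y - x) * \<rho> y)" for y
      using mult_right_mono[OF D_le[of "y - x" i] \<rho>_nonneg[of y]] \<rho>_nonneg[of y]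
      by (simp add: abs_mult mult.assoc)
  qed
  also have "\<dots> = 2 / s * smoothed x" unfolding smoothed_def by (rule integral_mult_right_zero)
  finally show ?thesis .
qed

lemma smoothed_derivative:
  "((\<lambda>t. smoothed (x + t *\<^sub>R axis i 1)) has_vector_derivative smoothed_grad x $ i) (at 0)"
proof -
  have "((\<lambda>t. LINT y|lborel. K (y - (x + t *\<^sub>R axis i 1)) * \<rho> y) has_vector_derivative
      (LINT y|lborel. (- (D (y - (x + 0 *\<^sub>R axis i 1)) $ i)) * \<rho> y)) (at 0)"
  proof (rule has_vector_derivative_integral[where a = "-1" and b = 1 and w = "\<lambda>y. (2 / s * C) * \<rho> y"])
    fix t :: real and y
    show "norm (- (D (y - (x + t *\<^sub>R axis i 1)) $ i) * \<rho> y) \<le> (2 / s * C) * \<rho> y"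
      unfolding real_norm_def abs_mult abs_of_nonneg[OF \<rho>_nonneg]
      by (rule mult_right_mono[OF Di_bound \<rho>_nonneg])
    let ?z = "y - (x + t *\<^sub>R axis i 1)"
    have "((\<lambda>s. t - s) has_vector_derivative - 1) (at t)"
      by (auto intro!: derivative_eq_intros)
    moreover have "((\<lambda>r. K (?z + r *\<^sub>R axis i 1)) has_vector_derivative D ?z $ i) (at (t - t))"
      using K_der by simp
    ultimately have "((\<lambda>r. K (?z + r *\<^sub>R axis i 1)) \<circ> (\<lambda>s. t - s) has_vector_derivative (- 1) *\<^sub>R (D ?z $ i)) (at t)"
      by (rule vector_diff_chain_at)
    moreover have "?z + (t - r) *\<^sub>R axis i 1 = y - (x + r *\<^sub>R axis i 1)" for r
      by (simp add: algebra_simps)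
    ultimately have "((\<lambda>r. K (y - (x + r *\<^sub>R axis i 1))) has_vector_derivative - (D ?z $ i)) (at t)"
      by (simp add: o_def)
    from has_vector_derivative_mult[OF this has_vector_derivative_const[of "\<rho> y"]]
    show "((\<lambda>t. K (y - (x + t *\<^sub>R axis i 1)) * \<rho> y) has_vector_derivative - (D ?z $ i) * \<rho> y) (at t)"
      by simp
  qed (use K\<rho>_integrable \<rho>_integrable in auto)
  then show ?thesis unfolding smoothed_def smoothed_grad_def by simp
qed

lemma smoothed_weak_gradient: "has_weak_gradient smoothed smoothed_grad"
  by (rule has_weak_gradient_classical[OF smoothed_continuous smoothed_grad_continuous smoothed_derivative])

section \<open>Convexity estimates for averages of translates\<close>

lemma smoothed_shift: "smoothed x = (LINT y|lborel. K y * \<rho> (x + y))"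
proof -
  have "(\<lambda>y. K (y - x) * \<rho> y) \<in> borel_measurable lebesgue" by (intro borel_lebesgueI) measurable
  from integral_lebesgue_affine(1)[OF _ this, of 1 x]
  show ?thesis unfolding smoothed_def by (simp add: integral_completion add.commute)
qed

lemma K\<rho>_shift_integrable: "integrable lborel (\<lambda>y. K y * \<rho> (x + y))"
proof -
  have "(\<lambda>y. K (y - x) * \<rho> y) \<in> borel_measurable lebesgue" by (intro borel_lebesgueI) measurable
  from integral_lebesgue_affine(2)[OF _ this, of 1 x]
  show ?thesis using K\<rho>_integrable[of x] by (simp add: integrable_completion add.commute)
qed

lemma ennreal_smoothed: "ennreal (smoothed x) = (\<integral>\<^sup>+y. ennreal (K y) * ennreal (\<rho> (x + y)) \<partial>lborel)"
  unfolding smoothed_shift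
  using nn_integral_eq_integral[OF K\<rho>_shift_integrable[of x]] K_nonneg \<rho>_nonneg
  by (simp add: ennreal_mult)

text \<open>By Fubini and translation the shift moves from the density to the weight; the weight 1
  gives the mass, the harmonic potential gives the potential energy.\<close>

lemma nn_integral_smoothed_weighted:
  assumes [measurable]: "w \<in> borel_measurable borel"
  shows "(\<integral>\<^sup>+x. w x * ennreal (smoothed x) \<partial>lborel) =
     (\<integral>\<^sup>+y. ennreal (K y) * (\<integral>\<^sup>+x. w (x - y) * ennreal (\<rho> x) \<partial>lborel) \<partial>lborel)"
proof -
  have "(\<integral>\<^sup>+x. w x * ennreal (smoothed x) \<partial>lborel) =
     (\<integral>\<^sup>+x. \<integral>\<^sup>+y. w x * (ennreal (K y) * ennreal (\<rho> (x + y))) \<partial>lborel \<partial>lborel)"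
    unfolding ennreal_smoothed by (intro nn_integral_cong nn_integral_cmult[symmetric]) measurable
  also have "\<dots> = (\<integral>\<^sup>+y. \<integral>\<^sup>+x. w x * (ennreal (K y) * ennreal (\<rho> (x + y))) \<partial>lborel \<partial>lborel)"
    by (rule lborel_Fubini_nn[symmetric]) measurable
  also have "\<dots> = (\<integral>\<^sup>+y. ennreal (K y) * (\<integral>\<^sup>+x. w (x - y) * ennreal (\<rho> x) \<partial>lborel) \<partial>lborel)"
  proof (intro nn_integral_cong)
    fix y
    have "(\<integral>\<^sup>+x. w (x - y) * ennreal (\<rho> x) \<partial>lborel) = (\<integral>\<^sup>+x. w x * ennreal (\<rho> (x + y)) \<partial>lborel)"
      using nn_integral_lborel_shift[of "\<lambda>x. w (x - y) * ennreal (\<rho> x)" y] by simp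
    then show "(\<integral>\<^sup>+x. w x * (ennreal (K y) * ennreal (\<rho> (x + y))) \<partial>lborel) =
        ennreal (K y) * (\<integral>\<^sup>+x. w (x - y) * ennreal (\<rho> x) \<partial>lborel)"
      by (simp add: mult.left_commute[of _ "ennreal (K y)"] nn_integral_cmult)
  qed
  finally show ?thesis .
qed

lemma smoothed_mass: "(\<integral>\<^sup>+x. ennreal (smoothed x) \<partial>lborel) = 1"
  using nn_integral_smoothed_weighted[of "\<lambda>_. 1"] by (simp add: \<rho>_mass K_mass)

lemma smoothed_integrable: "integrable lborel smoothed"
  by (rule integrableI_bounded) (use smoothed_mass smoothed_pos in \<open>auto simp: less_imp_le\<close>)

lemma smoothed_potential:
  "(\<integral>\<^sup>+x. ennreal (harmonic \<gamma> x * smoothed x) \<partial>lborel) \<le>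
     ennreal (1 + s) * (\<integral>\<^sup>+x. ennreal (harmonic \<gamma> x * \<rho> x) \<partial>lborel)
     + ennreal ((s\<^sup>2 + s) * ((\<Sum>i\<in>UNIV. (\<gamma> i)\<^sup>2) * M))"
proof -
  let ?\<Lambda> = "\<Sum>i\<in>UNIV. (\<gamma> i)\<^sup>2" and ?V = "\<integral>\<^sup>+x. ennreal (harmonic \<gamma> x * \<rho> x) \<partial>lborel"
  have \<Lambda>: "0 \<le> ?\<Lambda>" by (simp add: sum_nonneg)
  have "(\<integral>\<^sup>+x. ennreal (harmonic \<gamma> x * smoothed x) \<partial>lborel) =
     (\<integral>\<^sup>+x. ennreal (harmonic \<gamma> x) * ennreal (smoothed x) \<partial>lborel)"
    by (simp add: ennreal_mult harmonic_nonneg less_imp_le[OF smoothed_pos])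
  also have "\<dots> = (\<integral>\<^sup>+y. ennreal (K y) * (\<integral>\<^sup>+x. ennreal (harmonic \<gamma> (x - y)) * ennreal (\<rho> x) \<partial>lborel) \<partial>lborel)"
    by (rule nn_integral_smoothed_weighted) measurable
  also have "\<dots> \<le> (\<integral>\<^sup>+y. ennreal (K y) * (ennreal (1 + s) * ?V + ennreal ((1 + 1 / s) * (?\<Lambda> * (norm y)\<^sup>2))) \<partial>lborel)"
  proof (intro nn_integral_mono mult_left_mono)
    fix y :: "real^'n"
    have "harmonic \<gamma> (x - y) * \<rho> x \<le> (1 + s) * (harmonic \<gamma> x * \<rho> x) + ((1 + 1 / s) * (?\<Lambda> * (norm y)\<^sup>2)) * \<rho> x" for x
    proof -
      have "harmonic \<gamma> (x - y) \<le> (1 + s) * harmonic \<gamma> x + (1 + 1 / s) * (?\<Lambda> * (norm y)\<^sup>2)"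
        using harmonic_diff_le[OF s, of \<gamma> x y] mult_left_mono[OF harmonic_le[of \<gamma> y], of "1 + 1 / s"] s by simp
      from mult_right_mono[OF this \<rho>_nonneg[of x]] show ?thesis by (simp add: algebra_simps)
    qed
    then have "(\<integral>\<^sup>+x. ennreal (harmonic \<gamma> (x - y)) * ennreal (\<rho> x) \<partial>lborel) \<le>
        (\<integral>\<^sup>+x. ennreal (1 + s) * ennreal (harmonic \<gamma> x * \<rho> x) + ennreal ((1 + 1 / s) * (?\<Lambda> * (norm y)\<^sup>2)) * ennreal (\<rho> x) \<partial>lborel)"
      using s \<Lambda>
      by (intro nn_integral_mono) (simp add: \<rho>_nonneg harmonic_nonneg ennreal_mult[symmetric] ennreal_plus[symmetric] ennreal_leI del: ennreal_plus)
    also have "\<dots> = ennreal (1 + s) * ?V + ennreal ((1 + 1 / s) * (?\<Lambda> * (norm y)\<^sup>2))"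
      by (simp add: nn_integral_add nn_integral_cmult \<rho>_mass)
    finally show "(\<integral>\<^sup>+x. ennreal (harmonic \<gamma> (x - y)) * ennreal (\<rho> x) \<partial>lborel) \<le>
        ennreal (1 + s) * ?V + ennreal ((1 + 1 / s) * (?\<Lambda> * (norm y)\<^sup>2))" .
  qed simp
  also have "\<dots> = (\<integral>\<^sup>+y. ennreal (K y) * (ennreal (1 + s) * ?V) + ennreal ((1 + 1 / s) * ?\<Lambda>) * ennreal (K y * (norm y)\<^sup>2) \<partial>lborel)"
    using s \<Lambda> K_nonneg by (intro nn_integral_cong) (simp add: distrib_left ennreal_mult[symmetric] mult_ac)
  also have "\<dots> = ennreal (1 + s) * ?V + ennreal ((1 + 1 / s) * ?\<Lambda>) * ennreal (s\<^sup>2 * M)"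
    by (simp add: nn_integral_add nn_integral_cmult nn_integral_multc K_mass K_moment)
  \<comment> \<open>(1 + 1/s) s^2 = s^2 + s, which vanishes with the width.\<close>
  also have "ennreal ((1 + 1 / s) * ?\<Lambda>) * ennreal (s\<^sup>2 * M) = ennreal ((s\<^sup>2 + s) * (?\<Lambda> * M))"
    using s \<Lambda> M by (simp add: ennreal_mult[symmetric]) (simp add: field_simps power2_eq_square)
  finally show ?thesis .
qed

text \<open>Jensen for the average against \<open>K\<close>, whose mass is 1, then Fubini and
  translation invariance.\<close>

lemma smoothed_square:
  "(\<integral>\<^sup>+x. ennreal ((smoothed x)\<^sup>2) \<partial>lborel) \<le> (\<integral>\<^sup>+x. ennreal ((\<rho> x)\<^sup>2) \<partial>lborel)"
proof -
  have "(\<integral>\<^sup>+x. ennreal ((smoothed x)\<^sup>2) \<partial>lborel) \<le>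
      (\<integral>\<^sup>+x. \<integral>\<^sup>+y. ennreal (K y) * ennreal ((\<rho> (x + y))\<^sup>2) \<partial>lborel \<partial>lborel)"
    unfolding smoothed_shift
    by (intro nn_integral_mono ennreal_integral_square_le) (simp_all add: K_nonneg K_mass)
  also have "\<dots> = (\<integral>\<^sup>+y. \<integral>\<^sup>+x. ennreal (K y) * ennreal ((\<rho> (x + y))\<^sup>2) \<partial>lborel \<partial>lborel)"
    by (rule lborel_Fubini_nn[symmetric]) measurable
  also have "\<dots> = (\<integral>\<^sup>+x. ennreal ((\<rho> x)\<^sup>2) \<partial>lborel)"
    by (simp add: nn_integral_cmult nn_integral_lborel_shift[of "\<lambda>x. ennreal ((\<rho> x)\<^sup>2)"] nn_integral_multc K_mass)
  finally show ?thesis .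
qed

text \<open>Smoothing commutes with translations, so increments of the smoothed density are averages
  of increments of \<open>\<rho>\<close>, and Jensen reduces them to the translation
  estimate.\<close>

lemma smoothed_increment:
  assumes wg: "has_weak_gradient \<rho> g" and gm [measurable]: "g \<in> borel_measurable borel"
    and g2: "integrable lborel (\<lambda>x. (norm (g x))\<^sup>2)"
  shows "(\<integral>\<^sup>+x. ennreal ((smoothed (x + h) - smoothed x)\<^sup>2) \<partial>lborel) \<le> (\<integral>\<^sup>+x. ennreal ((g x \<bullet> h)\<^sup>2) \<partial>lborel)"
proof -
  have eq: "smoothed (x + h) - smoothed x = (LINT y|lborel. K y * (\<rho> (x + y + h) - \<rho> (x + y)))" for x
  proof -
    have *: "x + h + y = x + y + h" for y by simp
    show ?thesis
      unfolding smoothed_shift right_diff_distrib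
      using Bochner_Integration.integral_diff[OF K\<rho>_shift_integrable[of "x + h"] K\<rho>_shift_integrable[of x]]
      unfolding * by simp
  qed
  have "(\<integral>\<^sup>+x. ennreal ((smoothed (x + h) - smoothed x)\<^sup>2) \<partial>lborel) \<le>
      (\<integral>\<^sup>+x. \<integral>\<^sup>+y. ennreal (K y) * ennreal ((\<rho> (x + y + h) - \<rho> (x + y))\<^sup>2) \<partial>lborel \<partial>lborel)"
    unfolding eq
    by (intro nn_integral_mono ennreal_integral_square_le) (simp_all add: K_nonneg K_mass)
  also have "\<dots> = (\<integral>\<^sup>+y. \<integral>\<^sup>+x. ennreal (K y) * ennreal ((\<rho> (x + y + h) - \<rho> (x + y))\<^sup>2) \<partial>lborel \<partial>lborel)"
    by (rule lborel_Fubini_nn[symmetric]) measurable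
  also have "\<dots> = (\<integral>\<^sup>+x. ennreal ((\<rho> (x + h) - \<rho> x)\<^sup>2) \<partial>lborel)"
    by (simp add: nn_integral_cmult nn_integral_lborel_shift[of "\<lambda>x. ennreal ((\<rho> (x + h) - \<rho> x)\<^sup>2)"]
        nn_integral_multc K_mass)
  also have "\<dots> \<le> (\<integral>\<^sup>+x. ennreal ((g x \<bullet> h)\<^sup>2) \<partial>lborel)"
    by (rule translation_estimate[OF wg \<rho>m gm g2])
  finally show ?thesis .
qed

text \<open>Fatou's lemma along difference quotients transfers the translation estimate to the gradient.\<close>

lemma smoothed_grad_component:
  assumes wg: "has_weak_gradient \<rho> g" and gm [measurable]: "g \<in> borel_measurable borel"
    and g2: "integrable lborel (\<lambda>x. (norm (g x))\<^sup>2)"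
  shows "(\<integral>\<^sup>+x. ennreal ((smoothed_grad x $ i)\<^sup>2) \<partial>lborel) \<le> (\<integral>\<^sup>+x. ennreal ((g x $ i)\<^sup>2) \<partial>lborel)"
proof -
  define h where "h = (\<lambda>m. inverse (real (Suc m)))"
  define q where "q = (\<lambda>m x. (smoothed (x + h m *\<^sub>R axis i 1) - smoothed x) /\<^sub>R h m)"
  have h: "0 < h m" for m unfolding h_def by simp
  have "filterlim h (at 0) sequentially"
    using LIMSEQ_inverse_real_of_nat h by (auto simp: filterlim_at h_def less_imp_neq[symmetric])
  then have lim: "(\<lambda>m. q m x) \<longlonglongrightarrow> smoothed_grad x $ i" for x
    using filterlim_compose[OF smoothed_derivative[of x i, unfolded has_vector_derivative_iff_quotient]]
    unfolding q_def by simp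
  have [measurable]: "q m \<in> borel_measurable borel" for m unfolding q_def by measurable
  have "ennreal ((smoothed_grad x $ i)\<^sup>2) = liminf (\<lambda>m. ennreal ((q m x)\<^sup>2))" for x
    by (intro lim_imp_Liminf[symmetric] tendsto_ennrealI tendsto_power lim) simp
  then have "(\<integral>\<^sup>+x. ennreal ((smoothed_grad x $ i)\<^sup>2) \<partial>lborel) = (\<integral>\<^sup>+x. liminf (\<lambda>m. ennreal ((q m x)\<^sup>2)) \<partial>lborel)"
    by simp
  also have "\<dots> \<le> liminf (\<lambda>m. \<integral>\<^sup>+x. ennreal ((q m x)\<^sup>2) \<partial>lborel)"
    by (rule nn_integral_liminf) measurable
  also have "\<dots> \<le> liminf (\<lambda>m::nat. \<integral>\<^sup>+x. ennreal ((g x $ i)\<^sup>2) \<partial>lborel)"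
  proof (intro Liminf_mono always_eventually allI)
    fix m
    have "(\<integral>\<^sup>+x. ennreal ((q m x)\<^sup>2) \<partial>lborel) =
        (\<integral>\<^sup>+x. ennreal ((inverse (h m))\<^sup>2) * ennreal ((smoothed (x + h m *\<^sub>R axis i 1) - smoothed x)\<^sup>2) \<partial>lborel)"
      unfolding q_def by (simp add: power_mult_distrib flip: ennreal_mult)
    also have "\<dots> = ennreal ((inverse (h m))\<^sup>2) * (\<integral>\<^sup>+x. ennreal ((smoothed (x + h m *\<^sub>R axis i 1) - smoothed x)\<^sup>2) \<partial>lborel)"
      by (rule nn_integral_cmult) measurable
    also have "\<dots> \<le> ennreal ((inverse (h m))\<^sup>2) * (\<integral>\<^sup>+x. ennreal ((g x \<bullet> (h m *\<^sub>R axis i 1))\<^sup>2) \<partial>lborel)"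
      by (intro mult_left_mono smoothed_increment[OF wg gm g2]) simp
    also have "\<dots> = (\<integral>\<^sup>+x. ennreal ((inverse (h m))\<^sup>2) * ennreal ((g x \<bullet> (h m *\<^sub>R axis i 1))\<^sup>2) \<partial>lborel)"
      by (rule nn_integral_cmult[symmetric]) measurable
    also have "\<dots> = (\<integral>\<^sup>+x. ennreal ((g x $ i)\<^sup>2) \<partial>lborel)"
    proof (intro nn_integral_cong)
      fix x
      have "(inverse (h m))\<^sup>2 * (g x \<bullet> (h m *\<^sub>R axis i 1))\<^sup>2 = (g x $ i)\<^sup>2"
        using h[of m] by (simp add: inner_axis power_mult_distrib[symmetric] mult.assoc[symmetric])
      then show "ennreal ((inverse (h m))\<^sup>2) * ennreal ((g x \<bullet> (h m *\<^sub>R axis i 1))\<^sup>2) = ennreal ((g x $ i)\<^sup>2)"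
        by (simp flip: ennreal_mult)
    qed
    finally show "(\<integral>\<^sup>+x. ennreal ((q m x)\<^sup>2) \<partial>lborel) \<le> (\<integral>\<^sup>+x. ennreal ((g x $ i)\<^sup>2) \<partial>lborel)" .
  qed
  also have "\<dots> = (\<integral>\<^sup>+x. ennreal ((g x $ i)\<^sup>2) \<partial>lborel)" by (rule Liminf_const) simp
  finally show ?thesis .
qed

lemma smoothed_grad_square:
  assumes wg: "has_weak_gradient \<rho> g" and gm [measurable]: "g \<in> borel_measurable borel"
    and g2: "integrable lborel (\<lambda>x. (norm (g x))\<^sup>2)"
  shows "(\<integral>\<^sup>+x. ennreal ((norm (smoothed_grad x))\<^sup>2) \<partial>lborel) \<le> (\<integral>\<^sup>+x. ennreal ((norm (g x))\<^sup>2) \<partial>lborel)"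
proof -
  have [measurable]: "(\<lambda>x. f x $ i) \<in> borel_measurable borel" if "f \<in> borel_measurable borel"
    for f :: "real^'n \<Rightarrow> real^'n" and i
    using borel_measurable_inner[OF that borel_measurable_const[of "axis i 1"]] by (simp add: inner_axis)
  show ?thesis
    unfolding ennreal_norm_square_vec
    by (subst (1 2) nn_integral_sum) (auto intro!: sum_mono smoothed_grad_component assms)
qed

section \<open>The square root of the smoothed density as a wave function\<close>

definition smoothed_state :: "real^'n \<Rightarrow> complex" where
  "smoothed_state x = complex_of_real (sqrt (smoothed x))"

lemma mod_sq_smoothed_state: "mod_sq smoothed_state = smoothed"
  unfolding mod_sq_def smoothed_state_def using smoothed_pos by (auto simp: less_imp_le)

lemma smoothed_in_L2: "in_L2 smoothed" and smoothed_grad_in_L2: "in_L2 smoothed_grad"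
proof -
  \<comment> \<open>A bounded integrable density is square integrable; the same majorant serves for
    the gradient.\<close>
  have sq: "(smoothed x)\<^sup>2 \<le> C * smoothed x" for x
    using mult_right_mono[OF smoothed_le, of "smoothed x" x] smoothed_pos[of x] by (simp add: power2_eq_square)
  show "in_L2 smoothed"
    by (rule in_L2_I_borel[where w = "\<lambda>x. C * smoothed x"]) (use sq smoothed_integrable in auto)
  show "in_L2 smoothed_grad"
  proof (rule in_L2_I_borel[where w = "\<lambda>x. (real CARD('n) * (2 / s)\<^sup>2 * C) * smoothed x"])
    fix x
    have "(smoothed_grad x $ i)\<^sup>2 \<le> (2 / s)\<^sup>2 * (C * smoothed x)" for i
    proof -
      have "\<bar>smoothed_grad x $ i\<bar>\<^sup>2 \<le> (2 / s * smoothed x)\<^sup>2"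
        by (intro power_mono smoothed_grad_le) simp
      then show ?thesis
        using mult_left_mono[OF sq[of x], of "(2 / s)\<^sup>2"] power_mult_distrib[of "2 / s" "smoothed x" 2] by simp
    qed
    then have "(\<Sum>i\<in>UNIV. (smoothed_grad x $ i)\<^sup>2) \<le> real CARD('n) * ((2 / s)\<^sup>2 * (C * smoothed x))"
      by (intro sum_bounded_above) simp
    then show "(norm (smoothed_grad x))\<^sup>2 \<le> (real CARD('n) * (2 / s)\<^sup>2 * C) * smoothed x"
      by (simp add: norm_vec_def L2_set_def sum_nonneg mult.assoc)
  qed (use smoothed_integrable in auto)
qed

lemma smoothed_state_in_H1: "in_H1 smoothed_state"
proof -
  \<comment> \<open>The chain rule for the square root holds at every point, because the smoothed
    density is strictly positive.\<close>
  define G where "G = (\<lambda>x. vec_lambda (\<lambda>i. complex_of_real (smoothed_grad x $ i / (2 * sqrt (smoothed x)))))"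
  have sc: "continuous_on UNIV (\<lambda>x. sqrt (smoothed x))"
    by (intro continuous_intros smoothed_continuous)
  have nz: "sqrt (smoothed x) \<noteq> 0" for x using smoothed_pos[of x] by simp
  have c1: "continuous_on UNIV smoothed_state"
    unfolding smoothed_state_def[abs_def] by (intro continuous_intros smoothed_continuous)
  have c2: "continuous_on UNIV G"
    unfolding G_def using nz
    by (intro continuous_on_vec_lambda continuous_on_of_real continuous_on_divide continuous_on_mult continuous_on_const sc
        continuous_on_component smoothed_grad_continuous) auto
  have wg: "has_weak_gradient smoothed_state G"
  proof (rule has_weak_gradient_classical[OF c1 c2])
    fix x i
    have "((\<lambda>t. smoothed (x + t *\<^sub>R axis i 1)) has_real_derivative smoothed_grad x $ i) (at 0)"
      using smoothed_derivative by (simp add: has_real_derivative_iff_has_vector_derivative)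
    then have "((\<lambda>t. sqrt (smoothed (x + t *\<^sub>R axis i 1))) has_real_derivative
        inverse (sqrt (smoothed (x + 0 *\<^sub>R axis i 1))) / 2 * smoothed_grad x $ i) (at 0)"
      by (intro DERIV_chain2[OF DERIV_real_sqrt]) (use smoothed_pos in simp_all)
    moreover have "inverse (sqrt (smoothed (x + 0 *\<^sub>R axis i 1))) / 2 * smoothed_grad x $ i =
        smoothed_grad x $ i / (2 * sqrt (smoothed x))"
      using nz[of x] by (simp add: field_simps)
    ultimately have "((\<lambda>t. sqrt (smoothed (x + t *\<^sub>R axis i 1))) has_real_derivative
        smoothed_grad x $ i / (2 * sqrt (smoothed x))) (at 0)"
      by (simp only:)
    then have "((\<lambda>t. complex_of_real (sqrt (smoothed (x + t *\<^sub>R axis i 1)))) has_vector_derivative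
        complex_of_real (smoothed_grad x $ i / (2 * sqrt (smoothed x)))) (at 0)"
      by (intro has_vector_derivative_of_real)
    then show "((\<lambda>t. smoothed_state (x + t *\<^sub>R axis i 1)) has_vector_derivative G x $ i) (at 0)"
      unfolding smoothed_state_def G_def by simp
  qed
  have "in_L2 smoothed_state"
    by (rule in_L2_I_borel[where w = smoothed])
       (use smoothed_pos smoothed_integrable borel_measurable_continuous_onI[OF c1] in \<open>auto simp: smoothed_state_def less_imp_le\<close>)
  moreover have "in_L2 G"
  proof (rule in_L2_I_borel[where w = "\<lambda>x. (real CARD('n) / s\<^sup>2) * smoothed x"])
    fix x
    \<comment> \<open>A component of the gradient of the root has square (\<partial>\<rho>)^2 / (4
      \<rho>), and the bound 2/s on the logarithmic gradient turns this into \<rho> / s^2.\<close>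
    have "(norm (G x $ i))\<^sup>2 \<le> smoothed x / s\<^sup>2" for i
    proof -
      have "\<bar>smoothed_grad x $ i\<bar>\<^sup>2 \<le> (2 / s * smoothed x)\<^sup>2"
        by (intro power_mono smoothed_grad_le) simp
      then have "(smoothed_grad x $ i)\<^sup>2 / (4 * smoothed x) \<le> (2 / s * smoothed x)\<^sup>2 / (4 * smoothed x)"
        using smoothed_pos[of x] by (intro divide_right_mono) auto
      also have "\<dots> = smoothed x / s\<^sup>2"
        using smoothed_pos[of x] s by (simp add: power2_eq_square field_simps)
      finally show ?thesis
        using smoothed_pos[of x] unfolding G_def by (simp add: norm_divide norm_mult power_divide power_mult_distrib)
    qed
    then have "(\<Sum>i\<in>UNIV. (norm (G x $ i))\<^sup>2) \<le> real CARD('n) * (smoothed x / s\<^sup>2)"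
      by (intro sum_bounded_above) simp
    then show "(norm (G x))\<^sup>2 \<le> (real CARD('n) / s\<^sup>2) * smoothed x"
      by (simp add: norm_vec_def L2_set_def sum_nonneg)
  qed (use smoothed_integrable borel_measurable_continuous_onI[OF c2] in auto)
  ultimately show ?thesis
    unfolding in_H1_def weakly_differentiable_def using wg in_L2_weak_grad[OF wg] by blast
qed

end

section \<open>Completeness of \<open>L\<^sup>2\<close> and Nash's inequality\<close>

lemma in_L2_measurable: "in_L2 u \<Longrightarrow> u \<in> borel_measurable lebesgue"
  and in_L2_integrable: "in_L2 u \<Longrightarrow> integrable lebesgue (\<lambda>x. (norm (u x))\<^sup>2)"
  unfolding in_L2_def by auto

lemma in_L2_bound:
  fixes u :: "real^'n \<Rightarrow> 'b::euclidean_space"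
  assumes "u \<in> borel_measurable lebesgue" "integrable lebesgue w" "\<And>x. (norm (u x))\<^sup>2 \<le> w x"
  shows "in_L2 u"
proof -
  have "integrable lebesgue (\<lambda>x. (norm (u x))\<^sup>2)"
  proof (rule Bochner_Integration.integrable_bound[OF assms(2)])
    show "(\<lambda>x. (norm (u x))\<^sup>2) \<in> borel_measurable lebesgue" using assms(1) by measurable
    show "AE x in lebesgue. norm ((norm (u x))\<^sup>2) \<le> norm (w x)"
      using assms(3) by (intro AE_I2) (simp add: order_trans[OF _ abs_ge_self])
  qed
  then show ?thesis unfolding in_L2_def using assms(1) by simp
qed

lemma in_L2_diff:
  fixes u v :: "real^'n \<Rightarrow> 'b::euclidean_space"
  assumes "in_L2 u" "in_L2 v" shows "in_L2 (\<lambda>x. u x - v x)"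
proof (rule in_L2_bound)
  show "(\<lambda>x. u x - v x) \<in> borel_measurable lebesgue"
    using in_L2_measurable[OF assms(1)] in_L2_measurable[OF assms(2)] by measurable
  show "integrable lebesgue (\<lambda>x. 2 * (norm (u x))\<^sup>2 + 2 * (norm (v x))\<^sup>2)"
    using in_L2_integrable[OF assms(1)] in_L2_integrable[OF assms(2)] by simp
  show "(norm (u x - v x))\<^sup>2 \<le> 2 * (norm (u x))\<^sup>2 + 2 * (norm (v x))\<^sup>2" for x
  proof -
    have "0 \<le> (norm (u x + v x))\<^sup>2" by simp
    then show ?thesis
      by (simp add: power2_norm_eq_inner inner_diff_left inner_diff_right inner_add_left inner_add_right inner_commute)
  qed
qed

lemma in_L2_midpoint:
  fixes u v :: "real^'n \<Rightarrow> 'b::euclidean_space"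
  assumes "in_L2 u" "in_L2 v"
  shows "in_L2 (\<lambda>x. (1/2) *\<^sub>R u x + (1/2) *\<^sub>R v x)"
    and "(LINT x|lebesgue. (norm ((1/2) *\<^sub>R u x + (1/2) *\<^sub>R v x))\<^sup>2) =
      (LINT x|lebesgue. (norm (u x))\<^sup>2) / 2 + (LINT x|lebesgue. (norm (v x))\<^sup>2) / 2
      - (LINT x|lebesgue. (norm (u x - v x))\<^sup>2) / 4"
proof -
  have eq: "(norm ((1/2) *\<^sub>R u x + (1/2) *\<^sub>R v x))\<^sup>2 =
     (norm (u x))\<^sup>2 / 2 + (norm (v x))\<^sup>2 / 2 - (norm (u x - v x))\<^sup>2 / 4" for x
    by (simp add: power2_norm_eq_inner inner_diff_left inner_diff_right inner_add_left inner_add_right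
        inner_commute[of "v x" "u x"] field_simps)
  have i: "integrable lebesgue (\<lambda>x. (norm (u x))\<^sup>2 / 2)" "integrable lebesgue (\<lambda>x. (norm (v x))\<^sup>2 / 2)"
    "integrable lebesgue (\<lambda>x. (norm (u x - v x))\<^sup>2 / 4)"
    using in_L2_integrable[OF assms(1)] in_L2_integrable[OF assms(2)] in_L2_integrable[OF in_L2_diff[OF assms]]
    by simp_all
  have m: "(\<lambda>x. (1/2) *\<^sub>R u x + (1/2) *\<^sub>R v x) \<in> borel_measurable lebesgue"
    using in_L2_measurable[OF assms(1)] in_L2_measurable[OF assms(2)] by measurable
  show "in_L2 (\<lambda>x. (1/2) *\<^sub>R u x + (1/2) *\<^sub>R v x)"
    unfolding in_L2_def eq
    using m Bochner_Integration.integrable_diff[OF Bochner_Integration.integrable_add[OF i(1,2)] i(3)] by simp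
  show "(LINT x|lebesgue. (norm ((1/2) *\<^sub>R u x + (1/2) *\<^sub>R v x))\<^sup>2) =
      (LINT x|lebesgue. (norm (u x))\<^sup>2) / 2 + (LINT x|lebesgue. (norm (v x))\<^sup>2) / 2
      - (LINT x|lebesgue. (norm (u x - v x))\<^sup>2) / 4"
    unfolding eq
    using Bochner_Integration.integral_diff[OF Bochner_Integration.integrable_add[OF i(1,2)] i(3)]
      Bochner_Integration.integral_add[OF i(1,2)] by simp
qed

lemma nn_integral_norm_square:
  fixes u :: "real^'n \<Rightarrow> 'b::euclidean_space"
  assumes "in_L2 u"
  shows "(\<integral>\<^sup>+x. ennreal ((norm (u x))\<^sup>2) \<partial>lebesgue) = ennreal (LINT x|lebesgue. (norm (u x))\<^sup>2)"
  by (rule nn_integral_eq_integral[OF in_L2_integrable[OF assms]]) simp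

lemma summable_imp_convergent_telescope:
  fixes F :: "nat \<Rightarrow> 'b::real_normed_vector"
  assumes "summable (\<lambda>j. F (Suc j) - F j)" shows "convergent F"
proof -
  have "(\<lambda>n. F 0 + (\<Sum>j<n. F (Suc j) - F j)) \<longlonglongrightarrow> F 0 + suminf (\<lambda>j. F (Suc j) - F j)"
    by (intro tendsto_intros summable_LIMSEQ assms)
  then show ?thesis by (auto simp: sum_lessThan_telescope convergent_def)
qed

text \<open>The values lie in any Euclidean space, so that a density and its gradient converge
  together as one pair-valued function. The almost everywhere convergent subsequence is kept for
  later uses of Fatou's lemma.\<close>

theorem L2_complete:
  fixes f :: "nat \<Rightarrow> real^'n \<Rightarrow> 'b::euclidean_space"
  assumes f: "\<And>k. in_L2 (f k)"
    and cauchy: "\<And>\<omega>. 0 < \<omega> \<Longrightarrow> \<exists>N. \<forall>k\<ge>N. \<forall>l\<ge>N. (LINT x|lebesgue. (norm (f k x - f l x))\<^sup>2) \<le> \<omega>"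
  obtains h r where "in_L2 h" "strict_mono r" "AE x in lebesgue. (\<lambda>j. f (r j) x) \<longlonglongrightarrow> h x"
    "(\<lambda>k. LINT x|lebesgue. (norm (f k x - h x))\<^sup>2) \<longlonglongrightarrow> 0"
proof -
  have fm [measurable]: "f k \<in> borel_measurable lebesgue" for k by (rule in_L2_measurable[OF f])
  define \<Delta> where "\<Delta> = (\<lambda>k l. LINT x|lebesgue. (norm (f k x - f l x))\<^sup>2)"
  have nn\<Delta>: "(\<integral>\<^sup>+x. ennreal ((norm (f k x - f l x))\<^sup>2) \<partial>lebesgue) = ennreal (\<Delta> k l)" for k l
    unfolding \<Delta>_def by (rule nn_integral_norm_square[OF in_L2_diff[OF f f]])
  have "\<exists>N. \<forall>k\<ge>N. \<forall>l\<ge>N. \<Delta> k l \<le> (1/8) ^ j" for j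
    unfolding \<Delta>_def by (rule cauchy) simp
  then obtain N where N: "\<And>j k l. N j \<le> k \<Longrightarrow> N j \<le> l \<Longrightarrow> \<Delta> k l \<le> (1/8) ^ j" by metis
  \<comment> \<open>The sum dominates each \<open>N j\<close>, and the added \<open>j\<close> makes
    \<open>r\<close> strictly increasing.\<close>
  define r where "r = (\<lambda>j. (\<Sum>i\<le>j. N i) + j)"
  have r: "strict_mono r" unfolding r_def by (rule strict_mono_Suc_iff[THEN iffD2]) simp
  have rN: "N j \<le> r j" for j
    using member_le_sum[of j "{..j}" N] unfolding r_def by simp
  have r\<Delta>: "\<Delta> (r (Suc j)) (r j) \<le> (1/8) ^ j" for j
    using rN[of j] strict_mono_less_eq[OF r, of j "Suc j"] by (intro N) auto
  \<comment> \<open>Squared distances of at most 8^(-j), weighted by 4^j, are summable; at almost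
    every point this leaves differences of order 2^(-j).\<close>
  define T where "T = (\<lambda>j x. 4 ^ j * (norm (f (r (Suc j)) x - f (r j) x))\<^sup>2)"
  have Tm [measurable]: "T j \<in> borel_measurable lebesgue" for j unfolding T_def by measurable
  have "(\<integral>\<^sup>+x. (\<Sum>j. ennreal (T j x)) \<partial>lebesgue) = (\<Sum>j. \<integral>\<^sup>+x. ennreal (T j x) \<partial>lebesgue)"
    by (rule nn_integral_suminf) measurable
  also have "\<dots> \<le> (\<Sum>j. ennreal ((1/2) ^ j))"
  proof (rule suminf_le)
    fix j
    have "(\<integral>\<^sup>+x. ennreal (T j x) \<partial>lebesgue) =
        (\<integral>\<^sup>+x. ennreal (4 ^ j) * ennreal ((norm (f (r (Suc j)) x - f (r j) x))\<^sup>2) \<partial>lebesgue)"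
      unfolding T_def by (simp add: ennreal_mult)
    also have "\<dots> = ennreal (4 ^ j) * ennreal (\<Delta> (r (Suc j)) (r j))"
      unfolding nn\<Delta>[symmetric] by (rule nn_integral_cmult) measurable
    also have "\<dots> \<le> ennreal (4 ^ j) * ennreal ((1/8) ^ j)"
      by (intro mult_left_mono ennreal_leI r\<Delta>) simp
    also have "\<dots> = ennreal ((1/2) ^ j)"
      by (simp add: ennreal_mult[symmetric] power_mult_distrib[symmetric])
    finally show "(\<integral>\<^sup>+x. ennreal (T j x) \<partial>lebesgue) \<le> ennreal ((1/2) ^ j)" .
  qed auto
  also have "\<dots> = ennreal (1 / (1 - 1/2))"
    using geometric_sums[of "1/2::real"] by (intro suminf_ennreal_eq) simp_all
  finally have "(\<integral>\<^sup>+x. (\<Sum>j. ennreal (T j x)) \<partial>lebesgue) \<noteq> \<infinity>"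
    using ennreal_less_top[of "1 / (1 - 1/2)"] by (auto simp: top_unique)
  then have "AE x in lebesgue. (\<Sum>j. ennreal (T j x)) \<noteq> \<infinity>"
    by (intro nn_integral_PInf_AE) measurable
  then have conv: "AE x in lebesgue. convergent (\<lambda>j. f (r j) x)"
  proof eventually_elim
    case (elim x)
    define S where "S = enn2real (\<Sum>j. ennreal (T j x))"
    have "ennreal (T j x) \<le> ennreal S" for j
    proof -
      have "ennreal (T j x) = (\<Sum>i\<in>{j}. ennreal (T i x))" by simp
      also have "\<dots> \<le> (\<Sum>j. ennreal (T j x))"
        by (rule sum_le_suminf) auto
      also have "\<dots> = ennreal S" unfolding S_def using elim by (simp add: less_top[symmetric])
      finally show ?thesis .
    qed
    then have TS: "T j x \<le> S" for j
      using ennreal_le_iff[of S "T j x"] by (simp add: S_def)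
    have S0: "0 \<le> S" unfolding S_def by simp
    have "norm (f (r (Suc j)) x - f (r j) x) \<le> sqrt S * (1/2) ^ j" for j
    proof (rule power2_le_imp_le)
      have "(sqrt S * (1/2) ^ j)\<^sup>2 = S / 4 ^ j"
        using S0 by (simp add: power_mult_distrib power2_eq_square power_divide flip: power_mult_distrib)
      then show "(norm (f (r (Suc j)) x - f (r j) x))\<^sup>2 \<le> (sqrt S * (1/2) ^ j)\<^sup>2"
        using TS[of j] unfolding T_def by (simp add: pos_le_divide_eq mult.commute)
    qed (use S0 in simp)
    moreover have "summable (\<lambda>j. sqrt S * (1/2) ^ j)"
      by (intro summable_mult summable_geometric) simp
    ultimately have "summable (\<lambda>j. f (r (Suc j)) x - f (r j) x)"
      by (rule summable_comparison_test'[rotated, where N = 0])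
    then show ?case by (rule summable_imp_convergent_telescope)
  qed
  define h where "h = (\<lambda>x. lim (\<lambda>j. f (r j) x))"
  have hm [measurable]: "h \<in> borel_measurable lebesgue"
    unfolding h_def by (rule borel_measurable_lim_metric) simp
  have ae: "AE x in lebesgue. (\<lambda>j. f (r j) x) \<longlonglongrightarrow> h x"
    using conv by eventually_elim (simp add: h_def convergent_LIMSEQ_iff)
  \<comment> \<open>Fatou along the subsequence bounds the distance to the limit for every index
    \<open>k\<close>, which need not belong to the subsequence.\<close>
  have fatou: "(\<integral>\<^sup>+x. ennreal ((norm (f k x - h x))\<^sup>2) \<partial>lebesgue) \<le> ennreal \<omega>"
    if k: "\<And>l. N' \<le> l \<Longrightarrow> \<Delta> k l \<le> \<omega>" for k N' \<omega>
  proof -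
    have "(\<integral>\<^sup>+x. ennreal ((norm (f k x - h x))\<^sup>2) \<partial>lebesgue) =
        (\<integral>\<^sup>+x. liminf (\<lambda>j. ennreal ((norm (f k x - f (r j) x))\<^sup>2)) \<partial>lebesgue)"
    proof (rule nn_integral_cong_AE)
      show "AE x in lebesgue. ennreal ((norm (f k x - h x))\<^sup>2) = liminf (\<lambda>j. ennreal ((norm (f k x - f (r j) x))\<^sup>2))"
        using ae
      proof eventually_elim
        case (elim x)
        then show ?case
          by (intro lim_imp_Liminf[symmetric] tendsto_ennrealI tendsto_intros) simp_all
      qed
    qed
    also have "\<dots> \<le> liminf (\<lambda>j. \<integral>\<^sup>+x. ennreal ((norm (f k x - f (r j) x))\<^sup>2) \<partial>lebesgue)"
      by (rule nn_integral_liminf) measurable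
    also have "\<dots> \<le> liminf (\<lambda>j::nat. ennreal \<omega>)"
    proof (rule Liminf_mono)
      have "r j \<ge> N'" if "j \<ge> N'" for j using seq_suble[OF r, of j] that by linarith
      then show "\<forall>\<^sub>F j in sequentially. (\<integral>\<^sup>+x. ennreal ((norm (f k x - f (r j) x))\<^sup>2) \<partial>lebesgue) \<le> ennreal \<omega>"
        unfolding nn\<Delta> using k by (intro eventually_sequentiallyI[of N'] ennreal_leI) auto
    qed
    also have "\<dots> = ennreal \<omega>" by (rule Liminf_const) simp
    finally show ?thesis .
  qed
  have h2: "in_L2 h"
  proof -
    \<comment> \<open>One member of the sequence at finite distance from \<open>h\<close> makes
      \<open>h\<close> square integrable.\<close>
    let ?k = "N 0"
    have "(\<integral>\<^sup>+x. ennreal ((norm (f ?k x - h x))\<^sup>2) \<partial>lebesgue) \<le> ennreal ((1/8) ^ 0)"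
      by (rule fatou[of "N 0"]) (rule N, simp_all)
    then have "(\<integral>\<^sup>+x. ennreal (norm ((norm (f ?k x - h x))\<^sup>2)) \<partial>lebesgue) < \<infinity>"
      by (simp add: le_less_trans)
    then have "integrable lebesgue (\<lambda>x. (norm (f ?k x - h x))\<^sup>2)"
      by (intro integrableI_bounded) measurable
    then have "in_L2 (\<lambda>x. f ?k x - h x)" unfolding in_L2_def by simp
    from in_L2_diff[OF f[of ?k] this] show ?thesis by simp
  qed
  have "(\<lambda>k. LINT x|lebesgue. (norm (f k x - h x))\<^sup>2) \<longlonglongrightarrow> 0"
  proof (rule LIMSEQ_I)
    fix \<omega> :: real assume \<omega>: "0 < \<omega>"
    obtain N' where N': "\<And>k l. N' \<le> k \<Longrightarrow> N' \<le> l \<Longrightarrow> \<Delta> k l \<le> \<omega> / 2"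
      using cauchy[of "\<omega> / 2"] \<omega> unfolding \<Delta>_def by auto
    have "norm ((LINT x|lebesgue. (norm (f k x - h x))\<^sup>2) - 0) < \<omega>" if "N' \<le> k" for k
    proof -
      have "ennreal (LINT x|lebesgue. (norm (f k x - h x))\<^sup>2) \<le> ennreal (\<omega> / 2)"
        unfolding nn_integral_norm_square[OF in_L2_diff[OF f h2], symmetric]
        by (rule fatou[of N']) (rule N'[OF that])
      then have "(LINT x|lebesgue. (norm (f k x - h x))\<^sup>2) \<le> \<omega> / 2"
        using \<omega> by (subst (asm) ennreal_le_iff) auto
      then show ?thesis using \<omega> by simp
    qed
    then show "\<exists>no. \<forall>k\<ge>no. norm ((LINT x|lebesgue. (norm (f k x - h x))\<^sup>2) - 0) < \<omega>" by blast
  qed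
  then show ?thesis using that h2 r ae by blast
qed

text \<open>Fubini needs g(x + t y) jointly measurable in x and t, which holds for Borel functions,
  while weak gradients are only Lebesgue measurable.\<close>

lemma borel_representative:
  fixes f :: "'a::euclidean_space \<Rightarrow> 'b::euclidean_space"
  assumes "f \<in> borel_measurable lebesgue"
  obtains f' where "f' \<in> borel_measurable borel" "AE x in lebesgue. f x = f' x"
proof -
  have "\<exists>p. p \<in> borel_measurable borel \<and> (AE x in lebesgue. f x \<bullet> b = p x)" for b
  proof -
    have "(\<lambda>x. f x \<bullet> b) \<in> borel_measurable (completion lborel)" using assms by measurable
    from completion_ex_borel_measurable_real[OF this] show ?thesis by (auto intro: AE_completion)
  qed
  then obtain p where p: "\<And>b. p b \<in> borel_measurable borel" "\<And>b. AE x in lebesgue. f x \<bullet> b = p b x" by metis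
  let ?f = "\<lambda>x. \<Sum>b\<in>Basis. p b x *\<^sub>R b"
  have "?f \<in> borel_measurable borel" using p(1) by measurable
  moreover have "AE x in lebesgue. \<forall>b\<in>Basis. f x \<bullet> b = p b x"
    using p(2) by (simp add: AE_ball_countable countable_finite)
  then have "AE x in lebesgue. f x = ?f x"
  proof eventually_elim
    case (elim x)
    have "f x = (\<Sum>b\<in>Basis. (f x \<bullet> b) *\<^sub>R b)" by (rule euclidean_representation[symmetric])
    also have "\<dots> = ?f x" using elim by (intro sum.cong) auto
    finally show ?case .
  qed
  ultimately show ?thesis by (rule that)
qed

text \<open>Square integrability is a conclusion: the bound involves only the mass and the gradient.
  Densities without quartic energy are handled through it.\<close>

theorem nash_L2:
  fixes f :: "real^'n \<Rightarrow> real" and K :: "real^'n \<Rightarrow> real"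
  assumes wg: "has_weak_gradient f g" and f1: "integrable lebesgue f" and g2: "in_L2 g"
    and K: "smoothing_kernel C M s K D" and M: "0 \<le> M"
  shows "integrable lebesgue (\<lambda>x. (f x)\<^sup>2)"
    and "(LINT x|lebesgue. (f x)\<^sup>2) \<le>
      2 * C * (LINT x|lebesgue. \<bar>f x\<bar>)\<^sup>2 + 2 * (s\<^sup>2 * M) * (LINT x|lebesgue. (norm (g x))\<^sup>2)"
proof -
  obtain f' where f': "f' \<in> borel_measurable borel" "AE x in lebesgue. f x = f' x"
    using borel_representative has_weak_gradient_measurable(1)[OF wg] by metis
  obtain g' where g': "g' \<in> borel_measurable borel" "AE x in lebesgue. g x = g' x"
    using borel_representative has_weak_gradient_measurable(2)[OF wg] by metis
  have wg': "has_weak_gradient f' g'" by (rule has_weak_gradient_cong_AE[OF wg f'(2) g'(2)])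
  have "in_L2 g'" by (rule in_L2_cong_AE[OF g2 g'(2)])
  then have g2': "integrable lborel (\<lambda>x. (norm (g' x))\<^sup>2)"
    using g'(1) unfolding in_L2_def by (simp add: integrable_completion)
  have Kp: "0 < K y" "K y \<le> C" for y using K unfolding smoothing_kernel_def by auto
  have C: "0 \<le> C" using Kp[of 0] by simp
  have "continuous_on UNIV K" using K unfolding smoothing_kernel_def by blast
  then have Km: "K \<in> borel_measurable borel" by (rule borel_measurable_continuous_onI)
  have "(\<integral>\<^sup>+x. ennreal ((f x)\<^sup>2) \<partial>lebesgue) = (\<integral>\<^sup>+x. ennreal ((f' x)\<^sup>2) \<partial>lebesgue)"
    by (rule nn_integral_cong_AE) (use f'(2) in eventually_elim, simp)
  also have "\<dots> \<le> 2 * (ennreal C * (\<integral>\<^sup>+x. ennreal \<bar>f' x\<bar> \<partial>lebesgue)\<^sup>2)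
     + 2 * ((\<integral>\<^sup>+y. ennreal (K y * (norm y)\<^sup>2) \<partial>lebesgue) * (\<integral>\<^sup>+x. ennreal ((norm (g' x))\<^sup>2) \<partial>lebesgue))"
    unfolding nn_integral_completion
    using K by (intro nash_inequality[OF wg' f'(1) g'(1) g2' Km less_imp_le[OF Kp(1)] Kp(2)])
      (simp add: smoothing_kernel_def)
  also have "(\<integral>\<^sup>+x. ennreal \<bar>f' x\<bar> \<partial>lebesgue) = (\<integral>\<^sup>+x. ennreal \<bar>f x\<bar> \<partial>lebesgue)"
    by (rule nn_integral_cong_AE) (use f'(2) in eventually_elim, simp)
  also have "\<dots> = ennreal (LINT x|lebesgue. \<bar>f x\<bar>)"
    by (rule nn_integral_eq_integral[OF integrable_abs[OF f1]]) simp
  also have "(\<integral>\<^sup>+x. ennreal ((norm (g' x))\<^sup>2) \<partial>lebesgue) = (\<integral>\<^sup>+x. ennreal ((norm (g x))\<^sup>2) \<partial>lebesgue)"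
    by (rule nn_integral_cong_AE) (use g'(2) in eventually_elim, simp)
  also have "\<dots> = ennreal (LINT x|lebesgue. (norm (g x))\<^sup>2)"
    by (rule nn_integral_norm_square[OF g2])
  also have "(\<integral>\<^sup>+y. ennreal (K y * (norm y)\<^sup>2) \<partial>lebesgue) = ennreal (s\<^sup>2 * M)"
    using K unfolding nn_integral_completion smoothing_kernel_def by simp
  also have "2 * (ennreal C * (ennreal (LINT x|lebesgue. \<bar>f x\<bar>))\<^sup>2)
     + 2 * (ennreal (s\<^sup>2 * M) * ennreal (LINT x|lebesgue. (norm (g x))\<^sup>2)) =
     ennreal (2 * C * (LINT x|lebesgue. \<bar>f x\<bar>)\<^sup>2 + 2 * (s\<^sup>2 * M) * (LINT x|lebesgue. (norm (g x))\<^sup>2))"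
    using C M by (simp add: ennreal_power ennreal_mult''[symmetric] ennreal_plus[symmetric] mult.assoc
        del: ennreal_plus flip: ennreal_numeral)
  finally have le: "(\<integral>\<^sup>+x. ennreal ((f x)\<^sup>2) \<partial>lebesgue) \<le>
     ennreal (2 * C * (LINT x|lebesgue. \<bar>f x\<bar>)\<^sup>2 + 2 * (s\<^sup>2 * M) * (LINT x|lebesgue. (norm (g x))\<^sup>2))" .
  show i: "integrable lebesgue (\<lambda>x. (f x)\<^sup>2)"
  proof (rule integrableI_bounded)
    show "(\<lambda>x. (f x)\<^sup>2) \<in> borel_measurable lebesgue"
      using has_weak_gradient_measurable(1)[OF wg] by measurable
    show "(\<integral>\<^sup>+x. ennreal (norm ((f x)\<^sup>2)) \<partial>lebesgue) < \<infinity>"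
      using le by (simp add: le_less_trans)
  qed
  have "ennreal (LINT x|lebesgue. (f x)\<^sup>2) \<le>
     ennreal (2 * C * (LINT x|lebesgue. \<bar>f x\<bar>)\<^sup>2 + 2 * (s\<^sup>2 * M) * (LINT x|lebesgue. (norm (g x))\<^sup>2))"
    using le nn_integral_eq_integral[OF i] by simp
  then show "(LINT x|lebesgue. (f x)\<^sup>2) \<le>
     2 * C * (LINT x|lebesgue. \<bar>f x\<bar>)\<^sup>2 + 2 * (s\<^sup>2 * M) * (LINT x|lebesgue. (norm (g x))\<^sup>2)"
    using C M by (subst (asm) ennreal_le_iff) auto
qed

section \<open>The limiting functional as a convex functional of the density\<close>

text \<open>Square integrability is demanded for every \<open>b\<close>; when the limiting
  functional has no quartic term it is supplied by \<open>integrable_square_of_gradient\<close>.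
  This lets all three admissible sets be described by one class.\<close>

definition density_class :: "('n::finite \<Rightarrow> real) \<Rightarrow> real \<Rightarrow> (real^'n \<Rightarrow> real) \<Rightarrow> bool" where
  "density_class \<gamma> b \<rho> \<longleftrightarrow>
     (\<forall>x. 0 \<le> \<rho> x) \<and> integrable lebesgue \<rho> \<and> (LINT x|lebesgue. \<rho> x) = 1 \<and>
     integrable lebesgue (\<lambda>x. harmonic \<gamma> x * \<rho> x) \<and> in_L2 \<rho> \<and>
     (b \<noteq> 0 \<longrightarrow> weakly_differentiable \<rho> \<and> in_L2 (weak_grad \<rho>))"

text \<open>This convention treats \<open>b = 0\<close>, where densities need not be weakly differentiable, together
  with \<open>b > 0\<close>.\<close>

definition density_grad :: "real \<Rightarrow> (real^'n::finite \<Rightarrow> real) \<Rightarrow> real^'n \<Rightarrow> real^'n" where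
  "density_grad b \<rho> = (if b = 0 then \<lambda>_. 0 else weak_grad \<rho>)"

definition density_energy ::
  "('n::finite \<Rightarrow> real) \<Rightarrow> real \<Rightarrow> real \<Rightarrow> (real^'n \<Rightarrow> real) \<Rightarrow> real" where
  "density_energy \<gamma> a b \<rho> =
     (LINT x|lebesgue. harmonic \<gamma> x * \<rho> x) + a / 2 * (LINT x|lebesgue. (norm (\<rho> x))\<^sup>2)
     + b / 2 * (LINT x|lebesgue. (norm (density_grad b \<rho> x))\<^sup>2)"

text \<open>Eight times the defect in midpoint convexity of \<open>density_energy\<close>.\<close>

definition density_dist_sq :: "real \<Rightarrow> real \<Rightarrow> (real^'n::finite \<Rightarrow> real) \<Rightarrow> (real^'n \<Rightarrow> real) \<Rightarrow> real" where
  "density_dist_sq a b \<rho> \<sigma> =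
     a * (LINT x|lebesgue. (norm (\<rho> x - \<sigma> x))\<^sup>2)
     + b * (LINT x|lebesgue. (norm (density_grad b \<rho> x - density_grad b \<sigma> x))\<^sup>2)"

lemma in_L2_zero: "in_L2 (\<lambda>_. 0)"
  unfolding in_L2_def by simp

lemma density_classD:
  assumes "density_class \<gamma> b \<rho>"
  shows "0 \<le> \<rho> x" "integrable lebesgue \<rho>" "(LINT x|lebesgue. \<rho> x) = 1"
    "integrable lebesgue (\<lambda>x. harmonic \<gamma> x * \<rho> x)" "in_L2 \<rho>" "in_L2 (density_grad b \<rho>)"
    "b \<noteq> 0 \<Longrightarrow> has_weak_gradient \<rho> (density_grad b \<rho>)"
  using assms in_L2_zero has_weak_gradient_weak_grad
  unfolding density_class_def density_grad_def by auto

lemma density_energy_nonneg: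
  assumes "density_class \<gamma> b \<rho>" "0 \<le> a" "0 \<le> b"
  shows "0 \<le> density_energy \<gamma> a b \<rho>"
  unfolding density_energy_def using assms density_classD(1)[OF assms(1)]
  by (intro add_nonneg_nonneg mult_nonneg_nonneg integral_nonneg_AE)
     (simp_all add: harmonic_nonneg)

lemma density_midpoint:
  assumes \<rho>: "density_class \<gamma> b \<rho>" and \<sigma>: "density_class \<gamma> b \<sigma>"
  defines "\<mu> \<equiv> \<lambda>x. (1/2) *\<^sub>R \<rho> x + (1/2) *\<^sub>R \<sigma> x"
  shows "density_class \<gamma> b \<mu>"
    and "density_energy \<gamma> a b \<mu> = density_energy \<gamma> a b \<rho> / 2 + density_energy \<gamma> a b \<sigma> / 2
      - density_dist_sq a b \<rho> \<sigma> / 8"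
proof -
  note R = density_classD[OF \<rho>] and S = density_classD[OF \<sigma>]
  note m2 = in_L2_midpoint[OF R(5) S(5)] and g2 = in_L2_midpoint[OF R(6) S(6)]
  \<comment> \<open>The chosen gradient of the midpoint is the midpoint of the gradients only almost
    everywhere; for \<open>b = 0\<close> all of them are 0 by convention.\<close>
  have grad: "AE x in lebesgue. density_grad b \<mu> x = (1/2) *\<^sub>R density_grad b \<rho> x + (1/2) *\<^sub>R density_grad b \<sigma> x"
    and wd: "b \<noteq> 0 \<Longrightarrow> weakly_differentiable \<mu>"
  proof -
    have wg: "has_weak_gradient \<mu> (\<lambda>x. (1/2) *\<^sub>R density_grad b \<rho> x + (1/2) *\<^sub>R density_grad b \<sigma> x)" if "b \<noteq> 0"
      unfolding \<mu>_def by (rule has_weak_gradient_lincomb[OF R(7)[OF that] S(7)[OF that]])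
    then show "b \<noteq> 0 \<Longrightarrow> weakly_differentiable \<mu>" unfolding weakly_differentiable_def by blast
    show "AE x in lebesgue. density_grad b \<mu> x = (1/2) *\<^sub>R density_grad b \<rho> x + (1/2) *\<^sub>R density_grad b \<sigma> x"
    proof (cases "b = 0")
      case False
      then show ?thesis using weak_grad_AE[OF wg] by (simp add: density_grad_def)
    qed (simp add: density_grad_def)
  qed
  have grad': "AE x in lebesgue. (1/2) *\<^sub>R density_grad b \<rho> x + (1/2) *\<^sub>R density_grad b \<sigma> x = density_grad b \<mu> x"
    using grad by eventually_elim simp
  have V: "integrable lebesgue (\<lambda>x. harmonic \<gamma> x * \<mu> x)"
    "(LINT x|lebesgue. harmonic \<gamma> x * \<mu> x) =
      (LINT x|lebesgue. harmonic \<gamma> x * \<rho> x) / 2 + (LINT x|lebesgue. harmonic \<gamma> x * \<sigma> x) / 2"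
  proof -
    have eq: "harmonic \<gamma> x * \<mu> x = (harmonic \<gamma> x * \<rho> x) / 2 + (harmonic \<gamma> x * \<sigma> x) / 2" for x
      unfolding \<mu>_def by (simp add: algebra_simps)
    show "integrable lebesgue (\<lambda>x. harmonic \<gamma> x * \<mu> x)"
      "(LINT x|lebesgue. harmonic \<gamma> x * \<mu> x) =
        (LINT x|lebesgue. harmonic \<gamma> x * \<rho> x) / 2 + (LINT x|lebesgue. harmonic \<gamma> x * \<sigma> x) / 2"
      unfolding eq using R(4) S(4) by simp_all
  qed
  have gL2: "in_L2 (density_grad b \<mu>)" by (rule in_L2_cong_AE[OF g2(1) grad'])
  show "density_class \<gamma> b \<mu>"
    unfolding density_class_def
  proof (intro conjI allI impI)
    show "0 \<le> \<mu> x" for x unfolding \<mu>_def using R(1)[of x] S(1)[of x] by simp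
    show "integrable lebesgue \<mu>" "(LINT x|lebesgue. \<mu> x) = 1"
      unfolding \<mu>_def using R(2,3) S(2,3) by simp_all
    show "in_L2 \<mu>" unfolding \<mu>_def by (rule m2(1))
    show "weakly_differentiable \<mu>" if "b \<noteq> 0" by (rule wd[OF that])
    show "in_L2 (weak_grad \<mu>)" if "b \<noteq> 0" using gL2 that by (simp add: density_grad_def)
  qed (rule V(1))
  have G: "(LINT x|lebesgue. (norm (density_grad b \<mu> x))\<^sup>2) =
      (LINT x|lebesgue. (norm ((1/2) *\<^sub>R density_grad b \<rho> x + (1/2) *\<^sub>R density_grad b \<sigma> x))\<^sup>2)"
    by (rule integral_lebesgue_cong_AE) (use grad in eventually_elim, simp)
  have M: "(LINT x|lebesgue. (norm (\<mu> x))\<^sup>2) = (LINT x|lebesgue. (norm (\<rho> x))\<^sup>2) / 2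
      + (LINT x|lebesgue. (norm (\<sigma> x))\<^sup>2) / 2 - (LINT x|lebesgue. (norm (\<rho> x - \<sigma> x))\<^sup>2) / 4"
    unfolding \<mu>_def by (rule m2(2))
  show "density_energy \<gamma> a b \<mu> = density_energy \<gamma> a b \<rho> / 2 + density_energy \<gamma> a b \<sigma> / 2
      - density_dist_sq a b \<rho> \<sigma> / 8"
    unfolding density_energy_def density_dist_sq_def V(2) M G g2(2) by (simp add: field_simps)
qed

text \<open>The bound is uniform because two probability densities have L1 distance at most 2. For
  \<open>b = 0\<close> the form is \<open>a\<close> times the squared L2 distance; for
  \<open>b > 0\<close> its gradient part suffices, through Nash's inequality.\<close>

lemma density_dist_sq_coercive:
  fixes a b \<omega> :: real
  assumes a: "0 \<le> a" and b: "0 \<le> b" and ab: "0 < a + b" and \<omega>: "0 < \<omega>"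
  obtains \<eta> where "0 < \<eta>" "\<And>\<gamma> (\<rho> :: real^'n \<Rightarrow> real) \<sigma>. density_class \<gamma> b \<rho> \<Longrightarrow> density_class \<gamma> b \<sigma> \<Longrightarrow>
    density_dist_sq a b \<rho> \<sigma> \<le> \<eta> \<Longrightarrow>
      (LINT x|lebesgue. (norm (\<rho> x - \<sigma> x))\<^sup>2) \<le> \<omega> \<and>
      (LINT x|lebesgue. (norm (density_grad b \<rho> x - density_grad b \<sigma> x))\<^sup>2) \<le> \<omega>"
proof (cases "b = 0")
  case True
  then have "0 < a" using ab by simp
  then have "(LINT x|lebesgue. (norm (\<rho> x - \<sigma> x))\<^sup>2) \<le> \<omega>"
    if "density_dist_sq a b \<rho> \<sigma> \<le> a * \<omega>" for \<rho> \<sigma> :: "real^'n \<Rightarrow> real"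
    using that True by (simp add: density_dist_sq_def)
  then show ?thesis using True \<open>0 < a\<close> \<omega> by (intro that[of "a * \<omega>"]) (simp_all add: density_grad_def)
next
  case False
  then have b: "0 < b" using b by simp
  obtain C M where C: "0 \<le> C" and M: "0 \<le> M" and
    kernels: "\<And>s. 0 < s \<Longrightarrow> \<exists>(K :: real^'n \<Rightarrow> real) D. smoothing_kernel (C / s ^ CARD('n)) M s K D"
    using smoothing_kernels_exist by metis
  \<comment> \<open>The width makes the L1 term of Nash's inequality at most 2 (\<omega>/16) 2^2 =
    \<omega>/2; the maximum with 1 ensures that s is at most its n-th power.\<close>
  define s where "s = max 1 (16 * C / \<omega>)"
  have s: "1 \<le> s" "0 < s" unfolding s_def by auto
  obtain K :: "real^'n \<Rightarrow> real" and D where K: "smoothing_kernel (C / s ^ CARD('n)) M s K D"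
    using kernels[OF s(2)] by blast
  have Cs: "C / s ^ CARD('n) \<le> \<omega> / 16"
  proof -
    have "s \<le> s ^ CARD('n)" using s(1) by (simp add: self_le_power)
    moreover have "16 * C / \<omega> \<le> s" unfolding s_def by simp
    ultimately have "16 * C / \<omega> \<le> s ^ CARD('n)" by linarith
    then have "16 * C \<le> s ^ CARD('n) * \<omega>" using \<omega> by (simp add: pos_divide_le_eq)
    then show ?thesis using s(2) by (simp add: pos_divide_le_eq mult.commute)
  qed
  \<comment> \<open>With the width fixed, the gradient term receives the other \<omega>/2;
    \<open>M + 1\<close> keeps the denominator positive when \<open>M\<close> is 0.\<close>
  define \<eta>' where "\<eta>' = min \<omega> (\<omega> / (4 * (s\<^sup>2 * (M + 1))))"
  have den: "0 < 4 * (s\<^sup>2 * (M + 1))" using s M by simp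
  have \<eta>': "0 < \<eta>'" "\<eta>' \<le> \<omega>" unfolding \<eta>'_def using \<omega> den by auto
  have M\<eta>: "2 * (s\<^sup>2 * M) * \<eta>' \<le> \<omega> / 2"
  proof -
    have "2 * (s\<^sup>2 * M) * \<eta>' \<le> 2 * (s\<^sup>2 * (M + 1)) * (\<omega> / (4 * (s\<^sup>2 * (M + 1))))"
      using M \<eta>'(1) by (intro mult_mono) (auto simp: \<eta>'_def)
    also have "\<dots> = \<omega> / 2" using den by (simp add: field_simps)
    finally show ?thesis .
  qed
  have "(LINT x|lebesgue. (norm (\<rho> x - \<sigma> x))\<^sup>2) \<le> \<omega> \<and>
      (LINT x|lebesgue. (norm (density_grad b \<rho> x - density_grad b \<sigma> x))\<^sup>2) \<le> \<omega>"
    if \<rho>: "density_class \<gamma> b \<rho>" and \<sigma>: "density_class \<gamma> b \<sigma>" and d: "density_dist_sq a b \<rho> \<sigma> \<le> b * \<eta>'"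
    for \<gamma> and \<rho> \<sigma> :: "real^'n \<Rightarrow> real"
  proof -
    note R = density_classD[OF \<rho>] and S = density_classD[OF \<sigma>]
    let ?G = "LINT x|lebesgue. (norm (density_grad b \<rho> x - density_grad b \<sigma> x))\<^sup>2"
    have "0 \<le> a * (LINT x|lebesgue. (norm (\<rho> x - \<sigma> x))\<^sup>2)" using a by simp
    then have "b * ?G \<le> b * \<eta>'" using d unfolding density_dist_sq_def by linarith
    then have G: "?G \<le> \<eta>'" using b by simp
    have wg: "has_weak_gradient (\<lambda>x. \<rho> x - \<sigma> x) (\<lambda>x. density_grad b \<rho> x - density_grad b \<sigma> x)"
      using has_weak_gradient_lincomb[OF R(7) S(7), of 1 "-1"] False by simp
    have i1: "integrable lebesgue (\<lambda>x. \<rho> x - \<sigma> x)" using R(2) S(2) by simp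
    note nash = nash_L2(2)[OF wg i1 in_L2_diff[OF R(6) S(6)] K M]
    have "(LINT x|lebesgue. \<bar>\<rho> x - \<sigma> x\<bar>) \<le> (LINT x|lebesgue. \<rho> x + \<sigma> x)"
      using R(1) S(1) by (intro integral_mono integrable_abs i1) (use R(2) S(2) in \<open>auto simp: abs_le_iff\<close>)
    also have "\<dots> = 2" using R(2,3) S(2,3) by simp
    finally have "(LINT x|lebesgue. \<bar>\<rho> x - \<sigma> x\<bar>)\<^sup>2 \<le> 2\<^sup>2" by (intro power_mono) simp_all
    then have "2 * (C / s ^ CARD('n)) * (LINT x|lebesgue. \<bar>\<rho> x - \<sigma> x\<bar>)\<^sup>2 \<le> 2 * (\<omega> / 16) * 2\<^sup>2"
      using Cs C s \<omega> by (intro mult_mono) auto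
    moreover have "2 * (s\<^sup>2 * M) * ?G \<le> 2 * (s\<^sup>2 * M) * \<eta>'"
      using G M by (intro mult_left_mono) auto
    ultimately have "(LINT x|lebesgue. (\<rho> x - \<sigma> x)\<^sup>2) \<le> \<omega>"
      using nash M\<eta> by simp
    then show ?thesis using G \<eta>'(2) by simp
  qed
  then show ?thesis using b \<eta>'(1) by (intro that[of "b * \<eta>'"]) simp_all
qed

text \<open>The midpoint is a competitor, so its energy is at least \<open>I\<close>. Here
  \<open>I\<close> may be the infimum, before a minimizer is known, or the minimum.\<close>

lemma density_dist_sq_le_excess:
  assumes "density_class \<gamma> b \<rho>" "density_class \<gamma> b \<sigma>"
    and "\<forall>\<mu>. density_class \<gamma> b \<mu> \<longrightarrow> I \<le> density_energy \<gamma> a b \<mu>"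
  shows "density_dist_sq a b \<rho> \<sigma> \<le> 4 * density_energy \<gamma> a b \<rho> + 4 * density_energy \<gamma> a b \<sigma> - 8 * I"
  using assms(3)[rule_format, OF density_midpoint(1)[OF assms(1,2)]] density_midpoint(2)[OF assms(1,2), of a] by simp

section \<open>Confinement by the potential and existence of a minimizing density\<close>

lemma harmonic_ge:
  assumes "\<And>i. 0 < \<gamma> i"
  obtains c where "0 < c" "\<And>x. c * (norm x)\<^sup>2 \<le> harmonic \<gamma> x"
proof -
  define m where "m = Min (range \<gamma>)"
  have m: "0 < m" "m \<le> \<gamma> i" for i unfolding m_def using assms by auto
  have "m\<^sup>2 / 2 * (norm x)\<^sup>2 \<le> harmonic \<gamma> x" for x :: "real^'a"
  proof -
    have "(\<Sum>i\<in>UNIV. m\<^sup>2 * (x $ i)\<^sup>2) \<le> (\<Sum>i\<in>UNIV. (\<gamma> i)\<^sup>2 * (x $ i)\<^sup>2)"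
      using m by (intro sum_mono mult_right_mono power_mono) (auto simp: less_imp_le)
    moreover have "(norm x)\<^sup>2 = (\<Sum>i\<in>UNIV. (x $ i)\<^sup>2)"
      by (simp add: norm_vec_def L2_set_def sum_nonneg)
    ultimately show ?thesis
      unfolding harmonic_def by (simp add: sum_distrib_left[symmetric])
  qed
  then show ?thesis using m(1) by (intro that[of "m\<^sup>2 / 2"]) auto
qed

text \<open>Chebyshev's inequality: outside the ball the potential is at least c R^2.\<close>

lemma mass_outside_ball:
  assumes \<rho>: "density_class \<gamma> b \<rho>" and c: "0 < c" "\<And>x. c * (norm x)\<^sup>2 \<le> harmonic \<gamma> x" and R: "0 < R"
    and V: "(LINT x|lebesgue. harmonic \<gamma> x * \<rho> x) \<le> B"
  shows "1 - B / (c * R\<^sup>2) \<le> (LINT x|lebesgue. indicator (cball 0 R) x * \<rho> x)"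
proof -
  note D = density_classD[OF \<rho>]
  have ib: "integrable lebesgue (\<lambda>x. indicator (cball 0 R) x * \<rho> x)"
    using integrable_mult_indicator[OF _ D(2), of "cball 0 R"] by simp
  have le: "\<rho> x \<le> indicator (cball 0 R) x * \<rho> x + harmonic \<gamma> x * \<rho> x / (c * R\<^sup>2)" for x
  proof (cases "x \<in> cball 0 R")
    case True
    then show ?thesis using D(1)[of x] harmonic_nonneg[of \<gamma> x] c R by simp
  next
    case False
    then have "R\<^sup>2 \<le> (norm x)\<^sup>2" using R by (intro power_mono) auto
    then have "c * R\<^sup>2 \<le> harmonic \<gamma> x" using c(2)[of x] mult_left_mono[of "R\<^sup>2" "(norm x)\<^sup>2" c] c(1) by linarith
    then have "(c * R\<^sup>2) * \<rho> x \<le> harmonic \<gamma> x * \<rho> x" using D(1) by (intro mult_right_mono) auto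
    moreover have "0 < c * R\<^sup>2" using c R by simp
    ultimately show ?thesis using False by (simp add: pos_le_divide_eq mult.commute)
  qed
  have "1 \<le> (LINT x|lebesgue. indicator (cball 0 R) x * \<rho> x + harmonic \<gamma> x * \<rho> x / (c * R\<^sup>2))"
    unfolding D(3)[symmetric] by (intro integral_mono le D(2) Bochner_Integration.integrable_add ib) (simp add: D(4))
  also have "\<dots> = (LINT x|lebesgue. indicator (cball 0 R) x * \<rho> x) + (LINT x|lebesgue. harmonic \<gamma> x * \<rho> x) / (c * R\<^sup>2)"
    using ib D(4) by simp
  also have "\<dots> \<le> (LINT x|lebesgue. indicator (cball 0 R) x * \<rho> x) + B / (c * R\<^sup>2)"
    using V c R by (simp add: divide_right_mono)
  finally show ?thesis by simp
qed

text \<open>A ball has finite measure, so Cauchy-Schwarz against its indicator turns L2 convergence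
  into convergence of the mass on it.\<close>

lemma integral_ball_tendsto:
  fixes u :: "nat \<Rightarrow> real^'n \<Rightarrow> real"
  assumes u: "\<And>k. in_L2 (u k)" and v: "in_L2 v"
    and lim: "(\<lambda>k. LINT x|lebesgue. (norm (u k x - v x))\<^sup>2) \<longlonglongrightarrow> 0"
  shows "(\<lambda>k. LINT x|lebesgue. indicator (cball 0 R) x * u k x) \<longlonglongrightarrow> (LINT x|lebesgue. indicator (cball 0 R) x * v x)"
proof -
  let ?\<iota> = "indicat_real (cball 0 R) :: real^'n \<Rightarrow> real"
  have li: "integrable lebesgue (\<lambda>x. ?\<iota> x * w x)" if "in_L2 w" for w :: "real^'n \<Rightarrow> real"
    using locally_integrableD[OF square_integrable_locally_integrable[OF in_L2_measurable[OF that] in_L2_integrable[OF that]] compact_cball[of 0 R]]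
    by simp
  have \<iota>: "integrable lebesgue ?\<iota>" by (rule compact_integrable_indicator[OF compact_cball])
  have \<iota>2: "(?\<iota> x)\<^sup>2 = ?\<iota> x" for x by (simp add: indicator_def)
  let ?C = "LINT x|lebesgue. ?\<iota> x"
  have bound: "((LINT x|lebesgue. ?\<iota> x * u k x) - (LINT x|lebesgue. ?\<iota> x * v x))\<^sup>2
      \<le> ?C * (LINT x|lebesgue. (norm (u k x - v x))\<^sup>2)" for k
  proof -
    have "(LINT x|lebesgue. ?\<iota> x * u k x) - (LINT x|lebesgue. ?\<iota> x * v x) = (LINT x|lebesgue. ?\<iota> x * (u k x - v x))"
      using li[OF u] li[OF v] by (simp add: right_diff_distrib)
    moreover have "\<bar>LINT x|lebesgue. ?\<iota> x * (u k x - v x)\<bar> \<le> (LINT x|lebesgue. \<bar>?\<iota> x * (u k x - v x)\<bar>)"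
      by (rule integral_abs_bound)
    ultimately have "\<bar>(LINT x|lebesgue. ?\<iota> x * u k x) - (LINT x|lebesgue. ?\<iota> x * v x)\<bar>\<^sup>2 \<le> (LINT x|lebesgue. \<bar>?\<iota> x * (u k x - v x)\<bar>)\<^sup>2"
      by (intro power_mono) simp_all
    then have "((LINT x|lebesgue. ?\<iota> x * u k x) - (LINT x|lebesgue. ?\<iota> x * v x))\<^sup>2 \<le> (LINT x|lebesgue. \<bar>?\<iota> x * (u k x - v x)\<bar>)\<^sup>2"
      by (simp only: power2_abs)
    also have "\<dots> \<le> (LINT x|lebesgue. (?\<iota> x)\<^sup>2) * (LINT x|lebesgue. (u k x - v x)\<^sup>2)"
      using in_L2_measurable[OF in_L2_diff[OF u v]] in_L2_integrable[OF in_L2_diff[OF u v]] \<iota>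
      by (intro Cauchy_Schwarz_integral) (auto simp: \<iota>2)
    finally show ?thesis by (simp add: \<iota>2)
  qed
  have "(\<lambda>k. ?C * (LINT x|lebesgue. (norm (u k x - v x))\<^sup>2)) \<longlonglongrightarrow> ?C * 0" by (intro tendsto_intros lim)
  then have "(\<lambda>k. ((LINT x|lebesgue. ?\<iota> x * u k x) - (LINT x|lebesgue. ?\<iota> x * v x))\<^sup>2) \<longlonglongrightarrow> 0"
    by (intro LIMSEQ_squeeze_0[OF _ bound]) simp_all
  from tendsto_real_sqrt[OF this] show ?thesis
    by (simp add: LIM_zero_iff tendsto_rabs_zero_iff)
qed

theorem density_minimizer_exists:
  fixes \<gamma> :: "'n::finite \<Rightarrow> real"
  assumes \<gamma>: "\<And>i. 0 < \<gamma> i" and a: "0 \<le> a" and b: "0 \<le> b" and ab: "0 < a + b"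
    and ne: "density_class \<gamma> b \<rho>0"
  obtains \<rho> where "density_class \<gamma> b \<rho>"
    "\<And>\<sigma>. density_class \<gamma> b \<sigma> \<Longrightarrow> density_energy \<gamma> a b \<rho> \<le> density_energy \<gamma> a b \<sigma>"
proof -
  define E where "E = density_energy \<gamma> a b ` {\<rho>. density_class \<gamma> b \<rho>}"
  define I where "I = Inf E"
  have bdd: "bdd_below E"
    unfolding E_def using density_energy_nonneg[OF _ a b] by (intro bdd_belowI[of _ 0]) auto
  have I_le: "I \<le> density_energy \<gamma> a b \<sigma>" if "density_class \<gamma> b \<sigma>" for \<sigma>
    unfolding I_def using that bdd by (intro cInf_lower) (auto simp: E_def)
  have I_all: "\<forall>\<sigma>. density_class \<gamma> b \<sigma> \<longrightarrow> I \<le> density_energy \<gamma> a b \<sigma>"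
    using I_le by blast
  have "\<exists>\<rho>. density_class \<gamma> b \<rho> \<and> density_energy \<gamma> a b \<rho> < I + inverse (real (Suc k))" for k
  proof -
    have "E \<noteq> {}" unfolding E_def using ne by auto
    moreover have "Inf E < I + inverse (real (Suc k))" unfolding I_def by simp
    ultimately obtain e where "e \<in> E" "e < I + inverse (real (Suc k))" by (rule cInf_lessD[THEN bexE])
    then show ?thesis unfolding E_def by auto
  qed
  then obtain u where u: "\<And>k. density_class \<gamma> b (u k)"
    and uE: "\<And>k. density_energy \<gamma> a b (u k) < I + inverse (real (Suc k))" by metis
  note U = density_classD[OF u]
  have I0: "0 \<le> I"
    unfolding I_def E_def using ne density_energy_nonneg[OF _ a b] by (intro cInf_greatest) auto
  define G where "G = (\<lambda>k. density_grad b (u k))"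
  \<comment> \<open>Density and gradient are paired, so that one subsequence serves for
    both.\<close>
  define f where "f = (\<lambda>k x. (u k x, G k x))"
  have um [measurable]: "u k \<in> borel_measurable lebesgue" and Gm [measurable]: "G k \<in> borel_measurable lebesgue" for k
    unfolding G_def by (rule in_L2_measurable, rule U)+
  have fL2: "in_L2 (f k)" for k
  proof (rule in_L2_bound)
    show "f k \<in> borel_measurable lebesgue" unfolding f_def by measurable
    show "integrable lebesgue (\<lambda>x. (norm (u k x))\<^sup>2 + (norm (G k x))\<^sup>2)"
      unfolding G_def by (intro Bochner_Integration.integrable_add in_L2_integrable U)
  qed (simp add: f_def norm_Pair)
  have cauchy: "\<exists>N. \<forall>k\<ge>N. \<forall>l\<ge>N. (LINT x|lebesgue. (norm (f k x - f l x))\<^sup>2) \<le> \<omega>" if "0 < \<omega>" for \<omega>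
  proof -
    have \<omega>2: "0 < \<omega> / 2" using that by simp
    obtain \<eta> where \<eta>: "0 < \<eta>" and co: "\<And>\<gamma> (\<rho> :: real^'n \<Rightarrow> real) \<sigma>. density_class \<gamma> b \<rho> \<Longrightarrow>
        density_class \<gamma> b \<sigma> \<Longrightarrow> density_dist_sq a b \<rho> \<sigma> \<le> \<eta> \<Longrightarrow>
        (LINT x|lebesgue. (norm (\<rho> x - \<sigma> x))\<^sup>2) \<le> \<omega> / 2 \<and>
        (LINT x|lebesgue. (norm (density_grad b \<rho> x - density_grad b \<sigma> x))\<^sup>2) \<le> \<omega> / 2"
      by (rule density_dist_sq_coercive[OF a b ab \<omega>2]) (erule that, blast)
    obtain N where N: "inverse (real (Suc N)) < \<eta> / 8" using reals_Archimedean[of "\<eta> / 8"] \<eta> by auto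
    \<comment> \<open>The excesses of the two energies are below p and q, so the form is at most 4 p
      + 4 q \<le> 8 r < \<eta>.\<close>
    have arith: "p \<le> r \<Longrightarrow> q \<le> r \<Longrightarrow> d \<le> 4 * A + 4 * B - 8 * I \<Longrightarrow> A < I + p \<Longrightarrow> B < I + q \<Longrightarrow> r < \<eta> / 8 \<Longrightarrow> d \<le> \<eta>"
      for p q r d A B :: real by linarith
    have "(LINT x|lebesgue. (norm (f k x - f l x))\<^sup>2) \<le> \<omega>" if kl: "N \<le> k" "N \<le> l" for k l
    proof -
      have "inverse (real (Suc k)) \<le> inverse (real (Suc N))" "inverse (real (Suc l)) \<le> inverse (real (Suc N))"
        using kl by (auto intro!: le_imp_inverse_le)
      then have "density_dist_sq a b (u k) (u l) \<le> \<eta>"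
        using arith density_dist_sq_le_excess[OF u u I_all, of k l] uE[of k] uE[of l] N by blast
      from co[OF u u this]
      have le: "(LINT x|lebesgue. (norm (u k x - u l x))\<^sup>2) \<le> \<omega> / 2" "(LINT x|lebesgue. (norm (G k x - G l x))\<^sup>2) \<le> \<omega> / 2"
        unfolding G_def by auto
      have "(norm (f k x - f l x))\<^sup>2 = (norm (u k x - u l x))\<^sup>2 + (norm (G k x - G l x))\<^sup>2" for x
        by (simp add: f_def norm_Pair)
      then have "(LINT x|lebesgue. (norm (f k x - f l x))\<^sup>2) =
          (LINT x|lebesgue. (norm (u k x - u l x))\<^sup>2) + (LINT x|lebesgue. (norm (G k x - G l x))\<^sup>2)"
        using Bochner_Integration.integral_add[OF in_L2_integrable[OF in_L2_diff[OF U(5) U(5)]]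
            in_L2_integrable[OF in_L2_diff[OF U(6) U(6)]], of k l k l] unfolding G_def by simp
      then show ?thesis using le by simp
    qed
    then show ?thesis by blast
  qed
  obtain h r where h: "in_L2 h" and r: "strict_mono r" and ae: "AE x in lebesgue. (\<lambda>j. f (r j) x) \<longlonglongrightarrow> h x"
    and lim: "(\<lambda>k. LINT x|lebesgue. (norm (f k x - h x))\<^sup>2) \<longlonglongrightarrow> 0"
    by (rule L2_complete[OF fL2 cauchy])
  define \<rho>' where "\<rho>' = (\<lambda>x. fst (h x))"
  define g where "g = (\<lambda>x. snd (h x))"
  \<comment> \<open>The limit is nonnegative only almost everywhere, while
    \<open>density_class\<close> asks for every point.\<close>
  define \<rho> where "\<rho> = (\<lambda>x. max 0 (\<rho>' x))"
  have hm [measurable]: "h \<in> borel_measurable lebesgue" by (rule in_L2_measurable[OF h])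
  have norm_h: "(norm (p :: real \<times> (real^'n)))\<^sup>2 = (norm (fst p))\<^sup>2 + (norm (snd p))\<^sup>2" for p
    by (simp add: norm_prod_def)
  have "fst \<in> borel_measurable borel" "snd \<in> borel_measurable borel"
    by (intro borel_measurable_continuous_onI continuous_on_fst continuous_on_snd continuous_on_id)+
  then have m [measurable]: "\<rho>' \<in> borel_measurable lebesgue" "g \<in> borel_measurable lebesgue"
    unfolding \<rho>'_def g_def by (intro measurable_compose[OF hm]; simp)+
  have m\<rho> [measurable]: "\<rho> \<in> borel_measurable lebesgue" unfolding \<rho>_def by measurable
  have \<rho>'2: "in_L2 \<rho>'" by (rule in_L2_bound[OF m(1) in_L2_integrable[OF h]]) (simp add: norm_h \<rho>'_def)
  have g2: "in_L2 g" by (rule in_L2_bound[OF m(2) in_L2_integrable[OF h]]) (simp add: norm_h g_def)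
  have u_lim: "(\<lambda>k. LINT x|lebesgue. (norm (u k x - \<rho>' x))\<^sup>2) \<longlonglongrightarrow> 0"
  proof (rule LIMSEQ_squeeze_0[OF _ _ lim])
    show "(LINT x|lebesgue. (norm (u k x - \<rho>' x))\<^sup>2) \<le> (LINT x|lebesgue. (norm (f k x - h x))\<^sup>2)" for k
      by (intro integral_mono in_L2_integrable in_L2_diff U \<rho>'2 fL2 h) (simp add: norm_h f_def \<rho>'_def)
  qed simp
  have G_lim: "(\<lambda>k. LINT x|lebesgue. (norm (G k x - g x))\<^sup>2) \<longlonglongrightarrow> 0"
  proof (rule LIMSEQ_squeeze_0[OF _ _ lim])
    show "(LINT x|lebesgue. (norm (G k x - g x))\<^sup>2) \<le> (LINT x|lebesgue. (norm (f k x - h x))\<^sup>2)" for k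
      unfolding G_def
      by (intro integral_mono in_L2_integrable in_L2_diff U g2 fL2 h) (simp add: norm_h f_def g_def G_def)
  qed simp
  have ae_lim: "AE x in lebesgue. (\<lambda>j. u (r j) x) \<longlonglongrightarrow> \<rho> x \<and> (\<lambda>j. G (r j) x) \<longlonglongrightarrow> g x \<and> \<rho>' x = \<rho> x"
    using ae
  proof eventually_elim
    case (elim x)
    have 1: "(\<lambda>j. u (r j) x) \<longlonglongrightarrow> \<rho>' x" "(\<lambda>j. G (r j) x) \<longlonglongrightarrow> g x"
      using tendsto_fst[OF elim] tendsto_snd[OF elim] by (simp_all add: f_def \<rho>'_def g_def)
    have "0 \<le> \<rho>' x" by (rule LIMSEQ_le_const[OF 1(1)]) (use U(1) in auto)
    then show ?case using 1 by (simp add: \<rho>_def)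
  qed
  have \<rho>_ae: "AE x in lebesgue. \<rho>' x = \<rho> x" using ae_lim by eventually_elim simp
  have \<rho>2: "in_L2 \<rho>" by (rule in_L2_cong_AE[OF \<rho>'2 \<rho>_ae])
  have \<rho>0: "0 \<le> \<rho> x" for x unfolding \<rho>_def by simp
  have wg: "has_weak_gradient \<rho> g" if "b \<noteq> 0"
  proof (rule has_weak_gradient_cong_AE[OF _ \<rho>_ae])
    show "has_weak_gradient \<rho>' g"
    proof (rule has_weak_gradient_L2_limit[OF _ _ _ _ _ u_lim G_lim])
      show "has_weak_gradient (u k) (G k)" for k unfolding G_def by (rule U(7)[OF that])
      show "locally_integrable \<rho>'" "locally_integrable g"
        by (intro square_integrable_locally_integrable m in_L2_integrable \<rho>'2 g2)+
      show "integrable lebesgue (\<lambda>x. (norm (u k x - \<rho>' x))\<^sup>2)" for k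
        by (intro in_L2_integrable in_L2_diff U \<rho>'2)
      show "integrable lebesgue (\<lambda>x. (norm (G k x - g x))\<^sup>2)" for k
        unfolding G_def by (intro in_L2_integrable in_L2_diff U g2)
    qed
  qed simp
  have grad: "AE x in lebesgue. density_grad b \<rho> x = g x"
  proof (cases "b = 0")
    case True
    \<comment> \<open>All gradients in the sequence are 0 by convention, and so is their
      limit.\<close>
    show ?thesis using ae_lim
    proof eventually_elim
      case (elim x)
      then show ?case using True by (auto simp: density_grad_def G_def LIMSEQ_const_iff)
    qed
  next
    case False
    then show ?thesis using weak_grad_AE[OF wg] by (simp add: density_grad_def)
  qed
  \<comment> \<open>The gradient is a separate argument, so that the pointwise limit
    \<open>g\<close> can be inserted in place of a chosen representative. The integrand is
    nonnegative on densities, and lower semicontinuity is Fatou's lemma.\<close>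
  define e where "e = (\<lambda>\<rho> g x. harmonic \<gamma> x * \<rho> x + a / 2 * (norm (\<rho> x :: real))\<^sup>2 + b / 2 * (norm (g x :: real^'n))\<^sup>2)"
  have hV [measurable]: "harmonic \<gamma> \<in> borel_measurable lebesgue" by (rule borel_lebesgueI[OF harmonic_borel])
  have e_nonneg: "0 \<le> e \<sigma> q x" if "0 \<le> \<sigma> x" for \<sigma> q x
    unfolding e_def using that a b harmonic_nonneg[of \<gamma> x] by simp
  have e_u: "(\<integral>\<^sup>+x. ennreal (e (u k) (G k) x) \<partial>lebesgue) = ennreal (density_energy \<gamma> a b (u k))" for k
  proof -
    have i: "integrable lebesgue (\<lambda>x. harmonic \<gamma> x * u k x)" "integrable lebesgue (\<lambda>x. a / 2 * (norm (u k x))\<^sup>2)"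
      "integrable lebesgue (\<lambda>x. b / 2 * (norm (G k x))\<^sup>2)"
      unfolding G_def by (intro integrable_mult_right in_L2_integrable U)+
    have "integrable lebesgue (e (u k) (G k))" unfolding e_def using i by (intro Bochner_Integration.integrable_add)
    then have "(\<integral>\<^sup>+x. ennreal (e (u k) (G k) x) \<partial>lebesgue) = ennreal (LINT x|lebesgue. e (u k) (G k) x)"
      by (rule nn_integral_eq_integral) (simp add: e_nonneg U(1))
    also have "(LINT x|lebesgue. e (u k) (G k) x) = density_energy \<gamma> a b (u k)"
      unfolding e_def density_energy_def
      using Bochner_Integration.integral_add[OF Bochner_Integration.integrable_add[OF i(1,2)] i(3)]
        Bochner_Integration.integral_add[OF i(1,2)] by (simp add: G_def)
    finally show ?thesis .
  qed
  have "(\<integral>\<^sup>+x. ennreal (e \<rho> g x) \<partial>lebesgue) = (\<integral>\<^sup>+x. liminf (\<lambda>j. ennreal (e (u (r j)) (G (r j)) x)) \<partial>lebesgue)"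
  proof (rule nn_integral_cong_AE)
    show "AE x in lebesgue. ennreal (e \<rho> g x) = liminf (\<lambda>j. ennreal (e (u (r j)) (G (r j)) x))"
      using ae_lim
    proof eventually_elim
      case (elim x)
      then show ?case unfolding e_def
        by (intro lim_imp_Liminf[symmetric] tendsto_ennrealI tendsto_intros) simp_all
    qed
  qed
  also have "\<dots> \<le> liminf (\<lambda>j. \<integral>\<^sup>+x. ennreal (e (u (r j)) (G (r j)) x) \<partial>lebesgue)"
    unfolding e_def by (rule nn_integral_liminf) measurable
  also have "\<dots> \<le> liminf (\<lambda>j. ennreal (I + inverse (real (Suc j))))"
  proof (intro Liminf_mono always_eventually allI)
    fix j
    have "inverse (real (Suc (r j))) \<le> inverse (real (Suc j))"
      using seq_suble[OF r, of j] by (auto intro!: le_imp_inverse_le)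
    then show "(\<integral>\<^sup>+x. ennreal (e (u (r j)) (G (r j)) x) \<partial>lebesgue) \<le> ennreal (I + inverse (real (Suc j)))"
      unfolding e_u using uE[of "r j"] by (intro ennreal_leI) linarith
  qed
  also have "\<dots> = ennreal I"
  proof (rule lim_imp_Liminf)
    have "(\<lambda>j. I + inverse (real (Suc j))) \<longlonglongrightarrow> I + 0"
      by (intro tendsto_intros LIMSEQ_inverse_real_of_nat)
    then show "(\<lambda>j. ennreal (I + inverse (real (Suc j)))) \<longlonglongrightarrow> ennreal I"
      by (intro tendsto_ennrealI) simp
  qed simp
  finally have eI: "(\<integral>\<^sup>+x. ennreal (e \<rho> g x) \<partial>lebesgue) \<le> ennreal I" .
  have ei: "integrable lebesgue (e \<rho> g)"
  proof (rule integrableI_bounded)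
    show "e \<rho> g \<in> borel_measurable lebesgue" unfolding e_def by measurable
    show "(\<integral>\<^sup>+x. ennreal (norm (e \<rho> g x)) \<partial>lebesgue) < \<infinity>"
      using eI e_nonneg[OF \<rho>0] by (simp add: le_less_trans)
  qed
  have Vi: "integrable lebesgue (\<lambda>x. harmonic \<gamma> x * \<rho> x)"
  proof (rule Bochner_Integration.integrable_bound[OF ei])
    have "norm (harmonic \<gamma> x * \<rho> x) \<le> norm (e \<rho> g x)" for x
      using \<rho>0[of x] harmonic_nonneg[of \<gamma> x] a b e_nonneg[of \<rho> x g, OF \<rho>0] unfolding e_def by simp
    then show "AE x in lebesgue. norm (harmonic \<gamma> x * \<rho> x) \<le> norm (e \<rho> g x)" by simp
  qed measurable
  \<comment> \<open>Fatou gives mass at most 1; the reverse inequality comes from the confinement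
    estimate on large balls.\<close>
  have mass_le: "(\<integral>\<^sup>+x. ennreal (\<rho> x) \<partial>lebesgue) \<le> 1"
  proof -
    have "(\<integral>\<^sup>+x. ennreal (\<rho> x) \<partial>lebesgue) = (\<integral>\<^sup>+x. liminf (\<lambda>j. ennreal (u (r j) x)) \<partial>lebesgue)"
    proof (rule nn_integral_cong_AE)
      show "AE x in lebesgue. ennreal (\<rho> x) = liminf (\<lambda>j. ennreal (u (r j) x))"
        using ae_lim
      proof eventually_elim
        case (elim x)
        then show ?case by (intro lim_imp_Liminf[symmetric] tendsto_ennrealI) simp_all
      qed
    qed
    also have "\<dots> \<le> liminf (\<lambda>j. \<integral>\<^sup>+x. ennreal (u (r j) x) \<partial>lebesgue)"
      by (rule nn_integral_liminf) measurable
    also have "\<dots> = liminf (\<lambda>j::nat. 1)"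
      using U by (simp add: nn_integral_eq_integral)
    also have "\<dots> = (1::ennreal)" by (rule Liminf_const) simp
    finally show ?thesis .
  qed
  have i\<rho>: "integrable lebesgue \<rho>"
    by (rule integrableI_bounded) (use mass_le \<rho>0 in \<open>auto simp: le_less_trans\<close>)
  have mass_le': "(LINT x|lebesgue. \<rho> x) \<le> 1"
    using mass_le nn_integral_eq_integral[OF i\<rho>] \<rho>0 by simp
  obtain c where c: "0 < c" "\<And>x. c * (norm x)\<^sup>2 \<le> harmonic \<gamma> x" by (rule harmonic_ge[of \<gamma>, OF \<gamma>]) (erule that, blast)
  have mass_ge: "1 - (I + 1) / (c * R\<^sup>2) \<le> (LINT x|lebesgue. \<rho> x)" if R: "0 < R" for R
  proof -
    have "1 - (I + 1) / (c * R\<^sup>2) \<le> (LINT x|lebesgue. indicator (cball 0 R) x * u k x)" for k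
    proof (rule mass_outside_ball[OF u c R])
      \<comment> \<open>The potential term is at most the whole energy, hence at most I + 1 along
        the entire sequence.\<close>
      have "inverse (real (Suc k)) \<le> 1" by (simp add: inverse_le_1_iff)
      moreover have "0 \<le> a / 2 * (LINT x|lebesgue. (norm (u k x))\<^sup>2)"
        "0 \<le> b / 2 * (LINT x|lebesgue. (norm (density_grad b (u k) x))\<^sup>2)" using a b by simp_all
      ultimately show "(LINT x|lebesgue. harmonic \<gamma> x * u k x) \<le> I + 1"
        using uE[of k] unfolding density_energy_def by linarith
    qed
    then have "1 - (I + 1) / (c * R\<^sup>2) \<le> (LINT x|lebesgue. indicator (cball 0 R) x * \<rho>' x)"
      by (intro LIMSEQ_le_const[OF integral_ball_tendsto[OF U(5) \<rho>'2 u_lim]]) auto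
    also have "\<dots> = (LINT x|lebesgue. indicator (cball 0 R) x * \<rho> x)"
      by (rule integral_lebesgue_cong_AE) (use \<rho>_ae in eventually_elim, simp)
    also have "\<dots> \<le> (LINT x|lebesgue. \<rho> x)"
      using integrable_mult_indicator[OF _ i\<rho>, of "cball 0 R"] \<rho>0
      by (intro integral_mono i\<rho>) (auto simp: indicator_def)
    finally show ?thesis .
  qed
  have "(\<lambda>n. 1 - (I + 1) / (c * (real (Suc n))\<^sup>2)) \<longlonglongrightarrow> 1 - (I + 1) / c * 0"
  proof -
    have "(\<lambda>n. 1 - (I + 1) / c * (inverse (real (Suc n)))\<^sup>2) \<longlonglongrightarrow> 1 - (I + 1) / c * 0\<^sup>2"
      by (intro tendsto_intros LIMSEQ_inverse_real_of_nat)
    then show ?thesis by (simp add: divide_inverse power_inverse mult.assoc)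
  qed
  then have "1 \<le> (LINT x|lebesgue. \<rho> x)"
    using LIMSEQ_le_const2[of "\<lambda>n. 1 - (I + 1) / (c * (real (Suc n))\<^sup>2)" 1 "LINT x|lebesgue. \<rho> x"] mass_ge by auto
  then have mass: "(LINT x|lebesgue. \<rho> x) = 1" using mass_le' by simp
  have g_ae: "AE x in lebesgue. g x = density_grad b \<rho> x" using grad by eventually_elim simp
  have gL2: "in_L2 (density_grad b \<rho>)" by (rule in_L2_cong_AE[OF g2 g_ae])
  have dc: "density_class \<gamma> b \<rho>"
    unfolding density_class_def
  proof (intro conjI allI impI)
    show "weakly_differentiable \<rho>" if "b \<noteq> 0" using wg[OF that] unfolding weakly_differentiable_def by blast
    show "in_L2 (weak_grad \<rho>)" if "b \<noteq> 0" using gL2 that by (simp add: density_grad_def)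
  qed (rule \<rho>0 i\<rho> mass Vi \<rho>2)+
  have "density_energy \<gamma> a b \<rho> = (LINT x|lebesgue. e \<rho> g x)"
  proof -
    have i: "integrable lebesgue (\<lambda>x. a / 2 * (norm (\<rho> x))\<^sup>2)" "integrable lebesgue (\<lambda>x. b / 2 * (norm (g x))\<^sup>2)"
      by (intro integrable_mult_right in_L2_integrable \<rho>2 g2)+
    have "(LINT x|lebesgue. (norm (density_grad b \<rho> x))\<^sup>2) = (LINT x|lebesgue. (norm (g x))\<^sup>2)"
      by (rule integral_lebesgue_cong_AE) (use grad in eventually_elim, simp)
    then show ?thesis
      unfolding e_def density_energy_def
      using Bochner_Integration.integral_add[OF Bochner_Integration.integrable_add[OF Vi i(1)] i(2)]
        Bochner_Integration.integral_add[OF Vi i(1)] by simp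
  qed
  also have "\<dots> \<le> I"
    using eI nn_integral_eq_integral[OF ei] e_nonneg[OF \<rho>0] I0 by (simp add: ennreal_le_iff)
  finally show ?thesis using that[OF dc] I_le order_trans by blast
qed

text \<open>For \<open>a = 0\<close> the form does not contain the L2 distance, so coercivity is
  used to bring that distance below every positive bound.\<close>

lemma density_minimizer_unique:
  fixes \<rho> \<sigma> :: "real^'n \<Rightarrow> real"
  assumes a: "0 \<le> a" and b: "0 \<le> b" and ab: "0 < a + b"
    and \<rho>: "density_class \<gamma> b \<rho>" and \<sigma>: "density_class \<gamma> b \<sigma>"
    and min: "\<And>\<mu>. density_class \<gamma> b \<mu> \<Longrightarrow> density_energy \<gamma> a b \<rho> \<le> density_energy \<gamma> a b \<mu>"
    and le: "density_energy \<gamma> a b \<sigma> \<le> density_energy \<gamma> a b \<rho>"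
  shows "AE x in lebesgue. \<rho> x = \<sigma> x"
proof -
  have d: "density_dist_sq a b \<rho> \<sigma> \<le> 0"
    using density_dist_sq_le_excess[OF \<rho> \<sigma>, of "density_energy \<gamma> a b \<rho>" a] min le by simp
  have "(LINT x|lebesgue. (norm (\<rho> x - \<sigma> x))\<^sup>2) \<le> 0"
  proof (rule field_le_epsilon)
    fix \<omega> :: real assume "0 < \<omega>"
    obtain \<eta> where \<eta>: "0 < \<eta>" and co: "\<And>\<gamma> (\<rho> :: real^'n \<Rightarrow> real) \<sigma>. density_class \<gamma> b \<rho> \<Longrightarrow>
        density_class \<gamma> b \<sigma> \<Longrightarrow> density_dist_sq a b \<rho> \<sigma> \<le> \<eta> \<Longrightarrow>
        (LINT x|lebesgue. (norm (\<rho> x - \<sigma> x))\<^sup>2) \<le> \<omega> \<and>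
        (LINT x|lebesgue. (norm (density_grad b \<rho> x - density_grad b \<sigma> x))\<^sup>2) \<le> \<omega>"
      by (rule density_dist_sq_coercive[OF a b ab \<open>0 < \<omega>\<close>]) (erule that, blast)
    from co[OF \<rho> \<sigma>] \<eta> show "(LINT x|lebesgue. (norm (\<rho> x - \<sigma> x))\<^sup>2) \<le> 0 + \<omega>" using d by simp
  qed
  moreover have "0 \<le> (LINT x|lebesgue. (norm (\<rho> x - \<sigma> x))\<^sup>2)" by simp
  ultimately have "(LINT x|lebesgue. (norm (\<rho> x - \<sigma> x))\<^sup>2) = 0" by linarith
  then have "AE x in lebesgue. (norm (\<rho> x - \<sigma> x))\<^sup>2 = 0"
    using in_L2_integrable[OF in_L2_diff[OF density_classD(5)[OF \<rho>] density_classD(5)[OF \<sigma>]]]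
    by (subst (asm) integral_nonneg_eq_0_iff_AE) auto
  then show ?thesis by eventually_elim simp
qed

text \<open>The midpoint identity turns convergence of the energies into convergence in the norm.\<close>

lemma density_energy_tendsto_imp:
  fixes \<rho> :: "real^'n \<Rightarrow> real"
  assumes a: "0 \<le> a" and b: "0 \<le> b" and ab: "0 < a + b"
    and \<rho>: "density_class \<gamma> b \<rho>"
    and min: "\<And>\<mu>. density_class \<gamma> b \<mu> \<Longrightarrow> density_energy \<gamma> a b \<rho> \<le> density_energy \<gamma> a b \<mu>"
    and \<sigma>: "\<forall>\<^sub>F i in F. density_class \<gamma> b (\<sigma> i)"
    and lim: "\<And>\<eta>. 0 < \<eta> \<Longrightarrow> \<forall>\<^sub>F i in F. density_energy \<gamma> a b (\<sigma> i) \<le> density_energy \<gamma> a b \<rho> + \<eta>"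
  shows "((\<lambda>i. LINT x|lebesgue. (norm (\<sigma> i x - \<rho> x))\<^sup>2) \<longlongrightarrow> 0) F"
    and "((\<lambda>i. LINT x|lebesgue. (norm (density_grad b (\<sigma> i) x - density_grad b \<rho> x))\<^sup>2) \<longlongrightarrow> 0) F"
proof -
  have *: "\<forall>\<^sub>F i in F. (LINT x|lebesgue. (norm (\<sigma> i x - \<rho> x))\<^sup>2) \<le> \<omega> \<and>
      (LINT x|lebesgue. (norm (density_grad b (\<sigma> i) x - density_grad b \<rho> x))\<^sup>2) \<le> \<omega>" if \<omega>: "0 < \<omega>" for \<omega>
  proof -
    obtain \<eta> where \<eta>: "0 < \<eta>" and co: "\<And>\<gamma> (\<rho> :: real^'n \<Rightarrow> real) \<sigma>. density_class \<gamma> b \<rho> \<Longrightarrow>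
        density_class \<gamma> b \<sigma> \<Longrightarrow> density_dist_sq a b \<rho> \<sigma> \<le> \<eta> \<Longrightarrow>
        (LINT x|lebesgue. (norm (\<rho> x - \<sigma> x))\<^sup>2) \<le> \<omega> \<and>
        (LINT x|lebesgue. (norm (density_grad b \<rho> x - density_grad b \<sigma> x))\<^sup>2) \<le> \<omega>"
      by (rule density_dist_sq_coercive[OF a b ab \<omega>]) (erule that, blast)
    \<comment> \<open>The form is at most four times the excess over the minimum.\<close>
    have "0 < \<eta> / 4" using \<eta> by simp
    from \<sigma> lim[OF this] show ?thesis
    proof eventually_elim
      case (elim i)
      have "density_dist_sq a b (\<sigma> i) \<rho> \<le> \<eta>"
        using density_dist_sq_le_excess[OF elim(1) \<rho>, of "density_energy \<gamma> a b \<rho>" a] min elim(2) by simp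
      then show ?case by (rule co[OF elim(1) \<rho>])
    qed
  qed
  have "\<forall>\<^sub>F i in F. dist (LINT x|lebesgue. (norm (\<sigma> i x - \<rho> x))\<^sup>2) 0 < \<omega>"
    "\<forall>\<^sub>F i in F. dist (LINT x|lebesgue. (norm (density_grad b (\<sigma> i) x - density_grad b \<rho> x))\<^sup>2) 0 < \<omega>"
    if "0 < \<omega>" for \<omega>
    using *[of "\<omega> / 2"] that by (auto elim!: eventually_mono)
  then show "((\<lambda>i. LINT x|lebesgue. (norm (\<sigma> i x - \<rho> x))\<^sup>2) \<longlongrightarrow> 0) F"
    "((\<lambda>i. LINT x|lebesgue. (norm (density_grad b (\<sigma> i) x - density_grad b \<rho> x))\<^sup>2) \<longlongrightarrow> 0) F"
    by (auto intro: tendstoI)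
qed

section \<open>Wave functions and their densities\<close>

lemma mod_sq_nonneg: "0 \<le> mod_sq \<phi> x"
  unfolding mod_sq_def by simp

lemma norm_power4: "(norm (\<phi> x)) ^ 4 = (mod_sq \<phi> x)\<^sup>2"
  unfolding mod_sq_def by (simp flip: power_mult)

lemma mod_sq_measurable:
  "\<phi> \<in> borel_measurable lebesgue \<Longrightarrow> mod_sq \<phi> \<in> borel_measurable lebesgue"
  unfolding mod_sq_def[abs_def] by measurable

lemma in_L2_iff_mod_sq:
  "in_L2 \<phi> \<longleftrightarrow> \<phi> \<in> borel_measurable lebesgue \<and> integrable lebesgue (mod_sq \<phi>)"
  unfolding in_L2_def mod_sq_def[abs_def] by simp

lemma L2_norm_eq_1_iff: "L2_norm \<phi> = 1 \<longleftrightarrow> (LINT x|lebesgue. mod_sq \<phi> x) = 1"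
  unfolding L2_norm_def mod_sq_def by simp

lemma in_L2_real_iff:
  "in_L2 (\<rho> :: real^'n \<Rightarrow> real) \<longleftrightarrow> \<rho> \<in> borel_measurable lebesgue \<and> integrable lebesgue (\<lambda>x. (\<rho> x)\<^sup>2)"
  unfolding in_L2_def by simp

lemma admissible1_iff:
  "\<phi> \<in> admissible1 \<gamma> \<longleftrightarrow> \<phi> \<in> borel_measurable lebesgue \<and> density_class \<gamma> 0 (mod_sq \<phi>)"
  unfolding admissible1_def density_class_def in_L2_iff_mod_sq L2_norm_eq_1_iff in_L2_real_iff norm_power4
  by (auto simp: mod_sq_nonneg mod_sq_measurable simp flip: mod_sq_def)

text \<open>\<open>density_class\<close> depends on \<open>b\<close> only through
  \<open>b \<noteq> 0\<close>, so the same set serves for every positive limit of the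
  quotient.\<close>

lemma admissible2_iff:
  "b \<noteq> 0 \<Longrightarrow> \<phi> \<in> admissible2 \<gamma> \<longleftrightarrow> \<phi> \<in> borel_measurable lebesgue \<and> density_class \<gamma> b (mod_sq \<phi>)"
  unfolding admissible2_def density_class_def in_L2_iff_mod_sq L2_norm_eq_1_iff in_L2_real_iff norm_power4
  by (auto simp: mod_sq_nonneg mod_sq_measurable simp flip: mod_sq_def)

text \<open>\<open>admissible3\<close> does not mention the fourth power of the wave function;
  Nash's inequality at unit width supplies it.\<close>

lemma integrable_square_of_gradient:
  fixes f :: "real^'n \<Rightarrow> real"
  assumes "weakly_differentiable f" "integrable lebesgue f" "in_L2 (weak_grad f)"
  shows "integrable lebesgue (\<lambda>x. (f x)\<^sup>2)"
proof -
  obtain C M and K :: "real^'n \<Rightarrow> real" and D where "0 \<le> M" "smoothing_kernel C M 1 K D"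
    using unit_smoothing_kernel by blast
  from nash_L2(1)[OF has_weak_gradient_weak_grad[OF assms(1)] assms(2,3) this(2,1)] show ?thesis .
qed

lemma admissible3_iff:
  assumes "b \<noteq> 0"
  shows "\<phi> \<in> admissible3 \<gamma> \<longleftrightarrow> \<phi> \<in> borel_measurable lebesgue \<and> density_class \<gamma> b (mod_sq \<phi>)"
  unfolding admissible3_def density_class_def in_L2_iff_mod_sq L2_norm_eq_1_iff in_L2_real_iff
  using assms integrable_square_of_gradient[of "mod_sq \<phi>"]
  by (auto simp: mod_sq_nonneg mod_sq_measurable simp flip: mod_sq_def)

text \<open>When \<open>b = 0\<close> the arbitrary value of \<open>weak_grad\<close> is multiplied
  by 0, so the convention in \<open>density_grad\<close> leaves no trace in the energy.\<close>

lemma density_energy_weak_grad: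
  "density_energy \<gamma> a b \<rho> = (LINT x|lebesgue. harmonic \<gamma> x * \<rho> x)
     + a / 2 * (LINT x|lebesgue. (\<rho> x)\<^sup>2) + b / 2 * (LINT x|lebesgue. (norm (weak_grad \<rho> x))\<^sup>2)"
  unfolding density_energy_def density_grad_def by simp

lemma density_class_integrable:
  assumes "density_class \<gamma> b \<rho>"
  shows "integrable lebesgue (\<lambda>x. harmonic \<gamma> x * \<rho> x)" "integrable lebesgue (\<lambda>x. (\<rho> x)\<^sup>2)"
    "b \<noteq> 0 \<Longrightarrow> integrable lebesgue (\<lambda>x. (norm (weak_grad \<rho> x))\<^sup>2)"
  using assms unfolding density_class_def in_L2_def by auto

lemma energy1_eq:
  assumes "density_class \<gamma> 0 (mod_sq \<phi>)"
  shows "energy1 \<gamma> \<phi> = density_energy \<gamma> 1 0 (mod_sq \<phi>)"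
  unfolding energy1_def density_energy_weak_grad norm_power4
  using density_class_integrable[OF assms] by (simp flip: mod_sq_def)

lemma energy2_eq:
  assumes "density_class \<gamma> b (mod_sq \<phi>)" "b \<noteq> 0"
  shows "energy2 \<gamma> b \<phi> = density_energy \<gamma> 1 b (mod_sq \<phi>)"
  unfolding energy2_def density_energy_weak_grad norm_power4
  using density_class_integrable[OF assms(1)] assms(2) by (simp flip: mod_sq_def)

lemma energy3_eq:
  assumes "density_class \<gamma> 1 (mod_sq \<phi>)"
  shows "energy3 \<gamma> \<phi> = density_energy \<gamma> 0 1 (mod_sq \<phi>)"
  unfolding energy3_def density_energy_weak_grad
  using density_class_integrable[OF assms] by (simp flip: mod_sq_def)

lemma mod_sq_sqrt: "(\<And>x. 0 \<le> \<rho> x) \<Longrightarrow> mod_sq (\<lambda>x. complex_of_real (sqrt (\<rho> x))) = \<rho>"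
  unfolding mod_sq_def by auto

text \<open>The functional sees a wave function only through its density, and a nonnegative wave
  function is determined by its density. So existence and uniqueness carry over from
  densities.\<close>

lemma unique_nonneg_minimizer_sqrt:
  fixes \<rho> :: "real^'n \<Rightarrow> real"
  assumes a: "0 \<le> a" and b: "0 \<le> b" and ab: "0 < a + b"
    and A: "\<And>\<phi>. \<phi> \<in> A \<longleftrightarrow> \<phi> \<in> borel_measurable lebesgue \<and> density_class \<gamma> b (mod_sq \<phi>)"
    and E: "\<And>\<phi>. density_class \<gamma> b (mod_sq \<phi>) \<Longrightarrow> E \<phi> = density_energy \<gamma> a b (mod_sq \<phi>)"
    and \<rho>: "density_class \<gamma> b \<rho>"
    and min: "\<And>\<sigma>. density_class \<gamma> b \<sigma> \<Longrightarrow> density_energy \<gamma> a b \<rho> \<le> density_energy \<gamma> a b \<sigma>"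
  shows "unique_nonneg_minimizer E A (\<lambda>x. complex_of_real (sqrt (\<rho> x)))"
proof -
  let ?\<phi> = "\<lambda>x. complex_of_real (sqrt (\<rho> x))"
  have m: "mod_sq ?\<phi> = \<rho>" by (rule mod_sq_sqrt) (rule density_classD(1)[OF \<rho>])
  have "(\<lambda>t. complex_of_real (sqrt t)) \<in> borel_measurable borel"
    by (intro borel_measurable_continuous_onI continuous_intros)
  then have "?\<phi> \<in> borel_measurable lebesgue"
    by (rule measurable_compose[OF in_L2_measurable[OF density_classD(5)[OF \<rho>]]])
  then have \<phi>A: "?\<phi> \<in> A" unfolding A m using \<rho> by blast
  have E\<phi>: "E ?\<phi> = density_energy \<gamma> a b \<rho>" using E[of ?\<phi>] \<rho> unfolding m by simp
  have "E ?\<phi> \<le> E \<psi>" if "\<psi> \<in> A" for \<psi>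
    using that min unfolding A E\<phi> by (simp add: E)
  then have argmin: "is_arg_min E (\<lambda>\<psi>. \<psi> \<in> A) ?\<phi>"
    unfolding is_arg_min_def using \<phi>A by (auto simp: not_less)
  have uniq: "AE x in lebesgue. \<psi> x = ?\<phi> x" if \<psi>: "is_arg_min E (\<lambda>\<psi>. \<psi> \<in> A) \<psi>" "nonneg_ae \<psi>" for \<psi>
  proof -
    have \<psi>A: "\<psi> \<in> A" and le: "E \<psi> \<le> E ?\<phi>"
      using \<psi>(1) \<phi>A unfolding is_arg_min_def by (auto simp: not_less)
    then have "AE x in lebesgue. \<rho> x = mod_sq \<psi> x"
      using E[of \<psi>] E\<phi> unfolding A
      by (intro density_minimizer_unique[OF a b ab \<rho> _ min]) auto
    with \<psi>(2) show ?thesis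
      unfolding nonneg_ae_def
    proof eventually_elim
      case (elim x)
      then have x: "\<psi> x = complex_of_real (Re (\<psi> x))" by (simp add: complex_is_Real_iff complex_eq_iff)
      then have "norm (\<psi> x) = \<bar>Re (\<psi> x)\<bar>" by (metis norm_of_real)
      then have "sqrt (\<rho> x) = Re (\<psi> x)" using elim by (simp add: mod_sq_def)
      then show ?case using x by simp
    qed
  qed
  have "nonneg_ae ?\<phi>" unfolding nonneg_ae_def using density_classD(1)[OF \<rho>] by simp
  then show ?thesis
    unfolding unique_nonneg_minimizer_def using argmin uniq by blast
qed

section \<open>The full energy and its admissible set in terms of the density\<close>

lemma in_H1_integrable:
  "in_H1 \<phi> \<Longrightarrow> integrable lebesgue (\<lambda>x. (norm (weak_grad \<phi> x))\<^sup>2)"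
  unfolding in_H1_def in_L2_def by blast

lemma energy_density_eq:
  "energy_density \<gamma> \<beta> \<delta> \<phi> x = 1/2 * (norm (weak_grad \<phi> x))\<^sup>2 + harmonic \<gamma> x * mod_sq \<phi> x
     + \<beta>/2 * (mod_sq \<phi> x)\<^sup>2 + \<delta>/2 * (norm (weak_grad (mod_sq \<phi>) x))\<^sup>2"
  unfolding energy_density_def norm_power4 by (simp add: mod_sq_def)

lemma energy_density_integrable:
  assumes "in_H1 \<phi>" "density_class \<gamma> 1 (mod_sq \<phi>)"
  shows "integrable lebesgue (energy_density \<gamma> \<beta> \<delta> \<phi>)"
    and "energy \<gamma> \<beta> \<delta> \<phi> = (LINT x|lebesgue. (norm (weak_grad \<phi> x))\<^sup>2) / 2 + density_energy \<gamma> \<beta> \<delta> (mod_sq \<phi>)"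
proof -
  note i = in_H1_integrable[OF assms(1)] density_class_integrable[OF assms(2)]
  show "integrable lebesgue (energy_density \<gamma> \<beta> \<delta> \<phi>)"
    unfolding energy_density_eq[abs_def] using i by simp
  show "energy \<gamma> \<beta> \<delta> \<phi> = (LINT x|lebesgue. (norm (weak_grad \<phi> x))\<^sup>2) / 2 + density_energy \<gamma> \<beta> \<delta> (mod_sq \<phi>)"
    unfolding energy_def energy_density_eq density_energy_weak_grad using i by simp
qed

text \<open>All terms of the energy density are nonnegative, so each is bounded by a multiple of the
  sum. The right-hand side is free of \<beta> and \<delta>, hence one comparison state serves for
  all of them.\<close>

lemma admissible_iff:
  assumes \<beta>: "0 < \<beta>" and \<delta>: "0 < \<delta>"
  shows "\<phi> \<in> admissible \<gamma> \<beta> \<delta> \<longleftrightarrow> in_H1 \<phi> \<and> density_class \<gamma> 1 (mod_sq \<phi>)"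
proof
  assume \<phi>: "\<phi> \<in> admissible \<gamma> \<beta> \<delta>"
  then have H1: "in_H1 \<phi>" and V: "integrable lebesgue (\<lambda>x. harmonic \<gamma> x * mod_sq \<phi> x)"
    and L: "L2_norm \<phi> = 1" and wd: "weakly_differentiable (mod_sq \<phi>)"
    and ed: "integrable lebesgue (energy_density \<gamma> \<beta> \<delta> \<phi>)"
    unfolding admissible_def mod_sq_def by auto
  have L2: "in_L2 \<phi>" using H1 unfolding in_H1_def by blast
  have m: "mod_sq \<phi> \<in> borel_measurable lebesgue" "weak_grad (mod_sq \<phi>) \<in> borel_measurable lebesgue"
    using has_weak_gradient_measurable[OF has_weak_gradient_weak_grad[OF wd]] by auto
  have nn: "0 \<le> 1/2 * (norm (weak_grad \<phi> x))\<^sup>2" "0 \<le> harmonic \<gamma> x * mod_sq \<phi> x"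
     "0 \<le> \<beta>/2 * (mod_sq \<phi> x)\<^sup>2" "0 \<le> \<delta>/2 * (norm (weak_grad (mod_sq \<phi>) x))\<^sup>2" for x
    using \<beta> \<delta> harmonic_nonneg[of \<gamma> x] mod_sq_nonneg[of \<phi> x] by simp_all
  have "in_L2 (mod_sq \<phi>)"
  proof (rule in_L2_bound[OF m(1)])
    show "integrable lebesgue (\<lambda>x. 2 / \<beta> * energy_density \<gamma> \<beta> \<delta> \<phi> x)" using ed by simp
    show "(norm (mod_sq \<phi> x))\<^sup>2 \<le> 2 / \<beta> * energy_density \<gamma> \<beta> \<delta> \<phi> x" for x
    proof -
      have "\<beta>/2 * (mod_sq \<phi> x)\<^sup>2 \<le> energy_density \<gamma> \<beta> \<delta> \<phi> x"
        unfolding energy_density_eq using nn[of x] by linarith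
      then have "2 / \<beta> * (\<beta>/2 * (mod_sq \<phi> x)\<^sup>2) \<le> 2 / \<beta> * energy_density \<gamma> \<beta> \<delta> \<phi> x"
        using \<beta> by (intro mult_left_mono) auto
      then show ?thesis using \<beta> by simp
    qed
  qed
  moreover have "in_L2 (weak_grad (mod_sq \<phi>))"
  proof (rule in_L2_bound[OF m(2)])
    show "integrable lebesgue (\<lambda>x. 2 / \<delta> * energy_density \<gamma> \<beta> \<delta> \<phi> x)" using ed by simp
    show "(norm (weak_grad (mod_sq \<phi>) x))\<^sup>2 \<le> 2 / \<delta> * energy_density \<gamma> \<beta> \<delta> \<phi> x" for x
    proof -
      have "\<delta>/2 * (norm (weak_grad (mod_sq \<phi>) x))\<^sup>2 \<le> energy_density \<gamma> \<beta> \<delta> \<phi> x"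
        unfolding energy_density_eq using nn[of x] by linarith
      then have "2 / \<delta> * (\<delta>/2 * (norm (weak_grad (mod_sq \<phi>) x))\<^sup>2) \<le> 2 / \<delta> * energy_density \<gamma> \<beta> \<delta> \<phi> x"
        using \<delta> by (intro mult_left_mono) auto
      then show ?thesis using \<delta> by simp
    qed
  qed
  ultimately show "in_H1 \<phi> \<and> density_class \<gamma> 1 (mod_sq \<phi>)"
    unfolding density_class_def using H1 V wd L L2 by (simp add: mod_sq_nonneg L2_norm_eq_1_iff in_L2_iff_mod_sq)
next
  assume \<phi>: "in_H1 \<phi> \<and> density_class \<gamma> 1 (mod_sq \<phi>)"
  then have "integrable lebesgue (energy_density \<gamma> \<beta> \<delta> \<phi>)"
    using energy_density_integrable(1) by blast
  moreover have "integrable lebesgue (\<lambda>x. harmonic \<gamma> x * (norm (\<phi> x))\<^sup>2)"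
    using \<phi> unfolding density_class_def mod_sq_def by blast
  ultimately show "\<phi> \<in> admissible \<gamma> \<beta> \<delta>"
    using \<phi> unfolding admissible_def density_class_def by (simp add: L2_norm_eq_1_iff)
qed

section \<open>Rescaling\<close>

lemma powr_half_power2:
  assumes "0 < \<epsilon>" shows "(\<epsilon> powr (- real n / 2))\<^sup>2 = inverse (\<epsilon> ^ n)"
proof -
  have "(\<epsilon> powr (- real n / 2))\<^sup>2 = \<epsilon> powr (- real n / 2 + - real n / 2)"
    unfolding power2_eq_square powr_add ..
  also have "- real n / 2 + - real n / 2 = - real n" by simp
  also have "\<epsilon> powr (- real n) = inverse (\<epsilon> ^ n)"
    using assms by (simp only: powr_minus powr_realpow)
  finally show ?thesis .
qed

lemma mod_sq_rescale:
  fixes \<phi> :: "real^'n \<Rightarrow> complex"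
  assumes "0 < \<epsilon>"
  shows "mod_sq (rescale \<epsilon> \<phi>) = (\<lambda>x. inverse (\<epsilon> ^ CARD('n)) * mod_sq \<phi> (inverse \<epsilon> *\<^sub>R x))"
proof
  fix x :: "real^'n"
  show "mod_sq (rescale \<epsilon> \<phi>) x = inverse (\<epsilon> ^ CARD('n)) * mod_sq \<phi> (inverse \<epsilon> *\<^sub>R x)"
    unfolding mod_sq_def rescale_def norm_scaleR power_mult_distrib power2_abs powr_half_power2[OF assms]
    by simp
qed

lemma integral_dilation:
  fixes h :: "real^'n \<Rightarrow> 'b::euclidean_space"
  assumes "0 < \<epsilon>" "h \<in> borel_measurable lebesgue"
  shows "(LINT x|lebesgue. h (inverse \<epsilon> *\<^sub>R x)) = \<epsilon> ^ CARD('n) *\<^sub>R (LINT x|lebesgue. h x)"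
    and "integrable lebesgue (\<lambda>x. h (inverse \<epsilon> *\<^sub>R x)) \<longleftrightarrow> integrable lebesgue h"
proof -
  have e: "inverse \<epsilon> \<noteq> 0" using assms(1) by simp
  show "(LINT x|lebesgue. h (inverse \<epsilon> *\<^sub>R x)) = \<epsilon> ^ CARD('n) *\<^sub>R (LINT x|lebesgue. h x)"
    using integral_lebesgue_affine(1)[OF e assms(2), of 0] assms(1) by (simp add: power_inverse)
  show "integrable lebesgue (\<lambda>x. h (inverse \<epsilon> *\<^sub>R x)) \<longleftrightarrow> integrable lebesgue h"
    using integral_lebesgue_affine(2)[OF e assms(2), of 0] by simp
qed

lemma L2_dilation:
  fixes h :: "real^'n \<Rightarrow> 'b::euclidean_space"
  assumes \<epsilon>: "0 < \<epsilon>" and h: "in_L2 h"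
  shows "in_L2 (\<lambda>x. c *\<^sub>R h (inverse \<epsilon> *\<^sub>R x))"
    and "(LINT x|lebesgue. (norm (c *\<^sub>R h (inverse \<epsilon> *\<^sub>R x)))\<^sup>2) = c\<^sup>2 * \<epsilon> ^ CARD('n) * (LINT x|lebesgue. (norm (h x))\<^sup>2)"
proof -
  have hm: "h \<in> borel_measurable lebesgue" by (rule in_L2_measurable[OF h])
  then have m2: "(\<lambda>x. (norm (h x))\<^sup>2) \<in> borel_measurable lebesgue" by measurable
  have "(\<lambda>x. inverse \<epsilon> *\<^sub>R x + 0) \<in> (lebesgue :: (real^'n) measure) \<rightarrow>\<^sub>M lebesgue"
    using \<epsilon> by (intro affine_measurable_lebesgue) simp
  from measurable_compose[OF this hm] have "(\<lambda>x. h (inverse \<epsilon> *\<^sub>R x)) \<in> borel_measurable lebesgue" by simp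
  then show "in_L2 (\<lambda>x. c *\<^sub>R h (inverse \<epsilon> *\<^sub>R x))"
    unfolding in_L2_def using integral_dilation(2)[OF \<epsilon> m2] in_L2_integrable[OF h]
    by (simp add: power_mult_distrib)
  show "(LINT x|lebesgue. (norm (c *\<^sub>R h (inverse \<epsilon> *\<^sub>R x)))\<^sup>2) = c\<^sup>2 * \<epsilon> ^ CARD('n) * (LINT x|lebesgue. (norm (h x))\<^sup>2)"
    using integral_dilation(1)[OF \<epsilon> m2] by (simp add: power_mult_distrib mult.assoc)
qed

lemma weak_gradient_dilation:
  fixes u :: "real^'n \<Rightarrow> 'b::euclidean_space"
  assumes \<epsilon>: "0 < \<epsilon>" and u: "weakly_differentiable u" and g: "in_L2 (weak_grad u)"
  shows "weakly_differentiable (\<lambda>x. c *\<^sub>R u (inverse \<epsilon> *\<^sub>R x))"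
    and "in_L2 (weak_grad (\<lambda>x. c *\<^sub>R u (inverse \<epsilon> *\<^sub>R x)))"
    and "(LINT x|lebesgue. (norm (weak_grad (\<lambda>x. c *\<^sub>R u (inverse \<epsilon> *\<^sub>R x)) x))\<^sup>2) =
      (c * inverse \<epsilon>)\<^sup>2 * \<epsilon> ^ CARD('n) * (LINT x|lebesgue. (norm (weak_grad u x))\<^sup>2)"
proof -
  have "inverse \<epsilon> \<noteq> 0" using \<epsilon> by simp
  from has_weak_gradient_scale[OF has_weak_gradient_weak_grad[OF u] this]
  have 1: "has_weak_gradient (\<lambda>x. u (inverse \<epsilon> *\<^sub>R x)) (\<lambda>x. inverse \<epsilon> *\<^sub>R weak_grad u (inverse \<epsilon> *\<^sub>R x))" .
  have wg: "has_weak_gradient (\<lambda>x. c *\<^sub>R u (inverse \<epsilon> *\<^sub>R x)) (\<lambda>x. (c * inverse \<epsilon>) *\<^sub>R weak_grad u (inverse \<epsilon> *\<^sub>R x))"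
    using has_weak_gradient_lincomb[OF 1 1, of c 0] by simp
  then show "weakly_differentiable (\<lambda>x. c *\<^sub>R u (inverse \<epsilon> *\<^sub>R x))"
    unfolding weakly_differentiable_def by blast
  note d = L2_dilation[OF \<epsilon> g, of "c * inverse \<epsilon>"]
  show "in_L2 (weak_grad (\<lambda>x. c *\<^sub>R u (inverse \<epsilon> *\<^sub>R x)))" by (rule in_L2_weak_grad[OF wg d(1)])
  have "(LINT x|lebesgue. (norm (weak_grad (\<lambda>x. c *\<^sub>R u (inverse \<epsilon> *\<^sub>R x)) x))\<^sup>2) =
      (LINT x|lebesgue. (norm ((c * inverse \<epsilon>) *\<^sub>R weak_grad u (inverse \<epsilon> *\<^sub>R x)))\<^sup>2)"
    by (rule integral_lebesgue_cong_AE) (use weak_grad_AE[OF wg] in eventually_elim, simp)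
  then show "(LINT x|lebesgue. (norm (weak_grad (\<lambda>x. c *\<^sub>R u (inverse \<epsilon> *\<^sub>R x)) x))\<^sup>2) =
      (c * inverse \<epsilon>)\<^sup>2 * \<epsilon> ^ CARD('n) * (LINT x|lebesgue. (norm (weak_grad u x))\<^sup>2)"
    unfolding d(2) .
qed

lemma rescale_in_H1:
  fixes \<phi> :: "real^'n \<Rightarrow> complex"
  assumes \<epsilon>: "0 < \<epsilon>" and \<phi>: "in_H1 \<phi>"
  shows "in_H1 (rescale \<epsilon> \<phi>)"
    and "(LINT x|lebesgue. (norm (weak_grad (rescale \<epsilon> \<phi>) x))\<^sup>2) =
      inverse (\<epsilon>\<^sup>2) * (LINT x|lebesgue. (norm (weak_grad \<phi> x))\<^sup>2)"
proof -
  let ?c = "\<epsilon> powr (- real CARD('n) / 2)"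
  have r: "rescale \<epsilon> \<phi> = (\<lambda>x. ?c *\<^sub>R \<phi> (inverse \<epsilon> *\<^sub>R x))"
    unfolding rescale_def by simp
  have H: "in_L2 \<phi>" "weakly_differentiable \<phi>" "in_L2 (weak_grad \<phi>)" using \<phi> unfolding in_H1_def by auto
  note w = weak_gradient_dilation[OF \<epsilon> H(2,3), of ?c]
  show "in_H1 (rescale \<epsilon> \<phi>)"
    unfolding in_H1_def r using L2_dilation(1)[OF \<epsilon> H(1)] w(1,2) by blast
  have "?c\<^sup>2 = inverse (\<epsilon> ^ CARD('n))" by (rule powr_half_power2[OF \<epsilon>])
  then have "(?c * inverse \<epsilon>)\<^sup>2 * \<epsilon> ^ CARD('n) = inverse (\<epsilon>\<^sup>2)"
    using \<epsilon> by (simp add: power_mult_distrib power_inverse)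
  then show "(LINT x|lebesgue. (norm (weak_grad (rescale \<epsilon> \<phi>) x))\<^sup>2) =
      inverse (\<epsilon>\<^sup>2) * (LINT x|lebesgue. (norm (weak_grad \<phi> x))\<^sup>2)"
    unfolding r w(3) by simp
qed

lemma harmonic_scale: "harmonic \<gamma> (c *\<^sub>R x) = c\<^sup>2 * harmonic \<gamma> x"
  unfolding harmonic_def by (simp add: power_mult_distrib sum_distrib_left mult.left_commute)

lemma rescale_density:
  fixes \<phi> :: "real^'n \<Rightarrow> complex"
  assumes \<epsilon>: "0 < \<epsilon>" and \<phi>: "density_class \<gamma> 1 (mod_sq \<phi>)"
  shows "density_class \<gamma> 1 (mod_sq (rescale \<epsilon> \<phi>))"
    and "density_energy \<gamma> a b (mod_sq (rescale \<epsilon> \<phi>)) =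
      \<epsilon>\<^sup>2 * (LINT x|lebesgue. harmonic \<gamma> x * mod_sq \<phi> x)
      + a / 2 * (inverse (\<epsilon> ^ CARD('n)) * (LINT x|lebesgue. (mod_sq \<phi> x)\<^sup>2))
      + b / 2 * (inverse (\<epsilon> ^ (CARD('n) + 2)) * (LINT x|lebesgue. (norm (weak_grad (mod_sq \<phi>) x))\<^sup>2))"
proof -
  let ?n = "CARD('n)" and ?\<rho> = "mod_sq \<phi>"
  let ?c = "inverse (\<epsilon> ^ ?n)"
  note C = density_classD[OF \<phi>]
  have wd: "weakly_differentiable ?\<rho>" "in_L2 (weak_grad ?\<rho>)" using \<phi> unfolding density_class_def by auto
  have r: "mod_sq (rescale \<epsilon> \<phi>) = (\<lambda>x. ?c *\<^sub>R ?\<rho> (inverse \<epsilon> *\<^sub>R x))"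
    unfolding mod_sq_rescale[OF \<epsilon>] by simp
  have mV: "(\<lambda>x. harmonic \<gamma> x * ?\<rho> x) \<in> borel_measurable lebesgue" by (rule borel_measurable_integrable[OF C(4)])
  have V_eq: "harmonic \<gamma> x * mod_sq (rescale \<epsilon> \<phi>) x = (?c * \<epsilon>\<^sup>2) * (harmonic \<gamma> (inverse \<epsilon> *\<^sub>R x) * ?\<rho> (inverse \<epsilon> *\<^sub>R x))" for x
    unfolding r harmonic_scale using \<epsilon> by (simp add: power_inverse field_simps)
  note w = weak_gradient_dilation[OF \<epsilon> wd, of ?c] and l = L2_dilation[OF \<epsilon> C(5), of ?c]
  have sq: "?c\<^sup>2 * \<epsilon> ^ ?n = ?c" using \<epsilon> by (simp add: power2_eq_square)
  have sq': "(?c * inverse \<epsilon>)\<^sup>2 * \<epsilon> ^ ?n = inverse (\<epsilon> ^ (?n + 2))"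
    using \<epsilon> by (simp add: power_mult_distrib power_add power2_eq_square)
  show "density_class \<gamma> 1 (mod_sq (rescale \<epsilon> \<phi>))"
    unfolding density_class_def
  proof (intro conjI allI impI)
    show "0 \<le> mod_sq (rescale \<epsilon> \<phi>) x" for x by (rule mod_sq_nonneg)
    have m: "?\<rho> \<in> borel_measurable lebesgue" by (rule borel_measurable_integrable[OF C(2)])
    show "integrable lebesgue (mod_sq (rescale \<epsilon> \<phi>))"
      unfolding r using integral_dilation(2)[OF \<epsilon> m] C(2) by simp
    show "(LINT x|lebesgue. mod_sq (rescale \<epsilon> \<phi>) x) = 1"
      unfolding r using integral_dilation(1)[OF \<epsilon> m] C(3) \<epsilon> by simp
    show "integrable lebesgue (\<lambda>x. harmonic \<gamma> x * mod_sq (rescale \<epsilon> \<phi>) x)"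
      unfolding V_eq using integral_dilation(2)[OF \<epsilon> mV] C(4) by (intro integrable_mult_right) simp
    show "in_L2 (mod_sq (rescale \<epsilon> \<phi>))" unfolding r by (rule l(1))
    show "weakly_differentiable (mod_sq (rescale \<epsilon> \<phi>))" unfolding r by (rule w(1))
    show "in_L2 (weak_grad (mod_sq (rescale \<epsilon> \<phi>)))" unfolding r by (rule w(2))
  qed
  have "(LINT x|lebesgue. harmonic \<gamma> x * mod_sq (rescale \<epsilon> \<phi>) x) = \<epsilon>\<^sup>2 * (LINT x|lebesgue. harmonic \<gamma> x * ?\<rho> x)"
    unfolding V_eq using integral_dilation(1)[OF \<epsilon> mV] \<epsilon> by simp
  moreover have "(LINT x|lebesgue. (mod_sq (rescale \<epsilon> \<phi>) x)\<^sup>2) = ?c * (LINT x|lebesgue. (?\<rho> x)\<^sup>2)"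
    unfolding r using l(2) unfolding sq by simp
  moreover have "(LINT x|lebesgue. (norm (weak_grad (mod_sq (rescale \<epsilon> \<phi>)) x))\<^sup>2) =
      inverse (\<epsilon> ^ (?n + 2)) * (LINT x|lebesgue. (norm (weak_grad ?\<rho> x))\<^sup>2)"
    unfolding r w(3) sq' ..
  ultimately show "density_energy \<gamma> a b (mod_sq (rescale \<epsilon> \<phi>)) =
      \<epsilon>\<^sup>2 * (LINT x|lebesgue. harmonic \<gamma> x * mod_sq \<phi> x)
      + a / 2 * (inverse (\<epsilon> ^ CARD('n)) * (LINT x|lebesgue. (mod_sq \<phi> x)\<^sup>2))
      + b / 2 * (inverse (\<epsilon> ^ (CARD('n) + 2)) * (LINT x|lebesgue. (norm (weak_grad (mod_sq \<phi>) x))\<^sup>2))"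
    unfolding density_energy_weak_grad by simp
qed

definition scaled_energy ::
  "('n::finite \<Rightarrow> real) \<Rightarrow> real \<Rightarrow> real \<Rightarrow> real \<Rightarrow> (real^'n \<Rightarrow> complex) \<Rightarrow> real" where
  "scaled_energy \<gamma> \<beta> \<delta> \<epsilon> \<phi> =
     \<epsilon> ^ 4 / 2 * (LINT x|lebesgue. (norm (weak_grad \<phi> x))\<^sup>2)
     + density_energy \<gamma> (\<beta> * \<epsilon> ^ (CARD('n) + 2)) (\<delta> * \<epsilon> ^ (CARD('n) + 4)) (mod_sq \<phi>)"

lemma scaled_energy_rescale:
  fixes \<phi> :: "real^'n \<Rightarrow> complex"
  assumes \<epsilon>: "0 < \<epsilon>" and \<phi>: "in_H1 \<phi>" "density_class \<gamma> 1 (mod_sq \<phi>)"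
  shows "scaled_energy \<gamma> \<beta> \<delta> \<epsilon> (rescale \<epsilon> \<phi>) = \<epsilon>\<^sup>2 * energy \<gamma> \<beta> \<delta> \<phi>"
proof -
  have 1: "\<epsilon> ^ 4 / 2 * (inverse (\<epsilon>\<^sup>2) * A) = \<epsilon>\<^sup>2 * (A / 2)" for A
    using \<epsilon> by (simp add: power2_eq_square power4_eq_xxxx field_simps)
  have 2: "\<beta> * \<epsilon> ^ (CARD('n) + 2) / 2 * (inverse (\<epsilon> ^ CARD('n)) * Q) = \<epsilon>\<^sup>2 * (\<beta> / 2 * Q)" for Q
    using \<epsilon> by (simp add: power_add power2_eq_square)
  have 3: "\<delta> * \<epsilon> ^ (CARD('n) + 4) / 2 * (inverse (\<epsilon> ^ (CARD('n) + 2)) * R) = \<epsilon>\<^sup>2 * (\<delta> / 2 * R)" for R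
    using \<epsilon> by (simp add: power_add power2_eq_square power4_eq_xxxx field_simps)
  show ?thesis
    unfolding scaled_energy_def rescale_in_H1(2)[OF \<epsilon> \<phi>(1)] rescale_density(2)[OF \<epsilon> \<phi>(2)] 1 2 3
      energy_density_integrable(2)[OF \<phi>]
    unfolding density_energy_weak_grad
    by (simp only: distrib_left add.assoc)
qed

text \<open>Rescaling is onto, so every competitor in the rescaled variable comes from one in the
  original variable.\<close>

lemma rescale_inverse:
  fixes \<phi> :: "real^'n \<Rightarrow> complex"
  assumes "0 < \<epsilon>" shows "rescale \<epsilon> (rescale (inverse \<epsilon>) \<phi>) = \<phi>"
proof
  fix x
  have "\<epsilon> powr (- real CARD('n) / 2) * inverse \<epsilon> powr (- real CARD('n) / 2) = 1"
    using assms by (simp flip: powr_mult)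
  then show "rescale \<epsilon> (rescale (inverse \<epsilon>) \<phi>) x = \<phi> x"
    unfolding rescale_def using assms by simp
qed

lemma ground_state_scaled_energy_le:
  fixes \<phi> \<psi> :: "real^'n \<Rightarrow> complex"
  assumes \<beta>: "0 < \<beta>" and \<delta>: "0 < \<delta>" and \<epsilon>: "0 < \<epsilon>" and \<phi>: "ground_state \<gamma> \<beta> \<delta> \<phi>"
    and \<psi>: "in_H1 \<psi>" "density_class \<gamma> 1 (mod_sq \<psi>)"
  shows "in_H1 (rescale \<epsilon> \<phi>)" "density_class \<gamma> 1 (mod_sq (rescale \<epsilon> \<phi>))"
    and "scaled_energy \<gamma> \<beta> \<delta> \<epsilon> (rescale \<epsilon> \<phi>) \<le> scaled_energy \<gamma> \<beta> \<delta> \<epsilon> \<psi>"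
proof -
  have \<phi>A: "in_H1 \<phi>" "density_class \<gamma> 1 (mod_sq \<phi>)"
    using \<phi> admissible_iff[OF \<beta> \<delta>] unfolding ground_state_def is_arg_min_def by auto
  show "in_H1 (rescale \<epsilon> \<phi>)" "density_class \<gamma> 1 (mod_sq (rescale \<epsilon> \<phi>))"
    by (rule rescale_in_H1(1)[OF \<epsilon> \<phi>A(1)], rule rescale_density(1)[OF \<epsilon> \<phi>A(2)])
  \<comment> \<open>The competitor is pulled back to the variable in which the ground state is
    minimal.\<close>
  define \<theta> where "\<theta> = rescale (inverse \<epsilon>) \<psi>"
  have i\<epsilon>: "0 < inverse \<epsilon>" using \<epsilon> by simp
  have \<theta>: "in_H1 \<theta>" "density_class \<gamma> 1 (mod_sq \<theta>)"
    unfolding \<theta>_def by (rule rescale_in_H1(1)[OF i\<epsilon> \<psi>(1)], rule rescale_density(1)[OF i\<epsilon> \<psi>(2)])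
  then have "energy \<gamma> \<beta> \<delta> \<phi> \<le> energy \<gamma> \<beta> \<delta> \<theta>"
    using \<phi> admissible_iff[OF \<beta> \<delta>] unfolding ground_state_def is_arg_min_def by (auto simp: not_less)
  then have "scaled_energy \<gamma> \<beta> \<delta> \<epsilon> (rescale \<epsilon> \<phi>) \<le> scaled_energy \<gamma> \<beta> \<delta> \<epsilon> (rescale \<epsilon> \<theta>)"
    unfolding scaled_energy_rescale[OF \<epsilon> \<phi>A] scaled_energy_rescale[OF \<epsilon> \<theta>]
    by (intro mult_left_mono) simp_all
  then show "scaled_energy \<gamma> \<beta> \<delta> \<epsilon> (rescale \<epsilon> \<phi>) \<le> scaled_energy \<gamma> \<beta> \<delta> \<epsilon> \<psi>"
    unfolding \<theta>_def rescale_inverse[OF \<epsilon>] .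
qed

section \<open>Convergence of the rescaled ground states\<close>

lemma density_class_of_1: "density_class \<gamma> 1 \<rho> \<Longrightarrow> density_class \<gamma> b \<rho>"
  unfolding density_class_def by simp

text \<open>Smooth densities are positive with square root in \<open>H\<^sup>1\<close>, and smoothing increases the limiting
  energy only a little.\<close>

lemma recovery_state:
  fixes \<rho> :: "real^'n \<Rightarrow> real"
  assumes a: "0 \<le> a" and b: "0 \<le> b" and \<rho>: "density_class \<gamma> b \<rho>" and \<eta>: "0 < \<eta>"
  obtains \<phi> where "in_H1 \<phi>" "density_class \<gamma> 1 (mod_sq \<phi>)"
    "density_energy \<gamma> a b (mod_sq \<phi>) \<le> density_energy \<gamma> a b \<rho> + \<eta>"
proof -
  note R = density_classD[OF \<rho>]
  obtain C M where M: "0 \<le> M" and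
    kernels: "\<And>s. 0 < s \<Longrightarrow> \<exists>(K :: real^'n \<Rightarrow> real) D. smoothing_kernel (C / s ^ CARD('n)) M s K D"
    by (rule smoothing_kernels_exist) blast
  define P where "P = (LINT x|lebesgue. harmonic \<gamma> x * \<rho> x)"
  define \<Lambda> where "\<Lambda> = (\<Sum>i\<in>UNIV. (\<gamma> i)\<^sup>2) * M"
  have P0: "0 \<le> P" unfolding P_def using R(1) by (intro integral_nonneg_AE AE_I2 mult_nonneg_nonneg harmonic_nonneg)
  have \<Lambda>0: "0 \<le> \<Lambda>" unfolding \<Lambda>_def using M by (simp add: sum_nonneg)
  \<comment> \<open>As s \<le> 1 gives s^2 \<le> s, the increase s P + (s^2 + s) \<Lambda> of the
    potential energy is at most s (P + 2 \<Lambda>); the added 1 keeps the denominator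
    positive.\<close>
  define s where "s = min 1 (\<eta> / (P + 2 * \<Lambda> + 1))"
  have s: "0 < s" "s \<le> 1" unfolding s_def using \<eta> P0 \<Lambda>0 by auto
  have s\<eta>: "s * P + (s\<^sup>2 + s) * \<Lambda> \<le> \<eta>"
  proof -
    have "s\<^sup>2 \<le> s" using s by (simp add: power2_eq_square mult_le_one mult_left_le)
    then have "(s\<^sup>2 + s) * \<Lambda> \<le> (2 * s) * \<Lambda>" using \<Lambda>0 by (intro mult_right_mono) auto
    then have "s * P + (s\<^sup>2 + s) * \<Lambda> \<le> s * (P + 2 * \<Lambda>)" by (simp add: algebra_simps)
    also have "\<dots> \<le> s * (P + 2 * \<Lambda> + 1)" using s by (intro mult_left_mono) auto
    also have "\<dots> \<le> \<eta> / (P + 2 * \<Lambda> + 1) * (P + 2 * \<Lambda> + 1)"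
      using P0 \<Lambda>0 by (intro mult_right_mono) (auto simp: s_def)
    also have "\<dots> = \<eta>" using P0 \<Lambda>0 by simp
    finally show ?thesis .
  qed
  obtain K :: "real^'n \<Rightarrow> real" and D where K: "smoothing_kernel (C / s ^ CARD('n)) M s K D"
    using kernels[OF s(1)] by blast
  obtain \<rho>1 where \<rho>1: "\<rho>1 \<in> borel_measurable borel" "AE x in lebesgue. \<rho> x = \<rho>1 x"
    by (rule borel_representative[OF in_L2_measurable[OF R(5)]])
  \<comment> \<open>A Borel representative may be negative on a null set, which truncation
    repairs.\<close>
  define \<rho>' where "\<rho>' = (\<lambda>x. max 0 (\<rho>1 x))"
  have \<rho>'m: "\<rho>' \<in> borel_measurable borel" unfolding \<rho>'_def using \<rho>1(1) by measurable
  have ae: "AE x in lebesgue. \<rho> x = \<rho>' x"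
    using \<rho>1(2)
  proof eventually_elim
    case (elim x)
    then show ?case unfolding \<rho>'_def using R(1)[of x] by simp
  qed
  have "(\<integral>\<^sup>+x. ennreal (\<rho>' x) \<partial>lborel) = (\<integral>\<^sup>+x. ennreal (\<rho>' x) \<partial>lebesgue)"
    by (simp add: nn_integral_completion)
  also have "\<dots> = (\<integral>\<^sup>+x. ennreal (\<rho> x) \<partial>lebesgue)"
    by (rule nn_integral_cong_AE) (use ae in eventually_elim, simp)
  also have "\<dots> = 1" using nn_integral_eq_integral[OF R(2)] R(1,3) by simp
  finally have mass: "(\<integral>\<^sup>+x. ennreal (\<rho>' x) \<partial>lborel) = 1" .
  interpret smoothing "C / s ^ CARD('n)" M s K D \<rho>'
  proof
    show "0 \<le> \<rho>' x" for x unfolding \<rho>'_def by simp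
  qed (rule K s(1) M \<rho>'m mass)+
  have V: "(\<integral>\<^sup>+x. ennreal (harmonic \<gamma> x * smoothed x) \<partial>lebesgue) \<le> ennreal ((1 + s) * P + (s\<^sup>2 + s) * \<Lambda>)"
  proof -
    have "(\<integral>\<^sup>+x. ennreal (harmonic \<gamma> x * \<rho>' x) \<partial>lebesgue) = (\<integral>\<^sup>+x. ennreal (harmonic \<gamma> x * \<rho> x) \<partial>lebesgue)"
      by (rule nn_integral_cong_AE) (use ae in eventually_elim, simp)
    also have "\<dots> = ennreal P"
      unfolding P_def using R(1) by (intro nn_integral_eq_integral R(4) AE_I2 mult_nonneg_nonneg harmonic_nonneg)
    finally have "(\<integral>\<^sup>+x. ennreal (harmonic \<gamma> x * smoothed x) \<partial>lebesgue) \<le>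
        ennreal (1 + s) * ennreal P + ennreal ((s\<^sup>2 + s) * \<Lambda>)"
      using smoothed_potential[of \<gamma>] unfolding nn_integral_completion \<Lambda>_def by simp
    also have "\<dots> = ennreal ((1 + s) * P + (s\<^sup>2 + s) * \<Lambda>)"
      using s P0 \<Lambda>0 by (simp add: ennreal_mult[symmetric] ennreal_plus[symmetric] del: ennreal_plus)
    finally show ?thesis .
  qed
  have u_nonneg: "0 \<le> smoothed x" for x using smoothed_pos[of x] by simp
  have Vi: "integrable lebesgue (\<lambda>x. harmonic \<gamma> x * smoothed x)"
  proof (rule integrableI_bounded)
    show "(\<lambda>x. harmonic \<gamma> x * smoothed x) \<in> borel_measurable lebesgue"
      by (intro borel_lebesgueI) measurable
    show "(\<integral>\<^sup>+x. ennreal (norm (harmonic \<gamma> x * smoothed x)) \<partial>lebesgue) < \<infinity>"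
      using V u_nonneg harmonic_nonneg[of \<gamma>] by (simp add: le_less_trans)
  qed
  have Vle: "(LINT x|lebesgue. harmonic \<gamma> x * smoothed x) \<le> (1 + s) * P + (s\<^sup>2 + s) * \<Lambda>"
  proof -
    have "ennreal (LINT x|lebesgue. harmonic \<gamma> x * smoothed x) \<le> ennreal ((1 + s) * P + (s\<^sup>2 + s) * \<Lambda>)"
      using V nn_integral_eq_integral[OF Vi] u_nonneg harmonic_nonneg[of \<gamma>] by simp
    then show ?thesis using s P0 \<Lambda>0 by (subst (asm) ennreal_le_iff) auto
  qed
  have Q: "(LINT x|lebesgue. (norm (smoothed x))\<^sup>2) \<le> (LINT x|lebesgue. (norm (\<rho> x))\<^sup>2)"
  proof -
    have "(\<integral>\<^sup>+x. ennreal ((\<rho>' x)\<^sup>2) \<partial>lebesgue) = (\<integral>\<^sup>+x. ennreal ((norm (\<rho> x))\<^sup>2) \<partial>lebesgue)"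
      by (rule nn_integral_cong_AE) (use ae in eventually_elim, simp)
    then have "ennreal (LINT x|lebesgue. (norm (smoothed x))\<^sup>2) \<le> ennreal (LINT x|lebesgue. (norm (\<rho> x))\<^sup>2)"
      using smoothed_square unfolding nn_integral_norm_square[OF smoothed_in_L2, symmetric]
        nn_integral_norm_square[OF R(5), symmetric] by (simp add: nn_integral_completion)
    then show ?thesis by (subst (asm) ennreal_le_iff) auto
  qed
  have gL2: "in_L2 (weak_grad smoothed)" by (rule in_L2_weak_grad[OF smoothed_weak_gradient smoothed_grad_in_L2])
  \<comment> \<open>The factor b/2 is kept in the inequality, so that it is trivial for
    \<open>b = 0\<close>, where \<open>\<rho>\<close> need not have a gradient.\<close>
  have G: "b / 2 * (LINT x|lebesgue. (norm (density_grad b smoothed x))\<^sup>2) \<le> b / 2 * (LINT x|lebesgue. (norm (density_grad b \<rho> x))\<^sup>2)"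
  proof (cases "b = 0")
    case False
    obtain g' where g': "g' \<in> borel_measurable borel" "AE x in lebesgue. density_grad b \<rho> x = g' x"
      by (rule borel_representative[OF in_L2_measurable[OF R(6)]])
    have wg': "has_weak_gradient \<rho>' g'" by (rule has_weak_gradient_cong_AE[OF R(7)[OF False] ae g'(2)])
    have "in_L2 g'" by (rule in_L2_cong_AE[OF R(6) g'(2)])
    then have g2': "integrable lborel (\<lambda>x. (norm (g' x))\<^sup>2)"
      using g'(1) unfolding in_L2_def by (simp add: integrable_completion)
    have "(\<integral>\<^sup>+x. ennreal ((norm (weak_grad smoothed x))\<^sup>2) \<partial>lebesgue) = (\<integral>\<^sup>+x. ennreal ((norm (smoothed_grad x))\<^sup>2) \<partial>lebesgue)"
      by (rule nn_integral_cong_AE) (use weak_grad_AE[OF smoothed_weak_gradient] in eventually_elim, simp)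
    also have "\<dots> \<le> (\<integral>\<^sup>+x. ennreal ((norm (g' x))\<^sup>2) \<partial>lebesgue)"
      using smoothed_grad_square[OF wg' g'(1) g2'] by (simp add: nn_integral_completion)
    also have "\<dots> = (\<integral>\<^sup>+x. ennreal ((norm (density_grad b \<rho> x))\<^sup>2) \<partial>lebesgue)"
      by (rule nn_integral_cong_AE) (use g'(2) in eventually_elim, simp)
    finally have "ennreal (LINT x|lebesgue. (norm (weak_grad smoothed x))\<^sup>2) \<le> ennreal (LINT x|lebesgue. (norm (density_grad b \<rho> x))\<^sup>2)"
      unfolding nn_integral_norm_square[OF gL2] nn_integral_norm_square[OF R(6)] .
    then have "(LINT x|lebesgue. (norm (weak_grad smoothed x))\<^sup>2) \<le> (LINT x|lebesgue. (norm (density_grad b \<rho> x))\<^sup>2)"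
      by (subst (asm) ennreal_le_iff) auto
    then show ?thesis using b False by (intro mult_left_mono) (simp_all add: density_grad_def)
  qed simp
  have dc: "density_class \<gamma> 1 smoothed"
    unfolding density_class_def
  proof (intro conjI allI impI)
    show i: "integrable lebesgue smoothed" using smoothed_integrable by (simp add: integrable_completion)
    have "(LINT x|lebesgue. smoothed x) = (LINT x|lborel. smoothed x)" by (simp add: integral_completion)
    also have "\<dots> = 1" using smoothed_mass nn_integral_eq_integral[OF smoothed_integrable] u_nonneg by simp
    finally show "(LINT x|lebesgue. smoothed x) = 1" .
    show "weakly_differentiable smoothed" using smoothed_weak_gradient unfolding weakly_differentiable_def by blast
  qed (rule u_nonneg Vi smoothed_in_L2 gL2)+
  have "a / 2 * (LINT x|lebesgue. (norm (smoothed x))\<^sup>2) \<le> a / 2 * (LINT x|lebesgue. (norm (\<rho> x))\<^sup>2)"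
    using Q a by (intro mult_left_mono) auto
  then have "density_energy \<gamma> a b smoothed \<le> density_energy \<gamma> a b \<rho> + \<eta>"
    unfolding density_energy_def P_def[symmetric] using G Vle s\<eta> by (simp add: algebra_simps)
  then show ?thesis
    using that[of smoothed_state] smoothed_state_in_H1 dc unfolding mod_sq_smoothed_state by blast
qed

text \<open>The potential has coefficient 1 on both sides, whence \<open>1 \<le> \<theta>\<close>. A
  multiplicative comparison relies only on the signs of the three terms, not on bounds for the
  ground states.\<close>

lemma density_energy_mono_scaled:
  assumes \<rho>: "density_class \<gamma> 1 \<rho>" and \<theta>: "1 \<le> \<theta>" "a \<le> \<theta> * a'" "b \<le> \<theta> * b'"
  shows "density_energy \<gamma> a b \<rho> \<le> \<theta> * density_energy \<gamma> a' b' \<rho>"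
proof -
  let ?P = "LINT x|lebesgue. harmonic \<gamma> x * \<rho> x" and ?Q = "LINT x|lebesgue. (\<rho> x)\<^sup>2"
    and ?R = "LINT x|lebesgue. (norm (weak_grad \<rho> x))\<^sup>2"
  have "0 \<le> ?P" using density_classD(1)[OF \<rho>] by (intro integral_nonneg_AE AE_I2 mult_nonneg_nonneg harmonic_nonneg)
  then have "1 * ?P \<le> \<theta> * ?P" using \<theta>(1) by (intro mult_right_mono) auto
  moreover have "a / 2 * ?Q \<le> (\<theta> * a') / 2 * ?Q" using \<theta>(2) by (intro mult_right_mono) auto
  moreover have "b / 2 * ?R \<le> (\<theta> * b') / 2 * ?R" using \<theta>(3) by (intro mult_right_mono) auto
  ultimately show ?thesis
    unfolding density_energy_weak_grad by (simp add: distrib_left)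
qed

text \<open>A positive limit leaves room between a/\<theta> and a; for the limit 0 the sign of
  \<open>f\<close> suffices. Thus coefficients that vanish in the limit need no separate
  argument.\<close>

lemma eventually_le_scaled:
  fixes f :: "real \<Rightarrow> real"
  assumes "(f \<longlongrightarrow> a) F" "\<forall>\<^sub>F x in F. 0 \<le> f x" "0 \<le> a" "1 < \<theta>"
  shows "\<forall>\<^sub>F x in F. a \<le> \<theta> * f x"
proof (cases "a = 0")
  case True
  then show ?thesis using assms(2,4) by (auto elim!: eventually_mono)
next
  case False
  then have "a / \<theta> < a" using assms(3,4) by (simp add: divide_less_eq)
  from order_tendstoD(1)[OF assms(1) this] show ?thesis
    by eventually_elim (use assms(4) in \<open>simp add: divide_less_eq mult.commute less_imp_le\<close>)
qed

text \<open>The tolerance is split in three: one third for the recovery state, one for the scaled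
  energy of that fixed state, one for replacing the coefficients by their limits.\<close>

theorem rescaled_ground_state_energy:
  fixes \<gamma> :: "'n::finite \<Rightarrow> real" and \<delta> \<epsilon> :: "real \<Rightarrow> real" and \<phi>g :: "real \<Rightarrow> real^'n \<Rightarrow> complex"
  assumes a: "0 \<le> a" and b: "0 \<le> b"
    and \<delta>: "\<And>\<beta>. 0 < \<beta> \<Longrightarrow> 0 < \<delta> \<beta>" and \<epsilon>: "\<And>\<beta>. 0 < \<beta> \<Longrightarrow> 0 < \<epsilon> \<beta>"
    and gs: "\<And>\<beta>. 0 < \<beta> \<Longrightarrow> ground_state \<gamma> \<beta> (\<delta> \<beta>) (\<phi>g \<beta>)"
    and \<epsilon>0: "(\<epsilon> \<longlongrightarrow> 0) at_top"
    and la: "((\<lambda>\<beta>. \<beta> * \<epsilon> \<beta> ^ (CARD('n) + 2)) \<longlongrightarrow> a) at_top"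
    and lb: "((\<lambda>\<beta>. \<delta> \<beta> * \<epsilon> \<beta> ^ (CARD('n) + 4)) \<longlongrightarrow> b) at_top"
    and \<rho>: "density_class \<gamma> b \<rho>" and \<eta>: "0 < \<eta>"
  shows "\<forall>\<^sub>F \<beta> in at_top. density_energy \<gamma> a b (mod_sq (rescale (\<epsilon> \<beta>) (\<phi>g \<beta>))) \<le> density_energy \<gamma> a b \<rho> + \<eta>"
proof -
  have "0 < \<eta> / 3" using \<eta> by simp
  then obtain \<psi> where \<psi>: "in_H1 \<psi>" "density_class \<gamma> 1 (mod_sq \<psi>)"
    and \<psi>E: "density_energy \<gamma> a b (mod_sq \<psi>) \<le> density_energy \<gamma> a b \<rho> + \<eta> / 3"
    by (rule recovery_state[OF a b \<rho>])
  define X where "X = density_energy \<gamma> a b (mod_sq \<psi>)"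
  have X: "0 \<le> X" unfolding X_def by (rule density_energy_nonneg[OF density_class_of_1[OF \<psi>(2)] a b])
  \<comment> \<open>Chosen so that enlarging X + \<eta>/3 by the factor 1 + \<kappa> costs exactly
    \<eta>/3.\<close>
  define \<kappa> where "\<kappa> = (\<eta> / 3) / (X + \<eta> / 3)"
  have den: "0 < X + \<eta> / 3" using X \<eta> by simp
  have \<kappa>: "0 < \<kappa>" unfolding \<kappa>_def using den \<eta> by simp
  have \<kappa>X: "(1 + \<kappa>) * (X + \<eta> / 3) = X + 2 * \<eta> / 3"
  proof -
    have "\<kappa> * (X + \<eta> / 3) = \<eta> / 3"
      using den unfolding \<kappa>_def by (subst nonzero_eq_divide_eq[symmetric]) auto
    then show ?thesis by (simp add: distrib_right)
  qed
  have pos: "\<forall>\<^sub>F \<beta> in at_top. 0 < (\<beta>::real)" by (rule eventually_gt_at_top)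
  \<comment> \<open>Since \<psi> does not depend on \<beta>, its kinetic term is a constant times
    the fourth power of \<epsilon> and vanishes.\<close>
  have "((\<lambda>\<beta>. scaled_energy \<gamma> \<beta> (\<delta> \<beta>) (\<epsilon> \<beta>) \<psi>) \<longlongrightarrow>
      0 ^ 4 / 2 * (LINT x|lebesgue. (norm (weak_grad \<psi> x))\<^sup>2) + X) at_top"
    unfolding scaled_energy_def X_def density_energy_weak_grad by (intro tendsto_intros \<epsilon>0 la lb) simp_all
  then have "\<forall>\<^sub>F \<beta> in at_top. scaled_energy \<gamma> \<beta> (\<delta> \<beta>) (\<epsilon> \<beta>) \<psi> < X + \<eta> / 3"
    using \<eta> by (intro order_tendstoD(2)) auto
  moreover have "\<forall>\<^sub>F \<beta> in at_top. a \<le> (1 + \<kappa>) * (\<beta> * \<epsilon> \<beta> ^ (CARD('n) + 2))"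
  proof (rule eventually_le_scaled[OF la _ a])
    show "\<forall>\<^sub>F \<beta> in at_top. 0 \<le> \<beta> * \<epsilon> \<beta> ^ (CARD('n) + 2)"
      using pos
    proof eventually_elim
      case (elim \<beta>)
      then show ?case using \<epsilon>[OF elim] by simp
    qed
  qed (use \<kappa> in simp)
  moreover have "\<forall>\<^sub>F \<beta> in at_top. b \<le> (1 + \<kappa>) * (\<delta> \<beta> * \<epsilon> \<beta> ^ (CARD('n) + 4))"
  proof (rule eventually_le_scaled[OF lb _ b])
    show "\<forall>\<^sub>F \<beta> in at_top. 0 \<le> \<delta> \<beta> * \<epsilon> \<beta> ^ (CARD('n) + 4)"
      using pos
    proof eventually_elim
      case (elim \<beta>)
      then show ?case using \<epsilon>[OF elim] \<delta>[OF elim] by simp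
    qed
  qed (use \<kappa> in simp)
  ultimately show ?thesis using pos
  proof eventually_elim
    case (elim \<beta>)
    let ?\<theta> = "rescale (\<epsilon> \<beta>) (\<phi>g \<beta>)"
    note g = ground_state_scaled_energy_le[OF elim(4) \<delta>[OF elim(4)] \<epsilon>[OF elim(4)] gs[OF elim(4)] \<psi>]
    \<comment> \<open>The kinetic term of the ground state is nonnegative and is dropped.\<close>
    have "density_energy \<gamma> (\<beta> * \<epsilon> \<beta> ^ (CARD('n) + 2)) (\<delta> \<beta> * \<epsilon> \<beta> ^ (CARD('n) + 4)) (mod_sq ?\<theta>)
        \<le> scaled_energy \<gamma> \<beta> (\<delta> \<beta>) (\<epsilon> \<beta>) ?\<theta>"
      unfolding scaled_energy_def by simp
    also have "\<dots> \<le> X + \<eta> / 3" using g(3) elim(1) by simp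
    finally have le: "density_energy \<gamma> (\<beta> * \<epsilon> \<beta> ^ (CARD('n) + 2)) (\<delta> \<beta> * \<epsilon> \<beta> ^ (CARD('n) + 4)) (mod_sq ?\<theta>) \<le> X + \<eta> / 3" .
    have "density_energy \<gamma> a b (mod_sq ?\<theta>) \<le>
        (1 + \<kappa>) * density_energy \<gamma> (\<beta> * \<epsilon> \<beta> ^ (CARD('n) + 2)) (\<delta> \<beta> * \<epsilon> \<beta> ^ (CARD('n) + 4)) (mod_sq ?\<theta>)"
      using \<kappa> by (intro density_energy_mono_scaled[OF g(2)] elim) simp
    also have "\<dots> \<le> (1 + \<kappa>) * (X + \<eta> / 3)" using le \<kappa> by (intro mult_left_mono) auto
    also have "\<dots> = X + 2 * \<eta> / 3" by (rule \<kappa>X)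
    finally show ?case using \<psi>E unfolding X_def by simp
  qed
qed

text \<open>\<open>A\<close> and \<open>E\<close> are abstract, so that the three regimes become
  instances which differ only in the pair of limiting coefficients.\<close>

theorem rescaled_ground_state_limit:
  fixes \<gamma> :: "'n::finite \<Rightarrow> real" and \<delta> \<epsilon> :: "real \<Rightarrow> real" and \<phi>g :: "real \<Rightarrow> real^'n \<Rightarrow> complex"
  assumes \<gamma>: "\<And>i. 0 < \<gamma> i" and a: "0 \<le> a" and b: "0 \<le> b" and ab: "0 < a + b"
    and \<delta>: "\<And>\<beta>. 0 < \<beta> \<Longrightarrow> 0 < \<delta> \<beta>" and \<epsilon>: "\<And>\<beta>. 0 < \<beta> \<Longrightarrow> 0 < \<epsilon> \<beta>"
    and gs: "\<And>\<beta>. 0 < \<beta> \<Longrightarrow> ground_state \<gamma> \<beta> (\<delta> \<beta>) (\<phi>g \<beta>)"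
    and \<epsilon>0: "(\<epsilon> \<longlongrightarrow> 0) at_top"
    and la: "((\<lambda>\<beta>. \<beta> * \<epsilon> \<beta> ^ (CARD('n) + 2)) \<longlongrightarrow> a) at_top"
    and lb: "((\<lambda>\<beta>. \<delta> \<beta> * \<epsilon> \<beta> ^ (CARD('n) + 4)) \<longlongrightarrow> b) at_top"
    and A: "\<And>\<phi>. \<phi> \<in> A \<longleftrightarrow> \<phi> \<in> borel_measurable lebesgue \<and> density_class \<gamma> b (mod_sq \<phi>)"
    and E: "\<And>\<phi>. density_class \<gamma> b (mod_sq \<phi>) \<Longrightarrow> E \<phi> = density_energy \<gamma> a b (mod_sq \<phi>)"
  shows "\<forall>\<beta>>0. rescale (\<epsilon> \<beta>) (\<phi>g \<beta>) \<in> admissible \<gamma> \<beta> (\<delta> \<beta>)"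
    and "\<exists>\<phi>inf. unique_nonneg_minimizer E A \<phi>inf \<and>
      tendsto_L2 (\<lambda>\<beta>. mod_sq (rescale (\<epsilon> \<beta>) (\<phi>g \<beta>))) (mod_sq \<phi>inf) at_top \<and>
      (b \<noteq> 0 \<longrightarrow> tendsto_H1 (\<lambda>\<beta>. mod_sq (rescale (\<epsilon> \<beta>) (\<phi>g \<beta>))) (mod_sq \<phi>inf) at_top)"
proof -
  let ?\<sigma> = "\<lambda>\<beta>. mod_sq (rescale (\<epsilon> \<beta>) (\<phi>g \<beta>))"
  have \<phi>A: "in_H1 (\<phi>g \<beta>)" "density_class \<gamma> 1 (mod_sq (\<phi>g \<beta>))" if "0 < \<beta>" for \<beta>
    using gs[OF that] admissible_iff[OF that \<delta>[OF that]] unfolding ground_state_def is_arg_min_def by auto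
  have rA: "in_H1 (rescale (\<epsilon> \<beta>) (\<phi>g \<beta>))" "density_class \<gamma> 1 (?\<sigma> \<beta>)" if "0 < \<beta>" for \<beta>
    by (rule rescale_in_H1(1)[OF \<epsilon>[OF that] \<phi>A(1)[OF that]], rule rescale_density(1)[OF \<epsilon>[OF that] \<phi>A(2)[OF that]])
  show "\<forall>\<beta>>0. rescale (\<epsilon> \<beta>) (\<phi>g \<beta>) \<in> admissible \<gamma> \<beta> (\<delta> \<beta>)"
    using rA admissible_iff \<delta> by blast
  have pos: "\<forall>\<^sub>F \<beta> in at_top. 0 < (\<beta>::real)" by (rule eventually_gt_at_top)
  \<comment> \<open>The ground state at \<beta> = 1 shows that the class of densities is not
    empty.\<close>
  have ne: "density_class \<gamma> b (?\<sigma> 1)" by (rule density_class_of_1[OF rA(2)]) simp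
  obtain \<rho> where \<rho>: "density_class \<gamma> b \<rho>"
    and min: "\<And>\<sigma>. density_class \<gamma> b \<sigma> \<Longrightarrow> density_energy \<gamma> a b \<rho> \<le> density_energy \<gamma> a b \<sigma>"
    using density_minimizer_exists[of \<gamma>, OF \<gamma> a b ab ne] by blast
  let ?\<phi> = "\<lambda>x. complex_of_real (sqrt (\<rho> x))"
  note R = density_classD[OF \<rho>]
  have m: "mod_sq ?\<phi> = \<rho>" by (rule mod_sq_sqrt) (rule R(1))
  have cl: "\<forall>\<^sub>F \<beta> in at_top. density_class \<gamma> b (?\<sigma> \<beta>)"
    using pos by eventually_elim (rule density_class_of_1[OF rA(2)])
  note lim = density_energy_tendsto_imp[OF a b ab \<rho> min cl
      rescaled_ground_state_energy[OF a b \<delta> \<epsilon> gs \<epsilon>0 la lb \<rho>]]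
  have L2: "tendsto_L2 ?\<sigma> \<rho> at_top"
    unfolding tendsto_L2_def
  proof (intro conjI)
    show "\<forall>\<^sub>F \<beta> in at_top. in_L2 (?\<sigma> \<beta>)" using cl by eventually_elim (rule density_classD(5))
    show "((\<lambda>\<beta>. L2_norm (\<lambda>x. ?\<sigma> \<beta> x - \<rho> x)) \<longlongrightarrow> 0) at_top"
      using tendsto_real_sqrt[OF lim(1)] unfolding L2_norm_def by simp
  qed (rule R(5))
  have H1: "tendsto_H1 ?\<sigma> \<rho> at_top" if b0: "b \<noteq> 0"
    unfolding tendsto_H1_def
  proof (intro conjI)
    have H1I: "in_H1 \<sigma>" if "density_class \<gamma> b \<sigma>" for \<sigma>
      using that b0 unfolding density_class_def in_H1_def by blast
    show "\<forall>\<^sub>F \<beta> in at_top. in_H1 (?\<sigma> \<beta>)" using cl by eventually_elim (rule H1I)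
    show "in_H1 \<rho>" by (rule H1I[OF \<rho>])
    have "((\<lambda>\<beta>. sqrt ((LINT x|lebesgue. (norm (?\<sigma> \<beta> x - \<rho> x))\<^sup>2)
        + (LINT x|lebesgue. (norm (density_grad b (?\<sigma> \<beta>) x - density_grad b \<rho> x))\<^sup>2))) \<longlongrightarrow> sqrt (0 + 0)) at_top"
      by (intro tendsto_real_sqrt tendsto_add lim)
    moreover have "\<forall>\<^sub>F \<beta> in at_top. sqrt ((LINT x|lebesgue. (norm (?\<sigma> \<beta> x - \<rho> x))\<^sup>2)
        + (LINT x|lebesgue. (norm (density_grad b (?\<sigma> \<beta>) x - density_grad b \<rho> x))\<^sup>2)) = H1_norm (\<lambda>x. ?\<sigma> \<beta> x - \<rho> x)"
      using cl
    proof eventually_elim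
      case (elim \<beta>)
      \<comment> \<open>\<open>H1_norm\<close> uses the chosen gradient of the difference; it agrees
        with the difference of the chosen gradients almost everywhere, which is enough under the
        integral.\<close>
      have wg: "has_weak_gradient (\<lambda>x. ?\<sigma> \<beta> x - \<rho> x) (\<lambda>x. density_grad b (?\<sigma> \<beta>) x - density_grad b \<rho> x)"
        using has_weak_gradient_lincomb[OF density_classD(7)[OF elim b0] R(7)[OF b0], of 1 "-1"] by simp
      have "(LINT x|lebesgue. (norm (weak_grad (\<lambda>x. ?\<sigma> \<beta> x - \<rho> x) x))\<^sup>2) =
          (LINT x|lebesgue. (norm (density_grad b (?\<sigma> \<beta>) x - density_grad b \<rho> x))\<^sup>2)"
        by (rule integral_lebesgue_cong_AE) (use weak_grad_AE[OF wg] in eventually_elim, simp)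
      then show ?case unfolding H1_norm_def L2_norm_def by simp
    qed
    ultimately show "((\<lambda>\<beta>. H1_norm (\<lambda>x. ?\<sigma> \<beta> x - \<rho> x)) \<longlongrightarrow> 0) at_top"
      by (rule Lim_transform_eventually[THEN tendsto_eq_rhs]) simp
  qed
  show "\<exists>\<phi>inf. unique_nonneg_minimizer E A \<phi>inf \<and> tendsto_L2 ?\<sigma> (mod_sq \<phi>inf) at_top \<and>
      (b \<noteq> 0 \<longrightarrow> tendsto_H1 ?\<sigma> (mod_sq \<phi>inf) at_top)"
  proof (intro exI conjI impI)
    show "unique_nonneg_minimizer E A ?\<phi>"
      by (rule unique_nonneg_minimizer_sqrt[OF a b ab A E \<rho> min])
    show "tendsto_L2 ?\<sigma> (mod_sq ?\<phi>) at_top" unfolding m by (rule L2)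
    show "tendsto_H1 ?\<sigma> (mod_sq ?\<phi>) at_top" if "b \<noteq> 0" unfolding m by (rule H1[OF that])
  qed
qed

lemma powr_scaling_power:
  assumes "0 < x" "0 < q" shows "(x powr (- 1 / q)) ^ n = x powr (- real n / q)"
proof -
  have "(x powr (- 1 / q)) ^ n = (x powr (- 1 / q)) powr real n"
    using assms by (intro powr_realpow[symmetric]) simp
  then show ?thesis by (simp add: powr_powr)
qed

theorem theorem3p2:
  fixes \<gamma> :: "'n::finite \<Rightarrow> real"
    and \<delta> :: "real \<Rightarrow> real"
    and \<phi>g :: "real \<Rightarrow> real^'n \<Rightarrow> complex"
    and d :: real
  assumes dim: "CARD('n) \<in> {1, 2, 3}"
    and d: "d = real CARD('n)"
    and \<gamma>: "\<And>i. 0 < \<gamma> i"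
    and \<delta>: "\<And>\<beta>. 0 < \<beta> \<Longrightarrow> 0 < \<delta> \<beta>"
    and \<phi>g: "\<And>\<beta>. 0 < \<beta> \<Longrightarrow> ground_state \<gamma> \<beta> (\<delta> \<beta>) (\<phi>g \<beta>) \<and> positive_ae (\<phi>g \<beta>)"
  shows "(\<delta> \<in> o(\<lambda>\<beta>. \<beta> powr ((4 + d) / (2 + d))) \<longrightarrow>
      (let \<epsilon> = \<lambda>\<beta>. \<beta> powr (- 1 / (2 + d));
           \<phi>\<epsilon> = \<lambda>\<beta>. rescale (\<epsilon> \<beta>) (\<phi>g \<beta>)
       in (\<forall>\<beta>>0. \<phi>\<epsilon> \<beta> \<in> admissible \<gamma> \<beta> (\<delta> \<beta>)) \<and>
          (\<exists>\<phi>inf. unique_nonneg_minimizer (energy1 \<gamma>) (admissible1 \<gamma>) \<phi>inf \<and>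
                tendsto_L2 (\<lambda>\<beta>. mod_sq (\<phi>\<epsilon> \<beta>)) (mod_sq \<phi>inf) at_top))) \<and>
    (\<forall>\<delta>inf>0. ((\<lambda>\<beta>. \<delta> \<beta> / \<beta> powr ((4 + d) / (2 + d))) \<longlongrightarrow> \<delta>inf) at_top \<longrightarrow>
      (let \<epsilon> = \<lambda>\<beta>. \<beta> powr (- 1 / (2 + d));
           \<phi>\<epsilon> = \<lambda>\<beta>. rescale (\<epsilon> \<beta>) (\<phi>g \<beta>)
       in (\<forall>\<beta>>0. \<phi>\<epsilon> \<beta> \<in> admissible \<gamma> \<beta> (\<delta> \<beta>)) \<and>
          (\<exists>\<phi>inf. unique_nonneg_minimizer (energy2 \<gamma> \<delta>inf) (admissible2 \<gamma>) \<phi>inf \<and>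
                tendsto_H1 (\<lambda>\<beta>. mod_sq (\<phi>\<epsilon> \<beta>)) (mod_sq \<phi>inf) at_top))) \<and>
    (filterlim (\<lambda>\<beta>. \<delta> \<beta> / \<beta> powr ((4 + d) / (2 + d))) at_top at_top \<longrightarrow>
      (let \<epsilon> = \<lambda>\<beta>. \<delta> \<beta> powr (- 1 / (4 + d));
           \<phi>\<epsilon> = \<lambda>\<beta>. rescale (\<epsilon> \<beta>) (\<phi>g \<beta>)
       in (\<forall>\<beta>>0. \<phi>\<epsilon> \<beta> \<in> admissible \<gamma> \<beta> (\<delta> \<beta>)) \<and>
          (\<exists>\<phi>inf. unique_nonneg_minimizer (energy3 \<gamma>) (admissible3 \<gamma>) \<phi>inf \<and>
                tendsto_H1 (\<lambda>\<beta>. mod_sq (\<phi>\<epsilon> \<beta>)) (mod_sq \<phi>inf) at_top)))"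
proof -
  let ?n = "CARD('n)"
  have gs: "ground_state \<gamma> \<beta> (\<delta> \<beta>) (\<phi>g \<beta>)" if "0 < \<beta>" for \<beta> using \<phi>g[OF that] by blast
  have d2: "0 < 2 + d" and d4: "0 < 4 + d" unfolding d by simp_all
  have pos: "\<forall>\<^sub>F \<beta> in at_top. 0 < (\<beta>::real)" by (rule eventually_gt_at_top)
  define \<epsilon> where "\<epsilon> = (\<lambda>\<beta>::real. \<beta> powr (- 1 / (2 + d)))"
  define r where "r = (4 + d) / (2 + d)"
  have r0: "0 < r" unfolding r_def using d2 d4 by simp
  have \<epsilon>: "0 < \<epsilon> \<beta>" if "0 < \<beta>" for \<beta> unfolding \<epsilon>_def using that by simp
  have \<epsilon>0: "(\<epsilon> \<longlongrightarrow> 0) at_top"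
    unfolding \<epsilon>_def using d2 by (intro tendsto_neg_powr filterlim_ident) (simp add: divide_neg_pos)
  \<comment> \<open>The power d + 2 of \<epsilon> is exactly 1/\<beta>, so this coefficient is
    constant and not merely convergent.\<close>
  have la: "((\<lambda>\<beta>. \<beta> * \<epsilon> \<beta> ^ (?n + 2)) \<longlongrightarrow> 1) at_top"
  proof (rule tendsto_eventually)
    show "\<forall>\<^sub>F \<beta> in at_top. \<beta> * \<epsilon> \<beta> ^ (?n + 2) = 1"
      using pos
    proof eventually_elim
      case (elim \<beta>)
      have "- real (?n + 2) / (2 + d) = - 1" using d2 unfolding d by (simp add: field_simps)
      then show ?case unfolding \<epsilon>_def powr_scaling_power[OF elim d2] using elim by (simp add: powr_minus)
    qed
  qed
  \<comment> \<open>The power d + 4 of \<epsilon> is \<beta> to the exponent -r, so the coefficient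
    is the quotient whose limit distinguishes the regimes.\<close>
  have \<delta>\<epsilon>: "\<delta> \<beta> * \<epsilon> \<beta> ^ (?n + 4) = \<delta> \<beta> / \<beta> powr r" if "0 < \<beta>" for \<beta>
  proof -
    have "real (?n + 4) = 4 + d" unfolding d by simp
    then have "- real (?n + 4) / (2 + d) = - r" unfolding r_def by (simp only: minus_divide_left)
    then show ?thesis unfolding \<epsilon>_def powr_scaling_power[OF that d2] using that by (simp add: powr_minus divide_inverse)
  qed
  have lb: "((\<lambda>\<beta>. \<delta> \<beta> * \<epsilon> \<beta> ^ (?n + 4)) \<longlongrightarrow> b) at_top" if "((\<lambda>\<beta>. \<delta> \<beta> / \<beta> powr r) \<longlongrightarrow> b) at_top" for b
    by (rule Lim_transform_eventually[OF that]) (use pos in \<open>eventually_elim, simp add: \<delta>\<epsilon>\<close>)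
  have case1: "(\<forall>\<beta>>0. rescale (\<epsilon> \<beta>) (\<phi>g \<beta>) \<in> admissible \<gamma> \<beta> (\<delta> \<beta>)) \<and>
      (\<exists>\<phi>inf. unique_nonneg_minimizer (energy1 \<gamma>) (admissible1 \<gamma>) \<phi>inf \<and>
        tendsto_L2 (\<lambda>\<beta>. mod_sq (rescale (\<epsilon> \<beta>) (\<phi>g \<beta>))) (mod_sq \<phi>inf) at_top)"
    if "\<delta> \<in> o(\<lambda>\<beta>. \<beta> powr r)"
  proof -
    have "((\<lambda>\<beta>. \<delta> \<beta> / \<beta> powr r) \<longlongrightarrow> 0) at_top"
      using smalloD_tendsto[OF that] .
    note L = rescaled_ground_state_limit[of \<gamma> 1 0 \<delta> \<epsilon> \<phi>g, OF \<gamma> _ _ _ \<delta> \<epsilon> gs \<epsilon>0 la lb[OF this] admissible1_iff energy1_eq]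
    show ?thesis using L by auto
  qed
  have case2: "(\<forall>\<beta>>0. rescale (\<epsilon> \<beta>) (\<phi>g \<beta>) \<in> admissible \<gamma> \<beta> (\<delta> \<beta>)) \<and>
      (\<exists>\<phi>inf. unique_nonneg_minimizer (energy2 \<gamma> \<delta>inf) (admissible2 \<gamma>) \<phi>inf \<and>
        tendsto_H1 (\<lambda>\<beta>. mod_sq (rescale (\<epsilon> \<beta>) (\<phi>g \<beta>))) (mod_sq \<phi>inf) at_top)"
    if \<delta>inf: "0 < \<delta>inf" and lim: "((\<lambda>\<beta>. \<delta> \<beta> / \<beta> powr r) \<longlongrightarrow> \<delta>inf) at_top" for \<delta>inf
  proof -
    have nz: "\<delta>inf \<noteq> 0" using \<delta>inf by simp
    note L = rescaled_ground_state_limit[of \<gamma> 1 \<delta>inf \<delta> \<epsilon> \<phi>g, OF \<gamma> _ _ _ \<delta> \<epsilon> gs \<epsilon>0 la lb[OF lim]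
        admissible2_iff[OF nz] energy2_eq[OF _ nz]]
    show ?thesis using L \<delta>inf by auto
  qed
  define \<epsilon>' where "\<epsilon>' = (\<lambda>\<beta>. \<delta> \<beta> powr (- 1 / (4 + d)))"
  have \<epsilon>': "0 < \<epsilon>' \<beta>" if "0 < \<beta>" for \<beta> unfolding \<epsilon>'_def using \<delta>[OF that] by simp
  have case3: "(\<forall>\<beta>>0. rescale (\<epsilon>' \<beta>) (\<phi>g \<beta>) \<in> admissible \<gamma> \<beta> (\<delta> \<beta>)) \<and>
      (\<exists>\<phi>inf. unique_nonneg_minimizer (energy3 \<gamma>) (admissible3 \<gamma>) \<phi>inf \<and>
        tendsto_H1 (\<lambda>\<beta>. mod_sq (rescale (\<epsilon>' \<beta>) (\<phi>g \<beta>))) (mod_sq \<phi>inf) at_top)"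
    if lim: "filterlim (\<lambda>\<beta>. \<delta> \<beta> / \<beta> powr r) at_top at_top"
  proof -
    \<comment> \<open>The hypothesis concerns only the quotient; multiplied by a power of \<beta>
      that diverges, it gives divergence of \<delta>, and hence that \<open>\<epsilon>'\<close>
      tends to 0.\<close>
    have "filterlim (\<lambda>\<beta>. \<beta> powr r) at_top (at_top :: real filter)"
    proof (rule filterlim_cong[THEN iffD1, OF refl refl])
      show "filterlim (\<lambda>\<beta>. exp (r * ln \<beta>)) at_top (at_top :: real filter)"
        by (intro filterlim_compose[OF exp_at_top] filterlim_tendsto_pos_mult_at_top[OF tendsto_const r0 ln_at_top])
      show "\<forall>\<^sub>F \<beta> in at_top. exp (r * ln \<beta>) = \<beta> powr r"
        using pos by eventually_elim (simp add: powr_def)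
    qed
    from filterlim_at_top_mult_at_top[OF lim this]
    have \<delta>_top: "filterlim \<delta> at_top at_top"
      by (rule filterlim_cong[THEN iffD1, OF refl refl, rotated])
         (use pos in \<open>eventually_elim, simp\<close>)
    have \<epsilon>'0: "(\<epsilon>' \<longlongrightarrow> 0) at_top"
      unfolding \<epsilon>'_def using d4 by (intro tendsto_neg_powr \<delta>_top) (simp add: divide_neg_pos)
    have lb': "((\<lambda>\<beta>. \<delta> \<beta> * \<epsilon>' \<beta> ^ (?n + 4)) \<longlongrightarrow> 1) at_top"
    proof (rule tendsto_eventually)
      show "\<forall>\<^sub>F \<beta> in at_top. \<delta> \<beta> * \<epsilon>' \<beta> ^ (?n + 4) = 1"
        using pos
      proof eventually_elim
        case (elim \<beta>)
        have "- real (?n + 4) / (4 + d) = - 1" using d4 unfolding d by (simp add: field_simps)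
        then show ?case unfolding \<epsilon>'_def powr_scaling_power[OF \<delta>[OF elim] d4] using \<delta>[OF elim] by (simp add: powr_minus)
      qed
    qed
    \<comment> \<open>The power d + 2 of \<open>\<epsilon>'\<close> is \<delta> to the exponent
      -1/r. So the remaining coefficient is the diverging quotient to the exponent -1/r, and it
      vanishes.\<close>
    have "((\<lambda>\<beta>. (\<delta> \<beta> / \<beta> powr r) powr (- 1 / r)) \<longlongrightarrow> 0) at_top"
      using r0 by (intro tendsto_neg_powr lim) (simp add: divide_neg_pos)
    then have la': "((\<lambda>\<beta>. \<beta> * \<epsilon>' \<beta> ^ (?n + 2)) \<longlongrightarrow> 0) at_top"
    proof (rule Lim_transform_eventually)
      show "\<forall>\<^sub>F \<beta> in at_top. (\<delta> \<beta> / \<beta> powr r) powr (- 1 / r) = \<beta> * \<epsilon>' \<beta> ^ (?n + 2)"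
        using pos
      proof eventually_elim
        case (elim \<beta>)
        have "real (?n + 2) = 2 + d" unfolding d by simp
        then have e: "- real (?n + 2) / (4 + d) = - 1 / r" unfolding r_def by (simp only: divide_divide_eq_right)
        have "(\<delta> \<beta> / \<beta> powr r) powr (- 1 / r) = \<delta> \<beta> powr (- 1 / r) / (\<beta> powr r) powr (- 1 / r)"
          using \<delta>[OF elim] elim by (simp add: powr_divide)
        also have "(\<beta> powr r) powr (- 1 / r) = inverse \<beta>"
          using r0 elim by (simp add: powr_powr powr_minus)
        finally show ?case
          unfolding \<epsilon>'_def powr_scaling_power[OF \<delta>[OF elim] d4] e by (simp add: divide_inverse mult.commute)
      qed
    qed
    have nz: "(1::real) \<noteq> 0" by simp
    note L = rescaled_ground_state_limit[of \<gamma> 0 1 \<delta> \<epsilon>' \<phi>g, OF \<gamma> _ _ _ \<delta> \<epsilon>' gs \<epsilon>'0 la' lb' admissible3_iff[OF nz] energy3_eq]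
    show ?thesis using L by auto
  qed
  show ?thesis
    using case1 case2 case3 unfolding Let_def \<epsilon>_def \<epsilon>'_def r_def by blast
qed

end
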